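(* Let $S=\mathbb{C}[x,y,z]$ and for parameters $(s,t)$ put $$Q_{(s,t)}=xyz\,(tx+sy+tz)(y+z)(x+y+z)(x+sy+tz)\big((-s+t+1)x+(-s+t)z\big)\big(x+(s-t)y\big)\big((-st^2+st+t^3-t)x+(-st+t^2)y+(-st^2+t^3)z\big).$$ Let $\mathcal{L}_{10}^1$ be the arrangement of $10$ lines in the projective plane given by $Q_{(5,3)}=0$, and let $\mathcal{L}_{10}^2$ be the arrangement of $10$ lines given by $Q_{((5\sqrt5+15)/4,\ \sqrt5+3)}=0$. Then the intersection lattices of $\mathcal{L}_{10}^1$ and $\mathcal{L}_{10}^2$ are isomorphic, while the modules $\mathrm{AR}$ have minimal graded free resolutions of the form $$0\to S(-8)\to S(-6)^{\oplus 2}\oplus S(-5)\to \mathrm{AR}(Q_{(5,3)})\to 0,$$ $$0\to S(-8)\oplus S(-7)\to S(-7)\oplus S(-6)^{\oplus 2}\oplus S(-5)\to \mathrm{AR}\big(Q_{((5\sqrt5+15)/4,\ \sqrt5+3)}\big)\to 0.$$ In particular, $\mathcal{L}_{10}^1$ and $\mathcal{L}_{10}^2$ have the same combinatorics but different $\mathrm{AR}$ modules, i.e. they form a Ziegler pair (2nd variant).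
   Context: For a homogeneous polynomial $f\in S=\mathbb{C}[x,y,z]$ defining a reduced plane curve, $\mathrm{AR}(f)=\{(a,b,c)\in S^{\oplus 3}: a\,\partial_x f+b\,\partial_y f+c\,\partial_z f=0\}$, a graded $S$-module whose degree $r$ part consists of triples of forms of degree $r$. The intersection lattice $L(\mathcal{L})$ of a line arrangement $\mathcal{L}\subset\mathbb{P}^2_{\mathbb{C}}$ is the set of all non-empty intersections of (sub)families of lines of $\mathcal{L}$, ordered by reverse inclusion ($X\le Y$ iff $Y\subset X$). Two line arrangements in $\mathbb{P}^2_{\mathbb{C}}$ form a Ziegler pair (2nd variant) if their intersection lattices are isomorphic but they have different $\mathrm{AR}$ modules of algebraic relations; here the $\mathrm{AR}$ modules differ in that their minimal graded free resolutions have different graded Betti numbers. *)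

theory Defs
  imports "HOL-Analysis.Analysis" "HOL-Library.Poly_Mapping"
begin

section \<open>The polynomial ring S = C[x,y,z]\<close>

text \<open>S is the monoid algebra over the complex numbers of the free commutative monoid on the
  three-element index type \<^typ>\<open>3\<close>; the variables x, y, z have the indices 1, 2, 3.  The same type
  indexes the coordinates of a vector in \<^typ>\<open>complex ^ 3\<close>.\<close>

type_synonym mon = "3 \<Rightarrow>\<^sub>0 nat"
type_synonym S = "mon \<Rightarrow>\<^sub>0 complex"

definition Var :: "3 \<Rightarrow> S" where
  "Var i = Poly_Mapping.single (Poly_Mapping.single i 1) 1"

definition Const :: "complex \<Rightarrow> S" where
  "Const c = Poly_Mapping.single 0 c"

definition linear_form :: "complex \<Rightarrow> complex \<Rightarrow> complex \<Rightarrow> S" where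
  "linear_form a b c = Const a * Var 1 + Const b * Var 2 + Const c * Var 3"

definition mon_degree :: "mon \<Rightarrow> nat" where
  "mon_degree m = (\<Sum>i\<in>UNIV. Poly_Mapping.lookup m i)"

definition eval :: "S \<Rightarrow> complex ^ 3 \<Rightarrow> complex" where
  "eval p v = (\<Sum>m\<in>Poly_Mapping.keys p.
     Poly_Mapping.lookup p m * (\<Prod>i\<in>UNIV. (v $ i) ^ Poly_Mapping.lookup m i))"

text \<open>The subtraction of exponents below truncates only for monomials that do not involve
  the variable, and there the coefficient is zero.\<close>

definition partial_deriv :: "3 \<Rightarrow> S \<Rightarrow> S" where
  "partial_deriv i p = (\<Sum>m\<in>Poly_Mapping.keys p.
     Poly_Mapping.single (m - Poly_Mapping.single i 1)
       (of_nat (Poly_Mapping.lookup m i) * Poly_Mapping.lookup p m))"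

definition irrelevant_ideal :: "S set" where
  "irrelevant_ideal = {a * Var 1 + b * Var 2 + c * Var 3 | a b c. True}"


section \<open>Line arrangements in the complex projective plane\<close>

definition proj_plane :: "(complex ^ 3) set set" where
  "proj_plane = {vec.span {v} | v. v \<noteq> 0}"

definition zero_locus :: "S \<Rightarrow> (complex ^ 3) set set" where
  "zero_locus f = {p \<in> proj_plane. \<forall>v\<in>p. eval f v = 0}"

definition proj_line :: "(complex ^ 3) set set \<Rightarrow> bool" where
  "proj_line L \<longleftrightarrow> (\<exists>a b c. (a, b, c) \<noteq> (0, 0, 0) \<and> L = zero_locus (linear_form a b c))"

text \<open>If f is a product of linear forms, the lines contained in the curve f = 0 are exactly
  its components.\<close>

definition arrangement :: "S \<Rightarrow> (complex ^ 3) set set set" where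
  "arrangement f = {L. proj_line L \<and> L \<subseteq> zero_locus f}"

text \<open>The empty subfamily has the whole plane as its intersection.\<close>

definition intersection_lattice :: "(complex ^ 3) set set set \<Rightarrow> (complex ^ 3) set set set" where
  "intersection_lattice A = {X. \<exists>B. B \<subseteq> A \<and> X = proj_plane \<inter> \<Inter>B \<and> X \<noteq> {}}"

definition lattice_le :: "(complex ^ 3) set set \<Rightarrow> (complex ^ 3) set set \<Rightarrow> bool" where
  "lattice_le X Y \<longleftrightarrow> Y \<subseteq> X"

definition isomorphic_lattices ::
  "(complex ^ 3) set set set \<Rightarrow> (complex ^ 3) set set set \<Rightarrow> bool" where
  "isomorphic_lattices A B \<longleftrightarrow>
     (\<exists>h. bij_betw h (intersection_lattice A) (intersection_lattice B) \<and>
          (\<forall>X\<in>intersection_lattice A. \<forall>Y\<in>intersection_lattice A.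
             lattice_le X Y \<longleftrightarrow> lattice_le (h X) (h Y)))"


section \<open>Graded free modules and minimal graded free resolutions\<close>

text \<open>A list [d0, ..., dk] of shifts stands for the graded free module
  S(-d0) + ... + S(-dk).  Its elements are coordinate functions on the natural numbers that vanish
  from the length of the list on.  Since the degree r part of S(-d) is the degree r - d part of S,
  an element is homogeneous of degree r if each monomial of its i-th coordinate has
  degree r - di; in degrees below di the i-th coordinate must vanish.\<close>

type_synonym shifts = "nat list"

definition free_module :: "shifts \<Rightarrow> (nat \<Rightarrow> S) set" where
  "free_module ds = {v. \<forall>i\<ge>length ds. v i = 0}"

definition graded_part :: "shifts \<Rightarrow> nat \<Rightarrow> (nat \<Rightarrow> S) set" where
  "graded_part ds r = {v \<in> free_module ds.
     \<forall>i<length ds. \<forall>m\<in>Poly_Mapping.keys (v i). mon_degree m + ds ! i = r}"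

definition graded_hom :: "shifts \<Rightarrow> shifts \<Rightarrow> ((nat \<Rightarrow> S) \<Rightarrow> (nat \<Rightarrow> S)) \<Rightarrow> bool" where
  "graded_hom ds es \<phi> \<longleftrightarrow>
     \<phi> ` free_module ds \<subseteq> free_module es \<and>
     (\<forall>v\<in>free_module ds. \<forall>w\<in>free_module ds. \<phi> (\<lambda>i. v i + w i) = (\<lambda>i. \<phi> v i + \<phi> w i)) \<and>
     (\<forall>c. \<forall>v\<in>free_module ds. \<phi> (\<lambda>i. c * v i) = (\<lambda>i. c * \<phi> v i)) \<and>
     (\<forall>r. \<phi> ` graded_part ds r \<subseteq> graded_part es r)"

text \<open>A minimal graded free resolution
  ... \<open>\<rightarrow>\<close> F 2 \<open>\<rightarrow>\<close> F 1 \<open>\<rightarrow>\<close> F 0 \<open>\<rightarrow>\<close> M \<open>\<rightarrow>\<close> 0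
  of a graded submodule M of the free module with shifts es.  The augmentation \<open>\<phi> 0\<close> is
  composed with the inclusion of M, and \<open>\<phi> (Suc i)\<close> maps F (i + 1) to F i.  The resolution
  is finite if F is eventually the empty list, which stands for the zero module.\<close>

definition minimal_graded_resolution ::
  "shifts \<Rightarrow> (nat \<Rightarrow> S) set \<Rightarrow> (nat \<Rightarrow> shifts) \<Rightarrow> (nat \<Rightarrow> (nat \<Rightarrow> S) \<Rightarrow> (nat \<Rightarrow> S)) \<Rightarrow> bool" where
  "minimal_graded_resolution es M F \<phi> \<longleftrightarrow>
     graded_hom (F 0) es (\<phi> 0) \<and>
     \<phi> 0 ` free_module (F 0) = M \<and>
     (\<forall>i. graded_hom (F (Suc i)) (F i) (\<phi> (Suc i))) \<and>
     (\<forall>i. \<phi> (Suc i) ` free_module (F (Suc i)) = {v \<in> free_module (F i). \<phi> i v = (\<lambda>_. 0)}) \<and>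
     (\<forall>i. \<forall>v\<in>free_module (F (Suc i)). \<forall>k. \<phi> (Suc i) v k \<in> irrelevant_ideal)"

definition has_minimal_graded_resolution ::
  "shifts \<Rightarrow> (nat \<Rightarrow> S) set \<Rightarrow> (nat \<Rightarrow> shifts) \<Rightarrow> bool" where
  "has_minimal_graded_resolution es M F \<longleftrightarrow> (\<exists>\<phi>. minimal_graded_resolution es M F \<phi>)"

text \<open>The finite sequence of free modules Fs ! 0, Fs ! 1, ..., continued by zero modules.\<close>

definition finite_resolution :: "shifts list \<Rightarrow> nat \<Rightarrow> shifts" where
  "finite_resolution Fs i = (if i < length Fs then Fs ! i else [])"

definition graded_betti :: "(nat \<Rightarrow> shifts) \<Rightarrow> nat \<Rightarrow> nat \<Rightarrow> nat" where
  "graded_betti F i j = count_list (F i) j"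

definition different_graded_betti :: "shifts \<Rightarrow> (nat \<Rightarrow> S) set \<Rightarrow> (nat \<Rightarrow> S) set \<Rightarrow> bool" where
  "different_graded_betti es M N \<longleftrightarrow>
     (\<exists>F. has_minimal_graded_resolution es M F) \<and>
     (\<exists>G. has_minimal_graded_resolution es N G) \<and>
     (\<forall>F G. has_minimal_graded_resolution es M F \<longrightarrow> has_minimal_graded_resolution es N G \<longrightarrow>
            graded_betti F \<noteq> graded_betti G)"


section \<open>Algebraic relations of the partial derivatives and Ziegler pairs\<close>

definition AR :: "S \<Rightarrow> (nat \<Rightarrow> S) set" where
  "AR f = {v \<in> free_module [0, 0, 0].
     v 0 * partial_deriv 1 f + v 1 * partial_deriv 2 f + v 2 * partial_deriv 3 f = 0}"

definition ziegler_pair_2 :: "S \<Rightarrow> S \<Rightarrow> bool" where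
  "ziegler_pair_2 f g \<longleftrightarrow>
     isomorphic_lattices (arrangement f) (arrangement g) \<and>
     different_graded_betti [0, 0, 0] (AR f) (AR g)"

definition Q :: "complex \<Rightarrow> complex \<Rightarrow> S" where
  "Q s t =
     Var 1 * Var 2 * Var 3
     * linear_form t s t
     * linear_form 0 1 1
     * linear_form 1 1 1
     * linear_form 1 s t
     * linear_form (- s + t + 1) 0 (- s + t)
     * linear_form 1 (s - t) 0
     * linear_form (- s * t\<^sup>2 + s * t + t ^ 3 - t) (- s * t + t\<^sup>2) (- s * t\<^sup>2 + t ^ 3)"

end

theory Submission
  imports Defs
begin

text \<open>The proof rests on a hidden symmetry.  Both arrangements contain the line \<open>X = 0\<close>, and there are
two further linear forms such that the other nine lines are \<open>L k - m k * X = 0\<close> and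
\<open>L k + m k * X = 0\<close> for \<open>k < 4\<close>, together with \<open>L 4 = 0\<close>, where every \<open>L k\<close> is a combination of these
two forms.  In the affine chart \<open>X = 1\<close> these are four pairs of parallels, each symmetric about the
origin, and one line through the origin.

An algebraic relation of the partial derivatives of \<open>f\<close> is a derivation that annihilates \<open>f\<close>.  It
preserves every line of the arrangement.  After subtraction of a multiple of the Euler field it
annihilates \<open>X\<close>, and it is then described by its values \<open>(A, B)\<close> on the two forms.  The multiple can
be recovered, because the Euler field multiplies \<open>f\<close> by 10 and the difference must annihilate \<open>f\<close>.
Hence \<open>AR f\<close> is isomorphic, as a graded module, to the module of the pairs \<open>(A, B)\<close> that are
tangent to the nine lines (\<open>AR_tangent_coords\<close>, \<open>tangent_lift\<close>, \<open>resolution_of_tangent_fields\<close>).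

This module has rank two.  The determinant of two tangent pairs is divisible by the product \<open>\<Delta>\<close> of
the nine lines (\<open>saito_dvd\<close>), so the determinants of an arbitrary tangent pair with the chosen
generators are multiples of \<open>\<Delta>\<close>, and the quotients satisfy the same linear relations as the
generators.  In the first arrangement there are three generators, of degrees 5, 6, 6, and the
coefficients of their single relation form a regular sequence; exactness of the Koszul complex then
shows that the quotients are those of a combination of the generators (\<open>three_pairs.generate\<close>).  In
the second arrangement the relation of lowest degree is \<open>X\<^sup>2 g1 = U g2 + V g3\<close>, where \<open>U\<close> and \<open>V\<close> are
linear.  The determinants of \<open>g1\<close>, \<open>g2\<close>, \<open>g3\<close> have the additional common factor \<open>U\<close>, and a fourth
generator of degree 7 is needed; here the quotients are first corrected modulo \<open>U\<close> and then
modulo \<open>V\<close> (\<open>four_pairs.generate\<close>).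

The degrees of the generators in any minimal resolution of \<open>M\<close> are the degrees in which \<open>M\<close> is not
contained in the product of the irrelevant ideal with \<open>M\<close> (\<open>generator_degree_iff\<close>).  Degree 7 occurs
for the second arrangement only, so the graded Betti numbers differ.  The intersection lattice of
lines in the plane is determined by the triples of concurrent lines
(\<open>isomorphic_lattices_of_triples\<close>), and these are found from determinants of the coefficients of the
lines, which are integral combinations of 1 and the golden ratio.\<close>

section \<open>The polynomial ring\<close>

abbreviation lookup where "lookup \<equiv> Poly_Mapping.lookup"
abbreviation keys where "keys \<equiv> Poly_Mapping.keys"
abbreviation single where "single \<equiv> Poly_Mapping.single"

lemma Const_0 [simp]: "Const 0 = 0"
  and Const_1 [simp]: "Const 1 = 1"
  and Const_numeral [simp]: "Const (numeral n) = numeral n"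
  by (simp_all add: Const_def)

lemma Const_add: "Const (a + b) = Const a + Const b"
  and Const_uminus [simp]: "Const (- a) = - Const a"
  and Const_diff: "Const (a - b) = Const a - Const b"
  and Const_mult: "Const (a * b) = Const a * Const b"
  by (simp_all add: Const_def single_add single_uminus single_diff mult_single)

lemma Const_eq_0_iff [simp]: "Const a = 0 \<longleftrightarrow> a = 0"
  by (metis Const_def lookup_single_eq lookup_zero single_zero)

lemma poly_mapping_sum_singles: "(p :: S) = (\<Sum>m\<in>keys p. single m (lookup p m))"
  by (rule poly_mapping_eqI) (auto simp: lookup_sum lookup_single when_def in_keys_iff)

lemma S_induct [case_names monomial add]:
  assumes mono: "\<And>m c. P (single m c)" and add: "\<And>p q. P p \<Longrightarrow> P q \<Longrightarrow> P (p + q)"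
  shows "P (p :: S)"
proof -
  have "P (\<Sum>m\<in>A. single m (lookup p m))" if "finite A" for A
    using that by (induction A rule: finite_induct) (use mono[of 0 0] in \<open>auto intro: mono add\<close>)
  then show ?thesis by (metis poly_mapping_sum_singles finite_keys)
qed

lemma keys_sum_superset:
  fixes g :: "mon \<Rightarrow> complex \<Rightarrow> 'b :: comm_monoid_add"
  assumes "finite A" "keys p \<subseteq> A" "\<And>m. g m 0 = 0"
  shows "(\<Sum>m\<in>keys p. g m (lookup p m)) = (\<Sum>m\<in>A. g m (lookup p m))"
  using assms by (intro sum.mono_neutral_left) (auto simp: in_keys_iff)

lemma keys_sum_add:
  fixes g :: "mon \<Rightarrow> complex \<Rightarrow> 'b :: comm_monoid_add"
  assumes g0: "\<And>m. g m 0 = 0" and gadd: "\<And>m a b. g m (a + b) = g m a + g m b"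
  shows "(\<Sum>m\<in>keys (p + q). g m (lookup (p + q) m))
       = (\<Sum>m\<in>keys p. g m (lookup p m)) + (\<Sum>m\<in>keys q. g m (lookup q m))"
proof -
  let ?A = "keys p \<union> keys q"
  have fin: "finite ?A" by simp
  have s: "(\<Sum>m\<in>keys r. g m (lookup r m)) = (\<Sum>m\<in>?A. g m (lookup r m))" if "keys r \<subseteq> ?A" for r
    by (rule keys_sum_superset) (use fin that g0 in auto)
  show ?thesis
    by (subst (1 2 3) s) (use keys_add[of p q] in \<open>auto simp: lookup_add gadd sum.distrib\<close>)
qed

subsection \<open>Substitution\<close>

text \<open>Evaluation at a point and restriction to a plane are both substitutions; they differ
  in the coefficient map.\<close>

definition insertion :: "(complex \<Rightarrow> 'b :: comm_ring_1) \<Rightarrow> (3 \<Rightarrow> 'b) \<Rightarrow> S \<Rightarrow> 'b" where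
  "insertion g \<sigma> p = (\<Sum>m\<in>keys p. g (lookup p m) * (\<Prod>i\<in>UNIV. \<sigma> i ^ lookup m i))"

locale coeff_hom =
  fixes g :: "complex \<Rightarrow> 'b :: comm_ring_1"
  assumes g_0: "g 0 = 0" and g_1: "g 1 = 1"
    and g_add: "g (a + b) = g a + g b" and g_mult: "g (a * b) = g a * g b"
begin

lemma insertion_single: "insertion g \<sigma> (single m c) = g c * (\<Prod>i\<in>UNIV. \<sigma> i ^ lookup m i)"
  by (cases "c = 0") (auto simp: insertion_def g_0)

lemma insertion_add: "insertion g \<sigma> (p + q) = insertion g \<sigma> p + insertion g \<sigma> q"
  unfolding insertion_def
  by (rule keys_sum_add) (auto simp: g_0 g_add algebra_simps)

lemma insertion_mult: "insertion g \<sigma> (p * q) = insertion g \<sigma> p * insertion g \<sigma> q"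
proof (induction p rule: S_induct)
  case (monomial m c)
  show ?case
  proof (induction q rule: S_induct)
    case (monomial n d)
    then show ?case
      by (simp add: mult_single insertion_single g_mult lookup_add power_add prod.distrib algebra_simps)
  qed (simp add: insertion_add algebra_simps)
qed (simp add: insertion_add algebra_simps)

lemma insertion_Const: "insertion g \<sigma> (Const c) = g c"
  by (simp add: Const_def insertion_single)

lemma insertion_Var: "insertion g \<sigma> (Var i) = \<sigma> i"
proof -
  have "(\<Prod>j\<in>UNIV. \<sigma> j ^ lookup (single i 1) j) = (\<Prod>j\<in>UNIV. if j = i then \<sigma> i else 1)"
    by (rule prod.cong) (auto simp: lookup_single when_def)
  then show ?thesis by (simp add: Var_def insertion_single g_1)
qed

lemma insertion_0: "insertion g \<sigma> 0 = 0" and insertion_1: "insertion g \<sigma> 1 = 1"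
  using insertion_Const[of \<sigma> 0] insertion_Const[of \<sigma> 1] by (simp_all add: g_0 g_1)

lemma insertion_uminus: "insertion g \<sigma> (- p) = - insertion g \<sigma> p"
  using insertion_add[of \<sigma> p "- p"] by (simp add: insertion_0 eq_neg_iff_add_eq_0 add.commute)

lemma insertion_diff: "insertion g \<sigma> (p - q) = insertion g \<sigma> p - insertion g \<sigma> q"
  using insertion_add[of \<sigma> p "- q"] by (simp add: insertion_uminus)

lemma insertion_power: "insertion g \<sigma> (p ^ k) = insertion g \<sigma> p ^ k"
  by (induction k) (simp_all add: insertion_1 insertion_mult)

lemma insertion_numeral: "insertion g \<sigma> (numeral k) = g (numeral k)"
  using insertion_Const[of \<sigma> "numeral k"] by simp

lemmas insertion_simps =
  insertion_add insertion_mult insertion_Const insertion_Var insertion_0 insertion_1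
  insertion_uminus insertion_diff insertion_power insertion_numeral

end

interpretation evalhom: coeff_hom "\<lambda>c. c" by standard auto
interpretation substhom: coeff_hom Const by standard (auto simp: Const_add Const_mult)

lemma eval_eq: "eval p v = insertion (\<lambda>c. c) (($) v) p"
  by (simp add: eval_def insertion_def)

lemma eval_simps:
  "eval (p + q) v = eval p v + eval q v" "eval (p * q) v = eval p v * eval q v"
  "eval (Const c) v = c" "eval (Var i) v = v $ i" "eval 0 v = 0" "eval 1 v = 1"
  "eval (- p) v = - eval p v" "eval (p - q) v = eval p v - eval q v" "eval (p ^ k) v = eval p v ^ k"
  "eval (numeral n) v = numeral n"
  by (simp_all add: eval_eq evalhom.insertion_simps)

lemma eval_prod: "eval (\<Prod>i\<in>I. f i) v = (\<Prod>i\<in>I. eval (f i) v)"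
  by (induction I rule: infinite_finite_induct) (auto simp: eval_simps)

subsection \<open>Linear forms\<close>

definition lf :: "complex ^ 3 \<Rightarrow> S" where
  "lf u = linear_form (u $ 1) (u $ 2) (u $ 3)"

definition dot :: "complex ^ 3 \<Rightarrow> complex ^ 3 \<Rightarrow> complex" where
  "dot u v = u $ 1 * v $ 1 + u $ 2 * v $ 2 + u $ 3 * v $ 3"

lemma dot_simps:
  "dot (u + u') v = dot u v + dot u' v" "dot (u - u') v = dot u v - dot u' v"
  "dot (c *s u) v = c * dot u v" "dot u (v + v') = dot u v + dot u v'"
  "dot u (v - v') = dot u v - dot u v'" "dot u (c *s v) = c * dot u v"
  "dot 0 v = 0" "dot u 0 = 0"
  by (simp_all add: dot_def algebra_simps)

lemma lf_simps:
  "lf (u + v) = lf u + lf v" "lf (u - v) = lf u - lf v" "lf (c *s u) = Const c * lf u" "lf 0 = 0"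
  by (simp_all add: lf_def linear_form_def Const_add Const_mult Const_diff algebra_simps)

lemma eval_lf: "eval (lf u) v = dot u v"
  by (simp add: lf_def linear_form_def eval_simps dot_def)

lemma exists_dot_eq_1:
  assumes "u \<noteq> 0" shows "\<exists>a. dot u a = 1"
proof -
  obtain i where "u $ i \<noteq> 0" using assms by (auto simp: vec_eq_iff)
  then have "dot u (axis i (1 / u $ i)) = 1"
    using exhaust_3[of i] by (auto simp: dot_def axis_def)
  then show ?thesis by blast
qed

lemma lf_inject: "lf u = lf v \<longleftrightarrow> u = v"
proof
  assume "lf u = lf v"
  then have "dot (u - v) w = 0" for w by (metis eval_lf dot_simps(2) right_minus_eq)
  then show "u = v" using exists_dot_eq_1[of "u - v"] by force
qed simp

lemma lf_eq_0_iff [simp]: "lf u = 0 \<longleftrightarrow> u = 0"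
  using lf_inject[of u 0] by (simp add: lf_simps)

text \<open>Restriction of a polynomial to the plane of zeros of \<open>lf u\<close>, realised as the polynomial on all
  of space that is constant along the direction \<open>a\<close>; here \<open>dot u a = 1\<close>.\<close>

definition restrict_to :: "complex ^ 3 \<Rightarrow> complex ^ 3 \<Rightarrow> S \<Rightarrow> S" where
  "restrict_to u a = insertion Const (\<lambda>i. Var i - Const (a $ i) * lf u)"

lemmas restrict_to_simps = substhom.insertion_simps[where \<sigma> = "\<lambda>i. Var i - Const (a $ i) * lf u" for a u,
    folded restrict_to_def]

lemma restrict_to_lf: "restrict_to u a (lf v) = lf (v - dot v a *s u)"
  unfolding lf_simps
  by (simp add: lf_def[of v] linear_form_def restrict_to_simps dot_def Const_add Const_mult algebra_simps)

lemma restrict_to_dvd: "lf u dvd p - restrict_to u a p"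
proof (induction p rule: S_induct)
  case (monomial m c)
  have pw: "lf u dvd x ^ n - y ^ n" if "lf u dvd x - y" for x y :: S and n
    using that by (metis dvd_mult2 power_diff_sumr2)
  have mul: "lf u dvd x * x' - y * y'" if "lf u dvd x - y" "lf u dvd x' - y'" for x y x' y'
  proof -
    have "x * x' - y * y' = (x - y) * x' + y * (x' - y')" by (simp add: algebra_simps)
    then show ?thesis using that by (simp add: dvd_add)
  qed
  have V: "lf u dvd Var i - restrict_to u a (Var i)" for i
    by (simp add: restrict_to_simps)
  have prod_single: "(\<Prod>i\<in>I. Var i ^ lookup m i) = single (\<Sum>i\<in>I. single i (lookup m i)) 1" for I
  proof (induction I rule: infinite_finite_induct)
    case (insert i I)
    have "Var i ^ n = single (single i n) 1" for n
      by (induction n) (auto simp: Var_def mult_single simp flip: single_add)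
    with insert show ?case by (simp add: mult_single)
  qed auto
  have "m = (\<Sum>i\<in>UNIV. single i (lookup m i))"
    by (rule poly_mapping_eqI) (auto simp: lookup_sum lookup_single when_def)
  then have eq: "single m c = Const c * (\<Prod>i\<in>UNIV. Var i ^ lookup m i)"
    unfolding prod_single by (simp add: Const_def mult_single)
  show ?case unfolding eq UNIV_3
    by (simp add: restrict_to_simps(2,3,9)) (intro mul pw V, simp)
next
  case (add p q)
  then show ?case by (simp add: restrict_to_simps) (metis add_diff_add dvd_add)
qed

lemma lf_dvd_iff: assumes "dot u a = 1" shows "lf u dvd p \<longleftrightarrow> restrict_to u a p = 0"
proof
  assume "lf u dvd p"
  then obtain q where "p = lf u * q" by (elim dvdE)
  then show "restrict_to u a p = 0" using assms by (simp add: restrict_to_simps restrict_to_lf lf_simps)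
next
  assume "restrict_to u a p = 0"
  then show "lf u dvd p" using restrict_to_dvd[of u p a] by simp
qed

text \<open>Divisibility by a linear form is membership in the kernel of a ring homomorphism into
  a domain.\<close>

lemma prime_elem_lf: assumes "u \<noteq> 0" shows "prime_elem (lf u)"
proof -
  obtain a where a: "dot u a = 1" using exists_dot_eq_1[OF assms] by blast
  show ?thesis using assms
    by (intro prime_elemI) (auto simp: lf_dvd_iff[OF a] restrict_to_simps)
qed

lemma lf_dvd_lf_imp: assumes "u \<noteq> 0" "lf u dvd lf v" shows "\<exists>c. v = c *s u"
proof -
  obtain a where a: "dot u a = 1" using exists_dot_eq_1[OF assms(1)] by blast
  have "v - dot v a *s u = 0" using assms(2) by (simp add: lf_dvd_iff[OF a] restrict_to_lf)
  then show ?thesis by (metis eq_iff_diff_eq_0)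
qed

subsection \<open>Derivations\<close>

lemma partial_deriv_single:
  "partial_deriv i (single m c) = single (m - single i 1) (of_nat (lookup m i) * c)"
  by (cases "c = 0") (auto simp: partial_deriv_def)

lemma partial_deriv_add: "partial_deriv i (p + q) = partial_deriv i p + partial_deriv i q"
  unfolding partial_deriv_def
  by (rule keys_sum_add) (auto simp: single_add algebra_simps)

text \<open>The truncated subtraction of exponents does no harm, because both sides vanish if the
  monomial \<open>m\<close> does not involve the variable.\<close>

lemma monomial_shift:
  fixes m n :: mon
  shows "single (m + n - single i 1) (of_nat (lookup m i) * (a * b))
       = single (m - single i 1) (of_nat (lookup m i) * a) * single n (b :: complex)"
proof (cases "lookup m i = 0")
  case False
  have "m + n - single i 1 = (m - single i 1) + n"
    by (rule poly_mapping_eqI) (use False in \<open>auto simp: lookup_minus lookup_add lookup_single when_def\<close>)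
  then show ?thesis by (simp add: mult_single algebra_simps)
qed simp

lemma partial_deriv_mult:
  "partial_deriv i (p * q) = partial_deriv i p * q + p * partial_deriv i q"
proof (induction p rule: S_induct)
  case (monomial m c)
  show ?case
  proof (induction q rule: S_induct)
    case (monomial n d)
    have "partial_deriv i (single m c * single n d)
        = single (m + n - single i 1) (of_nat (lookup m i) * (c * d))
        + single (n + m - single i 1) (of_nat (lookup n i) * (d * c))"
      by (simp add: mult_single partial_deriv_single lookup_add algebra_simps flip: single_add)
    also have "\<dots> = partial_deriv i (single m c) * single n d + single m c * partial_deriv i (single n d)"
      by (simp only: monomial_shift partial_deriv_single mult.commute[of "single m c"])
    finally show ?case .
  qed (simp add: partial_deriv_add algebra_simps)
qed (simp add: partial_deriv_add algebra_simps)

lemma partial_deriv_Const: "partial_deriv i (Const c) = 0"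
  by (simp add: Const_def partial_deriv_single)

lemma partial_deriv_Var: "partial_deriv i (Var j) = (if i = j then 1 else 0)"
  by (auto simp: Var_def partial_deriv_single lookup_single when_def)

lemma partial_deriv_diff: "partial_deriv i (p - q) = partial_deriv i p - partial_deriv i q"
  using partial_deriv_add[of i "p - q" q] by simp

text \<open>The triple \<open>v\<close> as a derivation of \<open>S\<close>. The algebraic
  relations of \<open>f\<close> are the derivations that annihilate \<open>f\<close>.\<close>

definition der :: "(nat \<Rightarrow> S) \<Rightarrow> S \<Rightarrow> S" where
  "der v p = v 0 * partial_deriv 1 p + v 1 * partial_deriv 2 p + v 2 * partial_deriv 3 p"

lemma der_simps:
  "der v (p + q) = der v p + der v q" "der v (p * q) = der v p * q + p * der v q"
  "der v (p - q) = der v p - der v q" "der v (Const c) = 0" "der v 1 = 0"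
  by (simp_all add: der_def partial_deriv_diff partial_deriv_Const[of _ 1, simplified] partial_deriv_add partial_deriv_mult partial_deriv_Const algebra_simps)

lemma der_vector_simps:
  "der (\<lambda>i. v i + w i) p = der v p + der w p" "der (\<lambda>i. c * v i) p = c * der v p"
  "der (\<lambda>i. v i - w i) p = der v p - der w p" "der (\<lambda>i. \<Sum>j\<in>J. f j i) p = (\<Sum>j\<in>J. der (f j) p)"
  by (simp_all add: der_def algebra_simps sum.distrib sum_distrib_left)

lemma der_lf: "der v (lf u) = Const (u $ 1) * v 0 + Const (u $ 2) * v 1 + Const (u $ 3) * v 2"
proof -
  have "(1::3) \<noteq> 2" "(1::3) \<noteq> 3" "(2::3) \<noteq> 3" by auto
  then show ?thesis
    by (simp add: lf_def linear_form_def der_def partial_deriv_add partial_deriv_mult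
        partial_deriv_Const partial_deriv_Var algebra_simps)
qed

lemma der_prod:
  assumes "finite I" "\<And>i. i \<in> I \<Longrightarrow> der v (g i) = c i * g i"
  shows "der v (\<Prod>i\<in>I. g i) = (\<Sum>i\<in>I. c i) * (\<Prod>i\<in>I. g i)"
  using assms
  by (induction I rule: finite_induct)
     (auto simp: der_simps algebra_simps)

section \<open>Line arrangements and their intersection lattices\<close>

definition det3 :: "complex ^ 3 \<Rightarrow> complex ^ 3 \<Rightarrow> complex ^ 3 \<Rightarrow> complex" where
  "det3 u v w = u $ 1 * (v $ 2 * w $ 3 - v $ 3 * w $ 2)
    - u $ 2 * (v $ 1 * w $ 3 - v $ 3 * w $ 1) + u $ 3 * (v $ 1 * w $ 2 - v $ 2 * w $ 1)"

definition cross :: "complex ^ 3 \<Rightarrow> complex ^ 3 \<Rightarrow> complex ^ 3" where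
  "cross u v = vector [u $ 2 * v $ 3 - u $ 3 * v $ 2, u $ 3 * v $ 1 - u $ 1 * v $ 3,
     u $ 1 * v $ 2 - u $ 2 * v $ 1]"

lemma dot_cross: "dot (cross u v) w = det3 u v w" "dot w (cross u v) = det3 u v w"
  by (simp_all add: dot_def cross_def det3_def algebra_simps)

lemma det3_degenerate: "det3 u v u = 0" "det3 u v v = 0" "det3 u u v = 0"
  by (simp_all add: det3_def algebra_simps)

lemma det3_permute:
  "det3 u v w = - det3 u w v" "det3 u v w = - det3 v u w" "det3 u v w = det3 v w u"
  "det3 u v w = det3 w u v" "det3 u v w = - det3 w v u"
  by (simp_all add: det3_def algebra_simps)

text \<open>A vector orthogonal to two independent vectors is a multiple of their cross product;
  this is stated without division as an identity of components.\<close>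

lemma orthogonal_to_independent_pair:
  assumes "dot u w = 0" "dot v w = 0" "cross u v \<noteq> 0" "det3 u v x = 0"
  shows "dot x w = 0"
proof -
  have "dot x w *s cross u v = det3 u v x *s w"
    using assms(1,2) unfolding vec_eq_iff forall_3 by (simp add: dot_def cross_def det3_def) algebra
  then show ?thesis using assms(3,4) by simp
qed

lemma orthogonal_to_basis:
  assumes "dot u w = 0" "dot v w = 0" "dot x w = 0" "w \<noteq> 0"
  shows "det3 u v x = 0"
proof -
  have "det3 u v x *s w = 0"
    using assms(1-3) unfolding vec_eq_iff forall_3 by (simp add: dot_def det3_def) algebra
  then show ?thesis using assms(4) by simp
qed

subsection \<open>The components of a product of linear forms\<close>

definition line :: "complex ^ 3 \<Rightarrow> (complex ^ 3) set set" where
  "line u = zero_locus (lf u)"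

lemma proj_line_iff: "proj_line L \<longleftrightarrow> (\<exists>u. u \<noteq> 0 \<and> L = line u)"
proof
  assume "proj_line L"
  then obtain a b c where abc: "(a, b, c) \<noteq> (0, 0, 0)" "L = zero_locus (linear_form a b c)"
    by (auto simp: proj_line_def)
  then show "\<exists>u. u \<noteq> 0 \<and> L = line u"
    by (intro exI[of _ "vector [a, b, c]"]) (auto simp: line_def lf_def vec_eq_iff forall_3)
next
  assume "\<exists>u. u \<noteq> 0 \<and> L = line u"
  then obtain u where u: "u \<noteq> 0" "L = line u" by blast
  then have "(u $ 1, u $ 2, u $ 3) \<noteq> (0, 0, 0)" by (auto simp: vec_eq_iff forall_3)
  then show "proj_line L" using u(2) unfolding proj_line_def line_def lf_def by blast
qed

lemma span_in_line: "w \<noteq> 0 \<Longrightarrow> vec.span {w} \<in> line u \<longleftrightarrow> dot u w = 0"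
proof -
  assume w: "w \<noteq> 0"
  have "(\<forall>v\<in>vec.span {w}. dot u v = 0) \<longleftrightarrow> dot u w = 0"
    by (auto simp: vec.span_singleton dot_simps dest: bspec[of _ _ w] intro: vec.span_base)
  then show ?thesis using w by (auto simp: line_def zero_locus_def eval_lf proj_plane_def)
qed

text \<open>The points \<open>(1, t, t\<^sup>2)\<close> lie on a conic, which meets every line in
  at most two points.\<close>

lemma generic_point:
  assumes "finite U" "0 \<notin> U" shows "\<exists>v. \<forall>u\<in>U. dot u v \<noteq> 0"
proof -
  define pu where "pu u = [:u $ 1, u $ 2, u $ 3:]" for u :: "complex ^ 3"
  have "pu u \<noteq> 0" if "u \<in> U" for u
  proof -
    have "u \<noteq> 0" using that assms(2) by blast
    then show ?thesis by (auto simp: pu_def vec_eq_iff forall_3)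
  qed
  then have "finite (\<Union>u\<in>U. {t. poly (pu u) t = 0})"
    using assms(1) by (intro finite_UN_I poly_roots_finite) auto
  then obtain t where "t \<notin> (\<Union>u\<in>U. {t. poly (pu u) t = 0})"
    using ex_new_if_finite infinite_UNIV_char_0 by blast
  then have "\<forall>u\<in>U. dot u (vector [1, t, t\<^sup>2]) \<noteq> 0"
    by (auto simp: pu_def dot_def algebra_simps power2_eq_square)
  then show ?thesis by blast
qed

lemma line_scale: "c \<noteq> 0 \<Longrightarrow> line (c *s u) = line u"
  by (simp add: line_def zero_locus_def eval_lf dot_simps)

lemma line_inject:
  assumes "u \<noteq> 0" "v \<noteq> 0" "line u = line v" shows "cross u v = 0"
proof (rule ccontr)
  assume nz: "cross u v \<noteq> 0"
  obtain x where x: "dot (cross u v) x = 1" using exists_dot_eq_1[OF nz] by blast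
  define w where "w = cross u x"
  have vw: "dot v w = - 1" using x by (simp add: w_def dot_cross) (simp add: det3_def algebra_simps)
  then have "w \<noteq> 0" by (auto simp: dot_simps)
  moreover have "dot u w = 0" by (simp add: w_def dot_cross det3_degenerate)
  ultimately show False using span_in_line[of w u] span_in_line[of w v] vw assms(3) by simp
qed

text \<open>If a line is not a component of the curve, then every factor restricts to a nonzero
  linear form on it, and a point of the line outside the zeros of all these forms is not on the
  curve.\<close>

lemma arrangement_prod:
  fixes us :: "nat \<Rightarrow> complex ^ 3"
  assumes "\<kappa> \<noteq> 0" "\<And>i. i < n \<Longrightarrow> us i \<noteq> 0"
  shows "arrangement (Const \<kappa> * (\<Prod>i<n. lf (us i))) = (\<lambda>i. line (us i)) ` {..<n}" (is "arrangement ?f = _")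
proof (intro equalityI subsetI)
  fix L assume "L \<in> arrangement ?f"
  then obtain u where u: "u \<noteq> 0" "L = line u" "line u \<subseteq> zero_locus ?f"
    by (auto simp: arrangement_def proj_line_iff)
  obtain a where a: "dot u a = 1" using exists_dot_eq_1[OF u(1)] by blast
  define U where "U = (\<lambda>i. us i - dot (us i) a *s u) ` {..<n}"
  have "0 \<in> U"
  proof (rule ccontr)
    assume "0 \<notin> U"
    then obtain v where v: "\<forall>x\<in>U. dot x v \<noteq> 0"
      using generic_point[of U] by (auto simp: U_def)
    \<comment> \<open>The point must be nonzero also for the empty product, where nothing
      constrains it.\<close>
    obtain y where y: "dot u y = 0" "y \<noteq> 0"
    proof -
      have "cross u (axis 1 1) \<noteq> 0 \<or> cross u (axis 2 1) \<noteq> 0"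
        using u(1) by (auto simp: cross_def vec_eq_iff forall_3 axis_def)
      then show ?thesis using that by (metis dot_cross(2) det3_degenerate(1))
    qed
    define w where "w = v - dot u v *s a"
    have uw: "dot u w = 0" by (simp add: w_def dot_simps a)
    have uiw: "dot (us i) w \<noteq> 0" if "i < n" for i
    proof -
      have "dot (us i) w = dot (us i - dot (us i) a *s u) v" by (simp add: w_def dot_simps algebra_simps)
      then show ?thesis using v that by (auto simp: U_def)
    qed
    define z where "z = (if w = 0 then y else w)"
    have z: "z \<noteq> 0" "dot u z = 0" "\<And>i. i < n \<Longrightarrow> dot (us i) z \<noteq> 0"
      using uw uiw y by (auto simp: z_def dot_simps)
    have "vec.span {z} \<in> zero_locus ?f" using u(3) z span_in_line by blast
    then have "eval ?f z = 0" by (auto simp: zero_locus_def intro: vec.span_base)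
    then show False using z(3) assms(1) by (simp add: eval_simps eval_prod eval_lf)
  qed
  then obtain i where i: "i < n" "us i = dot (us i) a *s u" by (auto simp: U_def)
  then have "line (us i) = line u" using assms(2) line_scale by (metis vector_smult_lzero)
  then show "L \<in> (\<lambda>i. line (us i)) ` {..<n}" using i u(2) by blast
next
  fix L assume "L \<in> (\<lambda>i. line (us i)) ` {..<n}"
  then obtain i where i: "i < n" "L = line (us i)" by blast
  have "L \<subseteq> zero_locus ?f"
    using i by (auto simp: line_def zero_locus_def eval_simps eval_prod)
  then show "L \<in> arrangement ?f" using i assms(2) by (auto simp: arrangement_def proj_line_iff)
qed

lemma card_arrangement_prod:
  fixes us :: "nat \<Rightarrow> complex ^ 3"
  assumes "\<kappa> \<noteq> 0" "\<And>i. i < n \<Longrightarrow> us i \<noteq> 0"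
    "\<And>i j. i < n \<Longrightarrow> j < n \<Longrightarrow> i \<noteq> j \<Longrightarrow> cross (us i) (us j) \<noteq> 0"
  shows "card (arrangement (Const \<kappa> * (\<Prod>i<n. lf (us i)))) = n"
proof -
  have "inj_on (\<lambda>i. line (us i)) {..<n}"
  proof (rule inj_onI, rule ccontr)
    fix i j assume "i \<in> {..<n}" "j \<in> {..<n}" "line (us i) = line (us j)" "i \<noteq> j"
    then show False using line_inject[of "us i" "us j"] assms(2,3) by simp
  qed
  then show ?thesis by (simp add: arrangement_prod assms(1,2) card_image)
qed

subsection \<open>The lattice is determined by the collinear triples\<close>

text \<open>The zero vector is left out, because it represents no point; hence the flat of a subfamily is empty
  if and only if this set is.\<close>

definition common_zeros :: "(nat \<Rightarrow> complex ^ 3) \<Rightarrow> nat set \<Rightarrow> (complex ^ 3) set" where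
  "common_zeros us I = {w. w \<noteq> 0 \<and> (\<forall>i\<in>I. dot (us i) w = 0)}"

definition flat :: "(nat \<Rightarrow> complex ^ 3) \<Rightarrow> nat set \<Rightarrow> (complex ^ 3) set set" where
  "flat us I = proj_plane \<inter> (\<Inter>i\<in>I. line (us i))"

lemma flat_eq: "flat us I = (\<lambda>w. vec.span {w}) ` common_zeros us I"
  by (auto simp: flat_def common_zeros_def proj_plane_def span_in_line)

lemma flat_empty_iff: "flat us I = {} \<longleftrightarrow> common_zeros us I = {}"
  by (simp add: flat_eq)

lemma flat_subset_iff: "flat us I \<subseteq> flat us J \<longleftrightarrow> common_zeros us I \<subseteq> common_zeros us J"
proof
  assume le: "flat us I \<subseteq> flat us J"
  show "common_zeros us I \<subseteq> common_zeros us J"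
  proof
    fix w assume w: "w \<in> common_zeros us I"
    then have "vec.span {w} \<in> flat us J" using le by (auto simp: flat_eq)
    then show "w \<in> common_zeros us J"
      using w by (auto simp: flat_def common_zeros_def span_in_line)
  qed
qed (auto simp: flat_eq)

locale simple_configuration =
  fixes us :: "nat \<Rightarrow> complex ^ 3" and n :: nat
  assumes nonzero: "\<And>i. i < n \<Longrightarrow> us i \<noteq> 0"
    and distinct: "\<And>i j. i < n \<Longrightarrow> j < n \<Longrightarrow> i \<noteq> j \<Longrightarrow> cross (us i) (us j) \<noteq> 0"
begin

lemma common_zeros_empty_iff:
  assumes "I \<subseteq> {..<n}"
  shows "common_zeros us I = {} \<longleftrightarrow> (\<exists>i\<in>I. \<exists>j\<in>I. \<exists>k\<in>I. det3 (us i) (us j) (us k) \<noteq> 0)"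
proof
  assume *: "common_zeros us I = {}"
  show "\<exists>i\<in>I. \<exists>j\<in>I. \<exists>k\<in>I. det3 (us i) (us j) (us k) \<noteq> 0"
  proof (cases "\<exists>i\<in>I. \<exists>k\<in>I. i \<noteq> k")
    case True
    then obtain i k where ik: "i \<in> I" "k \<in> I" "i \<noteq> k" by blast
    then have "cross (us i) (us k) \<noteq> 0" using distinct assms by blast
    then have "\<exists>l\<in>I. dot (us l) (cross (us i) (us k)) \<noteq> 0" using * by (auto simp: common_zeros_def)
    then show ?thesis using ik by (auto simp: dot_cross)
  next
    case False
    obtain v where "\<forall>i\<in>I. v = us i" using False by metis
    moreover obtain y where "dot v y = 0" "y \<noteq> 0"
    proof (cases "cross v (axis 1 1) \<noteq> 0 \<or> cross v (axis 2 1) \<noteq> 0")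
      case True
      then show ?thesis using that by (metis dot_cross(2) det3_degenerate(1))
    next
      case False
      then have "v = 0" by (auto simp: cross_def vec_eq_iff forall_3 axis_def)
      then show ?thesis using that[of "axis 1 1"] by (simp add: dot_simps axis_eq_0_iff)
    qed
    ultimately have "y \<in> common_zeros us I" by (auto simp: common_zeros_def)
    then show ?thesis using * by blast
  qed
qed (auto simp: common_zeros_def dest: orthogonal_to_basis)

text \<open>The flat of a subfamily lies on a line \<open>j\<close> for one of three reasons: it
  is empty, the line belongs to the subfamily, or the flat is a point given by two lines that are
  concurrent with \<open>j\<close>. All three can be read off from the vanishing of
  determinants.\<close>

lemma common_zeros_subset_singleton_iff:
  assumes I: "I \<subseteq> {..<n}" and j: "j < n"
  shows "common_zeros us I \<subseteq> common_zeros us {j} \<longleftrightarrow>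
    common_zeros us I = {} \<or> j \<in> I \<or> (\<exists>i\<in>I. \<exists>k\<in>I. i \<noteq> k \<and> det3 (us i) (us k) (us j) = 0)"
proof
  assume le: "common_zeros us I \<subseteq> common_zeros us {j}"
  show "common_zeros us I = {} \<or> j \<in> I \<or> (\<exists>i\<in>I. \<exists>k\<in>I. i \<noteq> k \<and> det3 (us i) (us k) (us j) = 0)"
  proof (rule ccontr)
    assume "\<not> ?thesis"
    then have ne: "common_zeros us I \<noteq> {}" and jI: "j \<notin> I"
      and det: "\<And>i k. i \<in> I \<Longrightarrow> k \<in> I \<Longrightarrow> i \<noteq> k \<Longrightarrow> det3 (us i) (us k) (us j) \<noteq> 0" by auto
    from ne obtain w where w: "w \<in> common_zeros us I" by blast
    then have wj: "dot (us j) w = 0" "w \<noteq> 0" using le by (auto simp: common_zeros_def)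
    show False
    proof (cases "\<exists>i\<in>I. \<exists>k\<in>I. i \<noteq> k")
      case True
      then obtain i k where ik: "i \<in> I" "k \<in> I" "i \<noteq> k" by blast
      then have "det3 (us i) (us k) (us j) = 0"
        using w wj by (intro orthogonal_to_basis[of _ w]) (auto simp: common_zeros_def)
      then show False using det ik by blast
    next
      case single: False
      show False
      proof (cases "I = {}")
        case True
        obtain a where a: "dot (us j) a = 1" using exists_dot_eq_1 nonzero[OF j] by blast
        then have "a \<in> common_zeros us I" using True by (auto simp: common_zeros_def dot_simps)
        then show False using le a by (auto simp: common_zeros_def)
      next
        case False
        then obtain i where i: "i \<in> I" by blast
        with single have Ii: "I = {i}" by auto
        have nz: "cross (us i) (us j) \<noteq> 0" using distinct i j jI I by blast
        obtain x where x: "dot (cross (us i) (us j)) x = 1" using exists_dot_eq_1[OF nz] by blast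
        have vw: "dot (us j) (cross (us i) x) = - 1"
          using x by (simp add: dot_cross) (simp add: det3_def algebra_simps)
        then have "cross (us i) x \<noteq> 0" by (auto simp: dot_simps)
        then have "cross (us i) x \<in> common_zeros us I"
          by (simp add: Ii common_zeros_def dot_cross det3_degenerate)
        then show False using le vw by (auto simp: common_zeros_def)
      qed
    qed
  qed
next
  assume "common_zeros us I = {} \<or> j \<in> I \<or> (\<exists>i\<in>I. \<exists>k\<in>I. i \<noteq> k \<and> det3 (us i) (us k) (us j) = 0)"
  then consider "common_zeros us I = {}" | "j \<in> I"
    | i k where "i \<in> I" "k \<in> I" "i \<noteq> k" "det3 (us i) (us k) (us j) = 0" by blast
  then show "common_zeros us I \<subseteq> common_zeros us {j}"
  proof cases
    case 3
    then have "cross (us i) (us k) \<noteq> 0" using distinct I by blast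
    with 3 show ?thesis
      by (auto simp: common_zeros_def intro: orthogonal_to_independent_pair[of "us i" _ "us k"])
  qed (auto simp: common_zeros_def)
qed

end

lemma intersection_lattice_lines:
  "intersection_lattice ((\<lambda>i. line (us i)) ` {..<n}) = {flat us I | I. I \<subseteq> {..<n} \<and> flat us I \<noteq> {}}"
  (is "?l = ?r")
proof (intro equalityI subsetI)
  fix X assume "X \<in> ?l"
  then obtain B where B: "B \<subseteq> (\<lambda>i. line (us i)) ` {..<n}" "X = proj_plane \<inter> \<Inter>B" "X \<noteq> {}"
    by (auto simp: intersection_lattice_def)
  then obtain I where "I \<subseteq> {..<n}" "B = (\<lambda>i. line (us i)) ` I" by (meson subset_imageE)
  then show "X \<in> ?r" using B by (auto simp: flat_def)
next
  fix X assume "X \<in> ?r"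
  then obtain I where "I \<subseteq> {..<n}" "X = flat us I" "flat us I \<noteq> {}" by blast
  then show "X \<in> ?l"
    unfolding intersection_lattice_def flat_def
    by (intro CollectI exI[of _ "(\<lambda>i. line (us i)) ` I"]) auto
qed

text \<open>A flat is the intersection of all lines that contain it, so the lattice is recovered
  from the relation between flats and lines, and this relation depends on the concurrent triples
  alone.\<close>

lemma isomorphic_lattices_of_triples:
  assumes "simple_configuration us n" "simple_configuration vs n"
    and triples: "\<And>i j k. i < j \<Longrightarrow> j < k \<Longrightarrow> k < n \<Longrightarrow>
      det3 (us i) (us j) (us k) = 0 \<longleftrightarrow> det3 (vs i) (vs j) (vs k) = 0"
  shows "isomorphic_lattices ((\<lambda>i. line (us i)) ` {..<n}) ((\<lambda>i. line (vs i)) ` {..<n})"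
proof -
  interpret u: simple_configuration us n by fact
  interpret v: simple_configuration vs n by fact
  have det: "det3 (us i) (us j) (us k) = 0 \<longleftrightarrow> det3 (vs i) (vs j) (vs k) = 0"
    if "i < n" "j < n" "k < n" for i j k
  proof -
    consider "i = j \<or> j = k \<or> i = k" | "i < j" "j < k" | "i < k" "k < j" | "j < i" "i < k"
      | "j < k" "k < i" | "k < i" "i < j" | "k < j" "j < i" by linarith
    then show ?thesis
    proof cases
      case 1
      then show ?thesis by (auto simp: det3_degenerate)
    next
      case 2
      then show ?thesis using triples that by blast
    next
      case 3
      then show ?thesis using triples[of i k j] that by (simp add: det3_permute(1)[of "us i" "us j"] det3_permute(1)[of "vs i" "vs j"])
    next
      case 4
      then show ?thesis using triples[of j i k] that by (simp add: det3_permute(2)[of "us i" "us j"] det3_permute(2)[of "vs i" "vs j"])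
    next
      case 5
      then show ?thesis using triples[of j k i] that by (simp add: det3_permute(3)[of "us i" "us j"] det3_permute(3)[of "vs i" "vs j"])
    next
      case 6
      then show ?thesis using triples[of k i j] that by (simp add: det3_permute(4)[of "us i" "us j"] det3_permute(4)[of "vs i" "vs j"])
    next
      case 7
      then show ?thesis using triples[of k j i] that by (simp add: det3_permute(5)[of "us i" "us j"] det3_permute(5)[of "vs i" "vs j"])
    qed
  qed
  have empty: "flat us I = {} \<longleftrightarrow> flat vs I = {}" if "I \<subseteq> {..<n}" for I
    unfolding flat_empty_iff u.common_zeros_empty_iff[OF that] v.common_zeros_empty_iff[OF that]
    using det that by (meson lessThan_iff subsetD)
  have single: "flat us I \<subseteq> flat us {j} \<longleftrightarrow> flat vs I \<subseteq> flat vs {j}" if "I \<subseteq> {..<n}" "j < n" for I j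
  proof -
    have "(\<exists>i\<in>I. \<exists>k\<in>I. i \<noteq> k \<and> det3 (us i) (us k) (us j) = 0)
        \<longleftrightarrow> (\<exists>i\<in>I. \<exists>k\<in>I. i \<noteq> k \<and> det3 (vs i) (vs k) (vs j) = 0)"
      using det that by (meson lessThan_iff subsetD)
    then show ?thesis
      using empty[OF that(1)]
      unfolding flat_subset_iff u.common_zeros_subset_singleton_iff[OF that]
        v.common_zeros_subset_singleton_iff[OF that] flat_empty_iff by blast
  qed
  have flat_split: "flat ws I \<subseteq> flat ws J \<longleftrightarrow> (\<forall>j\<in>J. flat ws I \<subseteq> flat ws {j})" for ws I J
    by (auto simp: flat_def)
  have mono: "flat us I \<subseteq> flat us J \<longleftrightarrow> flat vs I \<subseteq> flat vs J" if "I \<subseteq> {..<n}" "J \<subseteq> {..<n}" for I J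
    unfolding flat_split[of us I J] flat_split[of vs I J] using single that by (meson lessThan_iff subsetD)
  define idx where "idx X = {i. i < n \<and> X \<subseteq> line (us i)}" for X
  have idx_sub: "idx X \<subseteq> {..<n}" for X by (auto simp: idx_def)
  have idx_flat: "flat us (idx (flat us I)) = flat us I" if "I \<subseteq> {..<n}" for I
    using that by (auto simp: idx_def flat_def)
  define h where "h X = flat vs (idx X)" for X
  have h_flat: "h (flat us I) = flat vs I" if "I \<subseteq> {..<n}" for I
  proof (unfold h_def, rule subset_antisym)
    show "flat vs (idx (flat us I)) \<subseteq> flat vs I"
      using mono[OF idx_sub that, of "flat us I"] by (simp add: idx_flat[OF that])
    show "flat vs I \<subseteq> flat vs (idx (flat us I))"
      using mono[OF that idx_sub, of "flat us I"] by (simp add: idx_flat[OF that])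
  qed
  let ?L = "intersection_lattice ((\<lambda>i. line (us i)) ` {..<n})"
  let ?M = "intersection_lattice ((\<lambda>i. line (vs i)) ` {..<n})"
  have le: "lattice_le X Y \<longleftrightarrow> lattice_le (h X) (h Y)" if XY: "X \<in> ?L" "Y \<in> ?L" for X Y
  proof -
    obtain I where "I \<subseteq> {..<n}" "X = flat us I"
      using XY(1) unfolding intersection_lattice_lines by auto
    moreover obtain J where "J \<subseteq> {..<n}" "Y = flat us J"
      using XY(2) unfolding intersection_lattice_lines by auto
    ultimately show ?thesis using mono[of J I] h_flat by (simp add: lattice_le_def)
  qed
  have "inj_on h ?L"
    using le unfolding inj_on_def lattice_le_def by (metis subset_antisym order_refl)
  moreover have "h ` ?L = ?M"
  proof (intro equalityI subsetI)
    fix Y assume "Y \<in> ?M"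
    then obtain I where I: "I \<subseteq> {..<n}" "Y = flat vs I" "flat vs I \<noteq> {}"
      by (auto simp: intersection_lattice_lines)
    then have "flat us I \<in> ?L" using empty by (auto simp: intersection_lattice_lines)
    then show "Y \<in> h ` ?L" using h_flat I by (metis imageI)
  next
    fix Y assume "Y \<in> h ` ?L"
    then obtain I where "I \<subseteq> {..<n}" "flat us I \<noteq> {}" "Y = h (flat us I)"
      by (auto simp: intersection_lattice_lines)
    then have "Y = flat vs I" "flat vs I \<noteq> {}" "I \<subseteq> {..<n}" using empty h_flat by auto
    then show "Y \<in> ?M" unfolding intersection_lattice_lines by blast
  qed
  ultimately show ?thesis using le unfolding isomorphic_lattices_def bij_betw_def by blast
qed

section \<open>Minimal graded free resolutions\<close>

subsection \<open>Homogeneous polynomials\<close>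

definition homog :: "nat \<Rightarrow> S \<Rightarrow> bool" where
  "homog d p \<longleftrightarrow> (\<forall>m\<in>keys p. mon_degree m = d)"

lemma mon_degree_simps: "mon_degree (m + n) = mon_degree m + mon_degree n" "mon_degree 0 = 0"
  by (simp_all add: mon_degree_def lookup_add sum.distrib)

lemma mon_degree_single: "mon_degree (single i k) = k"
  by (simp add: mon_degree_def lookup_single when_def)

lemma mon_degree_eq_0: "mon_degree m = 0 \<longleftrightarrow> m = 0"
proof
  assume "mon_degree m = 0"
  then have "lookup m i = 0" for i by (simp add: mon_degree_def)
  then show "m = 0" by (intro poly_mapping_eqI) simp
qed (simp add: mon_degree_simps)

lemma homog_add: "homog d p \<Longrightarrow> homog d q \<Longrightarrow> homog d (p + q)"
  using keys_add[of p q] unfolding homog_def by blast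

lemma homog_uminus: "homog d p \<Longrightarrow> homog d (- p)"
  by (simp add: homog_def in_keys_iff)

lemma homog_diff: "homog d p \<Longrightarrow> homog d q \<Longrightarrow> homog d (p - q)"
  using homog_add[OF _ homog_uminus, of d p q] by simp

lemma homog_0: "homog d 0" and homog_1: "homog 0 1"
  by (simp_all add: homog_def mon_degree_simps)

lemma homog_mult: "homog d p \<Longrightarrow> homog e q \<Longrightarrow> homog (d + e) (p * q)"
  using keys_mult[of p q] unfolding homog_def by (auto simp: mon_degree_simps dest!: subsetD)

lemma homog_Const: "homog 0 (Const c)"
  by (auto simp: homog_def Const_def mon_degree_simps)

lemma homog_numeral: "homog 0 (numeral n)"
  using homog_Const[of "numeral n"] by simp

lemma homog_Var: "homog 1 (Var i)"
  by (auto simp: homog_def Var_def mon_degree_single)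

lemma homog_power: "homog d p \<Longrightarrow> homog (n * d) (p ^ n)"
  by (induction n) (auto intro: homog_mult homog_1)

lemma homog_sum: "(\<And>i. i \<in> I \<Longrightarrow> homog d (f i)) \<Longrightarrow> homog d (\<Sum>i\<in>I. f i)"
  by (induction I rule: infinite_finite_induct) (auto intro: homog_add homog_0)

lemma homog_lf: "homog 1 (lf u)"
  unfolding lf_def linear_form_def
  using homog_mult[OF homog_Const homog_Var] by (intro homog_add) auto

lemma homog_scale: "homog d p \<Longrightarrow> homog d (Const c * p)"
  using homog_mult[OF homog_Const] by simp

text \<open>Taking the constant term is multiplicative, since a product of monomials is constant
  only if both are.\<close>

lemma lookup_mult_0: "lookup (p * q) 0 = lookup p 0 * (lookup q 0 :: complex)" for p q :: S
proof -
  have sp: "lookup (single m c * single n d) 0 = lookup (single m c) 0 * (lookup (single n d) 0 :: complex)"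
    for m n :: mon and c d
  proof -
    have "m + n = 0 \<longleftrightarrow> m = 0 \<and> n = 0"
      by (metis add_is_0 mon_degree_eq_0 mon_degree_simps(1))
    then show ?thesis by (auto simp: mult_single lookup_single when_def)
  qed
  show ?thesis
  proof (induction p rule: S_induct)
    case (monomial m c)
    show ?case by (induction q rule: S_induct) (auto simp: sp lookup_add algebra_simps)
  qed (auto simp: lookup_add algebra_simps)
qed

lemma lookup_Var_0: "lookup (Var i) 0 = 0"
proof -
  have "single i (1 :: nat) \<noteq> 0" using mon_degree_single[of i 1] mon_degree_simps(2) by auto
  then show ?thesis by (simp add: Var_def lookup_single when_def)
qed

lemma irrelevant_ideal_closed:
  "0 \<in> irrelevant_ideal" "p \<in> irrelevant_ideal \<Longrightarrow> q \<in> irrelevant_ideal \<Longrightarrow> p + q \<in> irrelevant_ideal"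
  "p \<in> irrelevant_ideal \<Longrightarrow> c * p \<in> irrelevant_ideal"
proof -
  show "0 \<in> irrelevant_ideal" unfolding irrelevant_ideal_def by (intro CollectI exI[of _ 0]) simp
  show "p + q \<in> irrelevant_ideal" if pq: "p \<in> irrelevant_ideal" "q \<in> irrelevant_ideal"
  proof -
    obtain a b c a' b' c' where "p = a * Var 1 + b * Var 2 + c * Var 3" "q = a' * Var 1 + b' * Var 2 + c' * Var 3"
      using pq by (auto simp: irrelevant_ideal_def)
    then have "p + q = (a + a') * Var 1 + (b + b') * Var 2 + (c + c') * Var 3" by (simp add: algebra_simps)
    then show ?thesis unfolding irrelevant_ideal_def by blast
  qed
  show "c * p \<in> irrelevant_ideal" if p: "p \<in> irrelevant_ideal"
  proof -
    obtain a b d where "p = a * Var 1 + b * Var 2 + d * Var 3" using p by (auto simp: irrelevant_ideal_def)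
    then have "c * p = (c * a) * Var 1 + (c * b) * Var 2 + (c * d) * Var 3" by (simp add: algebra_simps)
    then show ?thesis unfolding irrelevant_ideal_def by blast
  qed
qed

lemma Var_irrelevant: "Var i \<in> irrelevant_ideal"
proof -
  have "Var i = (if i = 1 then 1 else 0) * Var 1 + (if i = 2 then 1 else 0) * Var 2 + (if i = 3 then 1 else 0) * Var 3"
    using exhaust_3[of i] by auto
  then show ?thesis unfolding irrelevant_ideal_def by blast
qed

lemma irrelevant_ideal_iff: "p \<in> irrelevant_ideal \<longleftrightarrow> lookup p 0 = 0"
proof
  assume "p \<in> irrelevant_ideal"
  then show "lookup p 0 = 0"
    by (auto simp: irrelevant_ideal_def lookup_add lookup_mult_0 lookup_Var_0)
next
  assume p0: "lookup p 0 = 0"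
  have mon: "single m c \<in> irrelevant_ideal" if m: "m \<noteq> 0" for m c
  proof -
    obtain i where i: "lookup m i \<noteq> 0" using m by (metis poly_mapping_eqI lookup_zero)
    have "(m - single i 1) + single i 1 = m"
      by (rule poly_mapping_eqI) (use i in \<open>auto simp: lookup_add lookup_minus lookup_single when_def\<close>)
    then have "single m c = single (m - single i 1) c * Var i" by (simp add: Var_def mult_single)
    then show ?thesis using irrelevant_ideal_closed(3) Var_irrelevant by metis
  qed
  have "(\<Sum>m\<in>A. single m (lookup p m)) \<in> irrelevant_ideal" if "finite A" for A
    using that
  proof (induction A rule: finite_induct)
    case (insert m A)
    have "single m (lookup p m) \<in> irrelevant_ideal"
      using mon irrelevant_ideal_closed(1) p0 by (cases "m = 0") auto
    with insert show ?case by (simp add: irrelevant_ideal_closed(2))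
  qed (simp add: irrelevant_ideal_closed(1))
  then show "p \<in> irrelevant_ideal" by (metis poly_mapping_sum_singles finite_keys)
qed

lemma homog_irrelevant: "homog d p \<Longrightarrow> d > 0 \<Longrightarrow> p \<in> irrelevant_ideal"
  unfolding irrelevant_ideal_iff homog_def
  by (metis mon_degree_simps(2) in_keys_iff less_irrefl)

subsection \<open>Homogeneous components\<close>

definition hcomp :: "nat \<Rightarrow> S \<Rightarrow> S" where
  "hcomp d p = (\<Sum>m\<in>keys p. if mon_degree m = d then single m (lookup p m) else 0)"

lemma hcomp_add: "hcomp d (p + q) = hcomp d p + hcomp d q"
  unfolding hcomp_def by (rule keys_sum_add) (auto simp: single_add)

lemma lookup_hcomp: "lookup (hcomp d p) m = (if mon_degree m = d then lookup p m else 0)"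
proof -
  have "lookup (hcomp d p) m = (\<Sum>n\<in>keys p. if n = m then (if mon_degree m = d then lookup p m else 0) else 0)"
    unfolding hcomp_def lookup_sum by (rule sum.cong) (auto simp: lookup_single when_def)
  then show ?thesis by (simp add: in_keys_iff)
qed

lemma hcomp_homog: "homog d (hcomp d p)"
  by (auto simp: homog_def in_keys_iff lookup_hcomp split: if_splits)

lemma hcomp_of_homog: "homog e p \<Longrightarrow> hcomp d p = (if d = e then p else 0)"
  by (rule poly_mapping_eqI) (auto simp: lookup_hcomp homog_def in_keys_iff)

lemma hcomp_0 [simp]: "hcomp d 0 = 0"
  by (simp add: hcomp_def)

lemma sum_hcomp:
  assumes "\<And>m. m \<in> keys p \<Longrightarrow> mon_degree m \<le> N" shows "(\<Sum>d\<le>N. hcomp d p) = p"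
proof (rule poly_mapping_eqI)
  fix m
  have "lookup (\<Sum>d\<le>N. hcomp d p) m = (\<Sum>d\<le>N. if d = mon_degree m then lookup p m else 0)"
    by (simp add: lookup_sum lookup_hcomp if_distrib cong: sum.cong)
  then show "lookup (\<Sum>d\<le>N. hcomp d p) m = lookup p m"
    using assms[of m] by (cases "lookup p m = 0") (auto simp: in_keys_iff)
qed

definition project :: "shifts \<Rightarrow> nat \<Rightarrow> (nat \<Rightarrow> S) \<Rightarrow> (nat \<Rightarrow> S)" where
  "project ds r v = (\<lambda>i. if i < length ds \<and> ds ! i \<le> r then hcomp (r - ds ! i) (v i) else 0)"

lemma graded_part_iff:
  "v \<in> graded_part ds r \<longleftrightarrow> v \<in> free_module ds \<and>
     (\<forall>i<length ds. if ds ! i \<le> r then homog (r - ds ! i) (v i) else v i = 0)"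
proof -
  have "(\<forall>m\<in>keys p. mon_degree m + d = r) \<longleftrightarrow> (if d \<le> r then homog (r - d) p else p = 0)" for p :: S and d
    by (auto simp: homog_def)
  then show ?thesis by (simp add: graded_part_def)
qed

lemma project_graded: "project ds r v \<in> graded_part ds r"
  by (auto simp: graded_part_iff project_def free_module_def hcomp_homog)

lemma project_add: "project ds r (\<lambda>i. v i + w i) = (\<lambda>i. project ds r v i + project ds r w i)"
  by (auto simp: project_def hcomp_add)

lemma project_sum: "project ds r (\<lambda>i. \<Sum>j\<in>J. f j i) = (\<lambda>i. \<Sum>j\<in>J. project ds r (f j) i)"
proof (induction J rule: infinite_finite_induct)
  case (insert j J)
  then show ?case by (simp add: project_add)
qed (auto simp: project_def)

lemma project_of_graded:
  assumes v: "v \<in> graded_part ds s"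
  shows "project ds r v = (if r = s then v else (\<lambda>_. 0))"
proof
  fix i
  show "project ds r v i = (if r = s then v else (\<lambda>_. 0)) i"
  proof (cases "i < length ds")
    case i: True
    show ?thesis
    proof (cases "ds ! i \<le> s")
      case True
      then have "homog (s - ds ! i) (v i)" using v i by (simp add: graded_part_iff)
      then show ?thesis using i True by (auto simp: project_def hcomp_of_homog)
    next
      case False
      then have "v i = 0" using v i by (simp add: graded_part_iff)
      then show ?thesis by (auto simp: project_def)
    qed
  qed (use v in \<open>auto simp: project_def graded_part_iff free_module_def\<close>)
qed

lemma sum_project:
  assumes v: "v \<in> free_module ds"
  obtains N where "v = (\<lambda>i. \<Sum>r\<le>N. project ds r v i)"
proof -
  define B where "B i = (if keys (v i) = {} then 0 else Max (mon_degree ` keys (v i)))" for i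
  define N where "N = (\<Sum>i<length ds. ds ! i + B i)"
  have N: "ds ! i + B i \<le> N" if "i < length ds" for i
    unfolding N_def using that by (intro member_le_sum[of i _ "\<lambda>i. ds ! i + B i"]) auto
  have "v i = (\<Sum>r\<le>N. project ds r v i)" for i
  proof (cases "i < length ds")
    case True
    have "(\<Sum>r\<le>N. project ds r v i) = (\<Sum>r\<in>{ds ! i..N}. hcomp (r - ds ! i) (v i))"
      using True by (intro sum.mono_neutral_cong_right) (auto simp: project_def)
    also have "\<dots> = (\<Sum>d\<le>N - ds ! i. hcomp d (v i))"
      by (rule sum.reindex_bij_witness[of _ "\<lambda>d. d + ds ! i" "\<lambda>r. r - ds ! i"])
         (use N[OF True] in auto)
    also have "\<dots> = v i"
    proof (rule sum_hcomp)
      fix m assume "m \<in> keys (v i)"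
      then have "mon_degree m \<le> B i" by (auto simp: B_def)
      then show "mon_degree m \<le> N - ds ! i" using N[OF True] by simp
    qed
    finally show ?thesis by simp
  qed (use v in \<open>auto simp: project_def free_module_def\<close>)
  then show ?thesis using that by blast
qed

subsection \<open>Degrees of minimal generators\<close>

text \<open>The submodule \<open>m M\<close>, where \<open>m\<close> is the irrelevant ideal.\<close>

definition irrelevant_multiple :: "(nat \<Rightarrow> S) set \<Rightarrow> (nat \<Rightarrow> S) set" where
  "irrelevant_multiple M =
     {\<lambda>k. Var 1 * a k + Var 2 * b k + Var 3 * c k | a b c. a \<in> M \<and> b \<in> M \<and> c \<in> M}"

lemma graded_hom_add:
  "graded_hom ds es \<phi> \<Longrightarrow> v \<in> free_module ds \<Longrightarrow> w \<in> free_module ds \<Longrightarrow>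
    \<phi> (\<lambda>i. v i + w i) = (\<lambda>i. \<phi> v i + \<phi> w i)"
  by (simp add: graded_hom_def)

lemma graded_hom_smult:
  "graded_hom ds es \<phi> \<Longrightarrow> v \<in> free_module ds \<Longrightarrow> \<phi> (\<lambda>i. c * v i) = (\<lambda>i. c * \<phi> v i)"
  by (simp add: graded_hom_def)

lemma free_module_closed:
  "(\<lambda>_. 0) \<in> free_module ds"
  "v \<in> free_module ds \<Longrightarrow> w \<in> free_module ds \<Longrightarrow> (\<lambda>i. v i + w i) \<in> free_module ds"
  "v \<in> free_module ds \<Longrightarrow> (\<lambda>i. c * v i) \<in> free_module ds"
  by (auto simp: free_module_def)

lemma graded_hom_zero: "graded_hom ds es \<phi> \<Longrightarrow> \<phi> (\<lambda>_. 0) = (\<lambda>_. 0)"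
  using graded_hom_smult[of ds es \<phi> "\<lambda>_. 0" 0] by (simp add: free_module_closed)

lemma graded_hom_sum:
  assumes "graded_hom ds es \<phi>" "\<And>j. j \<in> J \<Longrightarrow> f j \<in> free_module ds"
  shows "\<phi> (\<lambda>i. \<Sum>j\<in>J. f j i) = (\<lambda>i. \<Sum>j\<in>J. \<phi> (f j) i)"
  using assms(2)
proof (induction J rule: infinite_finite_induct)
  case (insert j J)
  have "(\<lambda>i. \<Sum>j\<in>J. f j i) \<in> free_module ds"
    using insert.prems by (auto simp: free_module_def intro!: sum.neutral)
  then show ?case using insert graded_hom_add[OF assms(1)] by simp
qed (auto simp: graded_hom_zero[OF assms(1)])

lemma graded_hom_project:
  assumes \<phi>: "graded_hom ds es \<phi>" and v: "v \<in> free_module ds"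
  shows "project es d (\<phi> v) = \<phi> (project ds d v)"
proof -
  obtain N where N: "v = (\<lambda>i. \<Sum>r\<le>N. project ds r v i)" using sum_project[OF v] by metis
  have pr: "project ds r v \<in> free_module ds" for r using project_graded graded_part_iff by blast
  have img: "\<phi> (project ds r v) \<in> graded_part es r" for r
    using \<phi> project_graded unfolding graded_hom_def by blast
  have "\<phi> v = (\<lambda>i. \<Sum>r\<le>N. \<phi> (project ds r v) i)"
    by (subst N) (rule graded_hom_sum[OF \<phi> pr])
  then have "project es d (\<phi> v) = (\<lambda>i. \<Sum>r\<le>N. project es d (\<phi> (project ds r v)) i)"
    by (simp add: project_sum)
  also have "\<dots> = (\<lambda>i. if d \<le> N then \<phi> (project ds d v) i else 0)"
  proof
    fix i
    have "(\<Sum>r\<le>N. project es d (\<phi> (project ds r v)) i) = (\<Sum>r\<le>N. if r = d then \<phi> (project ds d v) i else 0)"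
      by (rule sum.cong) (auto simp: project_of_graded[OF img])
    then show "(\<Sum>r\<le>N. project es d (\<phi> (project ds r v)) i) = (if d \<le> N then \<phi> (project ds d v) i else 0)"
      by simp
  qed
  also have "\<dots> = \<phi> (project ds d v)"
  proof (cases "d \<le> N")
    case False
    have "project ds d v = project ds d (\<lambda>i. \<Sum>r\<le>N. project ds r v i)" using N by simp
    also have "\<dots> = (\<lambda>i. \<Sum>r\<le>N. project ds d (project ds r v) i)"
      by (rule project_sum)
    also have "\<dots> = (\<lambda>_. 0)"
      using False by (auto simp: project_of_graded[OF project_graded] fun_eq_iff intro!: sum.neutral)
    finally have "project ds d v = (\<lambda>_. 0)" .
    then show ?thesis using False graded_hom_zero[OF \<phi>] by simp
  qed simp
  finally show ?thesis .
qed

definition unit_vector :: "nat \<Rightarrow> nat \<Rightarrow> S" where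
  "unit_vector i = (\<lambda>j. if j = i then 1 else 0)"

text \<open>This is the graded lemma of Nakayama for the part of the resolution that covers
  \<open>M\<close>. A basis element whose image lay in \<open>m M\<close> would differ from an
  element of \<open>m F 0\<close> by a relation, and minimality puts the relations into \<open>m F
  0\<close> as well, so 1 would be in \<open>m\<close>. Conversely an element of degree
  \<open>d\<close> is the image of an element of degree \<open>d\<close>; if no shift equals
  \<open>d\<close>, the coordinates of the latter have no constant term.\<close>

lemma generator_degree_iff:
  assumes res: "minimal_graded_resolution es M F \<phi>"
  shows "d \<in> set (F 0) \<longleftrightarrow> \<not> M \<inter> graded_part es d \<subseteq> irrelevant_multiple M"
proof
  have \<phi>0: "graded_hom (F 0) es (\<phi> 0)" and M: "\<phi> 0 ` free_module (F 0) = M"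
    and exact: "\<phi> (Suc 0) ` free_module (F (Suc 0)) = {v \<in> free_module (F 0). \<phi> 0 v = (\<lambda>_. 0)}"
    and minimal: "\<And>v k. v \<in> free_module (F (Suc 0)) \<Longrightarrow> \<phi> (Suc 0) v k \<in> irrelevant_ideal"
    using res unfolding minimal_graded_resolution_def by blast+
  {
    assume "d \<in> set (F 0)"
    then obtain i where i: "i < length (F 0)" "F 0 ! i = d" by (metis in_set_conv_nth)
    have e: "unit_vector i \<in> graded_part (F 0) d"
      using i by (auto simp: graded_part_iff unit_vector_def free_module_def homog_1 homog_0)
    then have e0: "unit_vector i \<in> free_module (F 0)" by (simp add: graded_part_iff)
    show "\<not> M \<inter> graded_part es d \<subseteq> irrelevant_multiple M"
    proof
      assume le: "M \<inter> graded_part es d \<subseteq> irrelevant_multiple M"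
      have "\<phi> 0 (unit_vector i) \<in> M \<inter> graded_part es d"
        using e e0 M \<phi>0 unfolding graded_hom_def by blast
      then have "\<phi> 0 (unit_vector i) \<in> irrelevant_multiple (\<phi> 0 ` free_module (F 0))" using le M by blast
      then obtain a b c where abc: "a \<in> free_module (F 0)" "b \<in> free_module (F 0)" "c \<in> free_module (F 0)"
        and eq: "\<phi> 0 (unit_vector i) = (\<lambda>k. Var 1 * \<phi> 0 a k + Var 2 * \<phi> 0 b k + Var 3 * \<phi> 0 c k)"
        unfolding irrelevant_multiple_def by blast
      define w where "w = (\<lambda>k. Var 1 * a k + Var 2 * b k + Var 3 * c k)"
      have w: "w \<in> free_module (F 0)" using abc by (simp add: w_def free_module_closed)
      have "\<phi> 0 w = \<phi> 0 (unit_vector i)"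
        unfolding eq w_def using abc
        by (simp add: graded_hom_add[OF \<phi>0] graded_hom_smult[OF \<phi>0] free_module_closed)
      moreover have "\<phi> 0 (\<lambda>k. unit_vector i k + (- 1) * w k)
          = (\<lambda>k. \<phi> 0 (unit_vector i) k + (- 1) * \<phi> 0 w k)"
        by (simp only: graded_hom_add[OF \<phi>0 e0 free_module_closed(3)[OF w]]
            graded_hom_smult[OF \<phi>0 w])
      ultimately have "\<phi> 0 (\<lambda>k. unit_vector i k + (- 1) * w k) = (\<lambda>_. 0)" by simp
      then have "(\<lambda>k. unit_vector i k + (- 1) * w k) \<in> \<phi> (Suc 0) ` free_module (F (Suc 0))"
        unfolding exact using e0 w by (simp only: mem_Collect_eq free_module_closed simp_thms)
      then have "unit_vector i i + (- 1) * w i \<in> irrelevant_ideal"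
        using minimal by (metis (no_types, lifting) imageE)
      then have "lookup (unit_vector i i - w i) 0 = 0" by (simp add: irrelevant_ideal_iff)
      then show False
        by (simp add: unit_vector_def w_def lookup_minus lookup_add lookup_mult_0 lookup_Var_0)
    qed
  next
    assume notle: "\<not> M \<inter> graded_part es d \<subseteq> irrelevant_multiple M"
    show "d \<in> set (F 0)"
    proof (rule ccontr)
      assume d: "d \<notin> set (F 0)"
      have "v \<in> irrelevant_multiple M" if v: "v \<in> M" "v \<in> graded_part es d" for v
      proof -
        obtain w where w: "w \<in> free_module (F 0)" "v = \<phi> 0 w" using v M by blast
        define u where "u = project (F 0) d w"
        have u: "u \<in> free_module (F 0)" unfolding u_def using project_graded graded_part_iff by blast
        have vu: "v = \<phi> 0 u"
          using graded_hom_project[OF \<phi>0 w(1), of d] w(2) project_of_graded[OF v(2), of d]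
          by (simp add: u_def)
        have "u k \<in> irrelevant_ideal" for k
        proof (cases "k < length (F 0) \<and> F 0 ! k \<le> d")
          case True
          then have "F 0 ! k < d" using d by (metis nth_mem order_le_less)
          then show ?thesis
            unfolding u_def project_def using True by (auto intro: homog_irrelevant[OF hcomp_homog])
        qed (auto simp: u_def project_def irrelevant_ideal_closed)
        then have "\<forall>k. \<exists>a b c. u k = a * Var 1 + b * Var 2 + c * Var 3"
          unfolding irrelevant_ideal_def by blast
        then obtain a' b' c' where u': "\<And>k. u k = a' k * Var 1 + b' k * Var 2 + c' k * Var 3" by metis
        define trunc where "trunc f = (\<lambda>k. if k < length (F 0) then f k else (0::S))" for f
        have tr: "trunc f \<in> free_module (F 0)" for f by (auto simp: trunc_def free_module_def)
        have "u = (\<lambda>k. Var 1 * trunc a' k + Var 2 * trunc b' k + Var 3 * trunc c' k)"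
        proof
          fix k
          show "u k = Var 1 * trunc a' k + Var 2 * trunc b' k + Var 3 * trunc c' k"
            using u'[of k] u by (cases "k < length (F 0)") (auto simp: trunc_def free_module_def algebra_simps)
        qed
        then have "v = (\<lambda>k. Var 1 * \<phi> 0 (trunc a') k + Var 2 * \<phi> 0 (trunc b') k + Var 3 * \<phi> 0 (trunc c') k)"
          unfolding vu using tr by (simp add: graded_hom_add[OF \<phi>0] graded_hom_smult[OF \<phi>0] free_module_closed)
        then show ?thesis unfolding irrelevant_multiple_def using M tr by blast
      qed
      then show False using notle by blast
    qed
  }
qed

lemma different_graded_betti_of_degree:
  assumes "has_minimal_graded_resolution es M F" "has_minimal_graded_resolution es N G"
    "d \<notin> set (F 0)" "d \<in> set (G 0)"
  shows "different_graded_betti es M N"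
proof -
  have "graded_betti F' \<noteq> graded_betti G'"
    if "has_minimal_graded_resolution es M F'" "has_minimal_graded_resolution es N G'" for F' G'
  proof -
    have "d \<notin> set (F' 0)" "d \<in> set (G' 0)"
      using generator_degree_iff assms that unfolding has_minimal_graded_resolution_def by metis+
    then have "graded_betti F' 0 d = 0" "graded_betti G' 0 d \<noteq> 0"
      by (simp_all add: graded_betti_def count_list_0_iff)
    then show ?thesis by metis
  qed
  then show ?thesis using assms(1,2) unfolding different_graded_betti_def by blast
qed

subsection \<open>Resolutions of length one given by matrices\<close>

definition combination :: "shifts \<Rightarrow> (nat \<Rightarrow> nat \<Rightarrow> S) \<Rightarrow> (nat \<Rightarrow> S) \<Rightarrow> (nat \<Rightarrow> S)" where
  "combination ds R w = (\<lambda>k. \<Sum>i<length ds. w i * R i k)"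

lemma graded_hom_combination:
  assumes R: "\<And>i. i < length ds \<Longrightarrow> R i \<in> graded_part es (ds ! i)"
  shows "graded_hom ds es (combination ds R)"
  unfolding graded_hom_def
proof (intro conjI ballI allI)
  show "combination ds R ` free_module ds \<subseteq> free_module es"
    using R by (auto simp: combination_def free_module_def graded_part_def intro!: sum.neutral)
  show "combination ds R (\<lambda>i. v i + w i) = (\<lambda>i. combination ds R v i + combination ds R w i)" for v w
    by (auto simp: combination_def algebra_simps sum.distrib)
  show "combination ds R (\<lambda>i. c * v i) = (\<lambda>i. c * combination ds R v i)" for c v
    by (auto simp: combination_def sum_distrib_left algebra_simps)
  show "combination ds R ` graded_part ds r \<subseteq> graded_part es r" for r
  proof (rule image_subsetI)
    fix w assume w: "w \<in> graded_part ds r"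
    have "mon_degree m + es ! k = r" if k: "k < length es" and m: "m \<in> keys (combination ds R w k)" for k m
    proof -
      have "keys (\<Sum>i<length ds. w i * R i k) \<subseteq> (\<Union>i\<in>{..<length ds}. keys (w i * R i k))"
        by (rule keys_sum)
      then obtain i where i: "i < length ds" "m \<in> keys (w i * R i k)"
        using m unfolding combination_def by auto
      then obtain m1 m2 where m12: "m = m1 + m2" "m1 \<in> keys (w i)" "m2 \<in> keys (R i k)"
        using keys_mult[of "w i" "R i k"] by auto
      have "mon_degree m1 + ds ! i = r" using w i(1) m12(2) by (simp add: graded_part_def)
      moreover have "mon_degree m2 + es ! k = ds ! i"
        using R[OF i(1)] k m12(3) by (simp add: graded_part_def)
      ultimately show ?thesis by (simp add: m12(1) mon_degree_simps)
    qed
    moreover have "combination ds R w \<in> free_module es"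
      using R by (auto simp: combination_def free_module_def graded_part_def intro!: sum.neutral)
    ultimately show "combination ds R w \<in> graded_part es r" by (simp add: graded_part_def)
  qed
qed

lemma has_minimal_graded_resolution_of_matrices:
  assumes R: "\<And>i. i < length ds \<Longrightarrow> R i \<in> graded_part as (ds ! i)"
    and \<rho>: "\<And>j. j < length es \<Longrightarrow> \<rho> j \<in> graded_part ds (es ! j)"
    and \<rho>_min: "\<And>j k. j < length es \<Longrightarrow> \<rho> j k \<in> irrelevant_ideal"
    and gen: "combination ds R ` free_module ds = M"
    and rel: "combination es \<rho> ` free_module es = {w \<in> free_module ds. combination ds R w = (\<lambda>_. 0)}"
    and inj: "\<And>c. c \<in> free_module es \<Longrightarrow> combination es \<rho> c = (\<lambda>_. 0) \<Longrightarrow> c = (\<lambda>_. 0)"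
  shows "has_minimal_graded_resolution as M (finite_resolution [ds, es])"
proof -
  define \<phi> where "\<phi> i = (if i = 0 then combination ds R else if i = 1 then combination es \<rho> else (\<lambda>_ _. 0))"
    for i :: nat
  let ?F = "finite_resolution [ds, es]"
  have F: "?F 0 = ds" "?F (Suc 0) = es" "\<And>i. ?F (Suc (Suc i)) = []"
    by (simp_all add: finite_resolution_def)
  have nil: "free_module [] = {\<lambda>_. 0}" by (auto simp: free_module_def)
  have zero_hom: "graded_hom [] fs (\<lambda>_ _. 0)" for fs
    by (auto simp: graded_hom_def graded_part_def free_module_def)
  have "minimal_graded_resolution as M ?F \<phi>"
    unfolding minimal_graded_resolution_def
  proof (intro conjI allI ballI)
    show "graded_hom (?F 0) as (\<phi> 0)" "\<phi> 0 ` free_module (?F 0) = M"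
      using graded_hom_combination[OF R] gen by (simp_all add: F \<phi>_def)
    fix i
    show "graded_hom (?F (Suc i)) (?F i) (\<phi> (Suc i))"
      using graded_hom_combination[OF \<rho>] zero_hom by (cases i) (auto simp: F \<phi>_def)
    show "\<phi> (Suc i) ` free_module (?F (Suc i)) = {v \<in> free_module (?F i). \<phi> i v = (\<lambda>_. 0)}"
    proof -
      consider "i = 0" | "i = 1" | j where "i = Suc (Suc j)" by (metis One_nat_def not0_implies_Suc)
      then show ?thesis
      proof cases
        case 2
        have "combination es \<rho> (\<lambda>_. 0) = (\<lambda>_. 0)" by (simp add: combination_def)
        then show ?thesis using 2 inj by (auto simp: F \<phi>_def nil free_module_closed)
      qed (use rel in \<open>auto simp: F \<phi>_def nil\<close>)
    qed
    show "\<phi> (Suc i) v k \<in> irrelevant_ideal" if "v \<in> free_module (?F (Suc i))" for v k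
    proof (cases i)
      case 0
      have "(\<Sum>j\<in>J. v j * \<rho> j k) \<in> irrelevant_ideal" if "J \<subseteq> {..<length es}" for J
        using finite_subset[OF that finite_lessThan] that
        by (induction J rule: finite_induct) (auto intro!: irrelevant_ideal_closed \<rho>_min)
      then show ?thesis using 0 by (auto simp: \<phi>_def combination_def)
    qed (auto simp: \<phi>_def irrelevant_ideal_closed)
  qed
  then show ?thesis unfolding has_minimal_graded_resolution_def by blast
qed

section \<open>Algebraic relations of a centred arrangement\<close>

lemma homog_cofactor:
  assumes p: "homog d p" "p \<noteq> 0" and pq: "homog (d + e) (p * q)"
  shows "homog e q"
proof -
  obtain N where N: "\<And>m. m \<in> keys q \<Longrightarrow> mon_degree m \<le> N"
    using finite_nat_set_iff_bounded_le[of "mon_degree ` keys q"] by auto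
  have zero: "hcomp k q = 0" if k: "k \<noteq> e" for k
  proof (cases "k \<le> N")
    case True
    have "p * q = (\<Sum>j\<le>N. p * hcomp j q)"
      using sum_hcomp[OF N] by (simp add: sum_distrib_left[symmetric])
    also have "hcomp (d + k) \<dots> = (\<Sum>j\<le>N. hcomp (d + k) (p * hcomp j q))"
      by (induction N) (auto simp: hcomp_add)
    also have "\<dots> = (\<Sum>j\<le>N. if j = k then p * hcomp k q else 0)"
      by (rule sum.cong) (auto simp: hcomp_of_homog[OF homog_mult[OF p(1) hcomp_homog]])
    finally have "hcomp (d + k) (p * q) = p * hcomp k q" using True by simp
    then show ?thesis using k p(2) by (simp add: hcomp_of_homog[OF pq])
  next
    case False
    show ?thesis
    proof (rule poly_mapping_eqI)
      fix m show "lookup (hcomp k q) m = lookup 0 m"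
        using N[of m] False by (cases "m \<in> keys q") (auto simp: lookup_hcomp in_keys_iff)
    qed
  qed
  show ?thesis unfolding homog_def
  proof
    fix m assume "m \<in> keys q"
    then have "lookup (hcomp (mon_degree m) q) m \<noteq> 0" by (simp add: lookup_hcomp in_keys_iff)
    then show "mon_degree m = e" using zero by fastforce
  qed
qed

text \<open>In the absence of unique factorisation the primes are divided out one at a
  time.\<close>

lemma prod_primes_dvd:
  fixes a :: S
  assumes "finite I" "\<And>i. i \<in> I \<Longrightarrow> prime_elem (g i)" "\<And>i. i \<in> I \<Longrightarrow> g i dvd a"
    "\<And>i j. i \<in> I \<Longrightarrow> j \<in> I \<Longrightarrow> i \<noteq> j \<Longrightarrow> \<not> g j dvd g i"
  shows "(\<Prod>i\<in>I. g i) dvd a"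
  using assms
proof (induction I arbitrary: a rule: finite_induct)
  case (insert i I)
  obtain b where b: "a = g i * b" using insert.prems(2)[of i] by (auto elim: dvdE)
  have "g j dvd b" if "j \<in> I" for j
    using insert.prems(1)[of j] insert.prems(2)[of j] insert.prems(3)[of i j] that insert.hyps(2)
    by (auto simp: b prime_elem_dvd_mult_iff)
  then have "(\<Prod>i\<in>I. g i) dvd b" using insert by auto
  then show ?case using insert.hyps by (simp add: b)
qed simp

lemma prime_not_dvd_prod:
  fixes p :: S
  assumes "prime_elem p" "finite I" "\<And>i. i \<in> I \<Longrightarrow> \<not> p dvd g i"
  shows "\<not> p dvd (\<Prod>i\<in>I. g i)"
  using assms(2,3)
proof (induction I rule: finite_induct)
  case empty
  then show ?case using prime_elem_not_unit[OF assms(1)] by simp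
next
  case (insert i I)
  then show ?case by (simp add: prime_elem_dvd_mult_iff[OF assms(1)])
qed

context simple_configuration
begin

lemma prime_line: "i < n \<Longrightarrow> prime_elem (lf (us i))"
  using prime_elem_lf nonzero by blast

lemma lines_not_dvd: assumes "i < n" "j < n" "i \<noteq> j" shows "\<not> lf (us i) dvd lf (us j)"
proof
  assume "lf (us i) dvd lf (us j)"
  then obtain c where "us j = c *s us i" using lf_dvd_lf_imp nonzero assms(1) by blast
  then have "cross (us i) (us j) = 0"
    by (simp add: cross_def vec_eq_iff forall_3 algebra_simps)
  then show False using distinct assms by blast
qed

text \<open>Modulo the linear form of one line a single term of the product rule survives, and its other
  factors are coprime to that form.\<close>

lemma annihilator_preserves_lines:
  assumes "der v (\<Prod>i<n. lf (us i)) = 0" "i < n"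
  shows "lf (us i) dvd der v (lf (us i))"
proof -
  let ?g = "\<Prod>j\<in>{..<n} - {i}. lf (us j)"
  have split: "(\<Prod>i<n. lf (us i)) = lf (us i) * ?g" using assms(2) by (simp add: prod.remove)
  have "\<not> lf (us i) dvd ?g"
    by (rule prime_not_dvd_prod[OF prime_line[OF assms(2)]]) (use lines_not_dvd assms(2) in auto)
  moreover have "der v (lf (us i)) * ?g = lf (us i) * (- der v ?g)"
    using assms(1) unfolding split der_simps by (simp add: eq_neg_iff_add_eq_0)
  then have "lf (us i) dvd der v (lf (us i)) * ?g" by simp
  ultimately show ?thesis using prime_line[OF assms(2)] by (simp add: prime_elem_dvd_mult_iff)
qed

end

lemma AR_iff: "v \<in> AR f \<longleftrightarrow> v \<in> free_module [0, 0, 0] \<and> der v f = 0"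
  by (simp add: AR_def der_def)

lemma AR_scale: assumes "\<kappa> \<noteq> 0" shows "AR (Const \<kappa> * f) = AR f"
proof -
  have "der v (Const \<kappa> * f) = Const \<kappa> * der v f" for v by (simp add: der_simps)
  then show ?thesis using assms by (auto simp: AR_iff)
qed

text \<open>The nine lines other than \<open>x\<close> come in four pairs that are exchanged by
  the reflection \<open>X \<mapsto> - X\<close>, and one line that it fixes. The pair with number
  \<open>k\<close> has the indices \<open>2 k + 1\<close> and \<open>2 k + 2\<close>; the fixed line has
  the index 9 and the direction \<open>p 4\<close>, \<open>q 4\<close>.\<close>

locale centred_arrangement =
  fixes x y1 y2 :: "complex ^ 3" and p q m :: "nat \<Rightarrow> complex"
begin

definition dir :: "nat \<Rightarrow> complex ^ 3" where
  "dir k = p k *s y1 + q k *s y2"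

definition lines :: "nat \<Rightarrow> complex ^ 3" where
  "lines i = (if i = 0 then x else if i = 9 then dir 4
     else if odd i then dir ((i - 1) div 2) - m ((i - 1) div 2) *s x
     else dir ((i - 1) div 2) + m ((i - 1) div 2) *s x)"

definition equation :: S where
  "equation = (\<Prod>i<10. lf (lines i))"

abbreviation X :: S where "X \<equiv> lf x"
abbreviation Y1 :: S where "Y1 \<equiv> lf y1"
abbreviation Y2 :: S where "Y2 \<equiv> lf y2"

definition along :: "nat \<Rightarrow> S \<Rightarrow> S \<Rightarrow> S" where
  "along k A B = Const (p k) * A + Const (q k) * B"

definition quadric :: "nat \<Rightarrow> S" where
  "quadric k = (along k Y1 Y2)\<^sup>2 - (Const (m k) * X)\<^sup>2"

text \<open>The derivation that annihilates \<open>X\<close> and takes the values \<open>A\<close>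
  and \<open>B\<close> on \<open>Y1\<close> and \<open>Y2\<close> preserves all lines. For a pair
  of lines the two conditions combine to one for their product, because the derivation takes the
  same value on both equations.\<close>

definition tangent :: "S \<Rightarrow> S \<Rightarrow> bool" where
  "tangent A B \<longleftrightarrow> (\<forall>k<4. quadric k dvd along k A B) \<and> along 4 Y1 Y2 dvd along 4 A B"

text \<open>The derivation \<open>v\<close> is the sum of \<open>h\<close> times the Euler field
  and a derivation that annihilates \<open>X\<close>; the latter has the values \<open>A\<close>,
  \<open>B\<close>.\<close>

definition coords :: "(nat \<Rightarrow> S) \<Rightarrow> S \<Rightarrow> S \<Rightarrow> bool" where
  "coords v A B \<longleftrightarrow> (\<exists>h. der v X = h * X \<and> der v Y1 = A + h * Y1 \<and> der v Y2 = B + h * Y2)"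

lemma along_add: "along k (A + A') (B + B') = along k A B + along k A' B'"
  and along_mult: "along k (c * A) (c * B) = c * along k A B"
  by (simp_all add: along_def algebra_simps)

lemma der_along: "der v (along k A B) = along k (der v A) (der v B)"
  by (simp add: along_def der_simps)

lemma lf_dir: "lf (dir k) = along k Y1 Y2"
  by (simp add: dir_def along_def lf_simps)

lemma lines_pair:
  assumes "k < 4"
  shows "lf (lines (2 * k + 1)) = along k Y1 Y2 - Const (m k) * X"
    "lf (lines (2 * k + 2)) = along k Y1 Y2 + Const (m k) * X"
proof -
  have "2 * k + 1 \<noteq> 9" using assms by linarith
  then show "lf (lines (2 * k + 1)) = along k Y1 Y2 - Const (m k) * X"
    by (simp add: lines_def lf_simps lf_dir)
  have "2 * k + 2 \<noteq> 9" by presburger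
  then show "lf (lines (2 * k + 2)) = along k Y1 Y2 + Const (m k) * X"
    by (simp add: lines_def lf_simps lf_dir)
qed

lemma lines_special: "lines 0 = x" "lf (lines 9) = along 4 Y1 Y2"
  by (simp_all add: lines_def lf_dir)

lemma quadric_eq:
  assumes "k < 4" shows "quadric k = lf (lines (2 * k + 1)) * lf (lines (2 * k + 2))"
  unfolding quadric_def lines_pair[OF assms] by (simp add: power2_eq_square algebra_simps)

lemma line_index_cases:
  fixes i :: nat
  assumes "i < 10"
  obtains "i = 0" | "i = 9" | k where "k < 4" "i = 2 * k + 1" | k where "k < 4" "i = 2 * k + 2"
proof -
  consider "i = 0" | "i = 9" | "odd i" "i < 9" | "even i" "i > 0" "i < 9"
    using assms by (cases "i = 0"; cases "i = 9"; cases "odd i"; simp)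
  then show ?thesis
  proof cases
    case 3
    then have "(i - 1) div 2 < 4" "i = 2 * ((i - 1) div 2) + 1" by presburger+
    then show ?thesis using that(3) by blast
  next
    case 4
    then have "(i - 2) div 2 < 4" "i = 2 * ((i - 2) div 2) + 2" by presburger+
    then show ?thesis using that(4) by blast
  qed (use that in auto)
qed

lemma coords_combination:
  assumes "\<And>i. i < length ds \<Longrightarrow> coords (R i) (A i) (B i)"
  shows "coords (combination ds R w) (\<Sum>i<length ds. w i * A i) (\<Sum>i<length ds. w i * B i)"
proof -
  obtain h where h: "\<And>i. i < length ds \<Longrightarrow>
      der (R i) X = h i * X \<and> der (R i) Y1 = A i + h i * Y1 \<and> der (R i) Y2 = B i + h i * Y2"
    using assms unfolding coords_def by metis
  have "der (combination ds R w) u = (\<Sum>i<length ds. w i * der (R i) u)" for u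
    unfolding combination_def by (simp add: der_vector_simps)
  then show ?thesis unfolding coords_def
    by (intro exI[of _ "\<Sum>i<length ds. w i * h i"])
       (auto simp: h sum_distrib_left sum_distrib_right algebra_simps sum.distrib)
qed

end

locale simple_centred_arrangement = centred_arrangement +
  assumes basis: "det3 x y1 y2 \<noteq> 0"
    and simple: "simple_configuration lines 10"
    and directions: "\<And>k. k < 5 \<Longrightarrow> p k \<noteq> 0 \<or> q k \<noteq> 0"
begin

sublocale simple_configuration lines 10 by (rule simple)

lemma X_nonzero: "X \<noteq> 0"
  using basis by (auto simp: det3_def)

lemma coords_unique:
  assumes "coords v A B" "coords v A' B'" shows "A = A'" "B = B'"
proof -
  obtain h h' where "der v X = h * X" "der v Y1 = A + h * Y1" "der v Y2 = B + h * Y2"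
    "der v X = h' * X" "der v Y1 = A' + h' * Y1" "der v Y2 = B' + h' * Y2"
    using assms unfolding coords_def by blast
  then show "A = A'" "B = B'" using X_nonzero by auto
qed

lemma AR_tangent_coords:
  assumes v: "v \<in> AR equation"
  obtains A B where "coords v A B" "tangent A B"
proof -
  have pres: "lf (lines i) dvd der v (lf (lines i))" if "i < 10" for i
    using annihilator_preserves_lines that v unfolding AR_iff equation_def by blast
  have "X dvd der v X" using pres[of 0] by (simp add: lines_special(1))
  then obtain h where h: "der v X = h * X" by (metis dvdE mult.commute)
  define A where "A = der v Y1 - h * Y1"
  define B where "B = der v Y2 - h * Y2"
  have dY: "der v Y1 = A + h * Y1" "der v Y2 = B + h * Y2" by (simp_all add: A_def B_def)
  have factor: "lf u dvd along k A B"
    if "lf u = along k Y1 Y2 + Const c * X" "lf u dvd der v (lf u)" for u k c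
  proof -
    have "der v (lf u) = along k A B + lf u * h"
      unfolding that(1) der_simps der_along by (simp add: h dY along_def algebra_simps)
    then show ?thesis using that(2) by (simp add: dvd_add_left_iff)
  qed
  have "quadric k dvd along k A B" if k: "k < 4" for k
  proof -
    have lt: "2 * k + 1 < 10" "2 * k + 2 < 10" using k by auto
    have 1: "lf (lines (2 * k + 1)) dvd along k A B"
      by (rule factor[of _ _ "- m k", OF _ pres[OF lt(1)]]) (simp add: lines_pair(1)[OF k] del: One_nat_def)
    have 2: "lf (lines (2 * k + 2)) dvd along k A B"
      by (rule factor[of _ _ "m k", OF lines_pair(2)[OF k] pres[OF lt(2)]])
    from 1 obtain b where b: "along k A B = lf (lines (2 * k + 1)) * b" by (elim dvdE)
    have "\<not> lf (lines (2 * k + 2)) dvd lf (lines (2 * k + 1))"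
      using lt by (intro lines_not_dvd) auto
    then have "lf (lines (2 * k + 2)) dvd b"
      using 2 prime_line[OF lt(2)] unfolding b by (simp add: prime_elem_dvd_mult_iff del: One_nat_def)
    then show ?thesis unfolding quadric_eq[OF k] b by (rule mult_dvd_mono[OF dvd_refl])
  qed
  moreover have "along 4 Y1 Y2 dvd along 4 A B"
    using pres[of 9] factor[of "lines 9" 4 0] lines_special(2) by simp
  ultimately have "tangent A B" by (simp add: tangent_def)
  moreover have "coords v A B" using h dY unfolding coords_def by blast
  ultimately show ?thesis using that by blast
qed

text \<open>Saito's criterion: two tangent fields are proportional along every line, so their determinant
  vanishes there.\<close>

lemma saito_dvd:
  assumes "tangent A B" "tangent A' B'"
  shows "(\<Prod>i\<in>{1..<10}. lf (lines i)) dvd A * B' - A' * B"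
proof (rule prod_primes_dvd)
  have step: "l dvd A * B' - A' * B"
    if l: "prime_elem l" and 1: "l dvd along k A B" and 2: "l dvd along k A' B'" and k: "k < 5" for l k
  proof -
    have c: "\<not> l dvd Const c" if "c \<noteq> 0" for c
    proof
      assume "l dvd Const c"
      then have "l dvd Const (1 / c) * Const c" by (rule dvd_mult)
      then show False using l that by (simp add: prime_elem_def flip: Const_mult)
    qed
    have "along k A B * B' - B * along k A' B' = Const (p k) * (A * B' - A' * B)"
      "A * along k A' B' - A' * along k A B = Const (q k) * (A * B' - A' * B)"
      by (simp_all add: along_def algebra_simps)
    then have "l dvd Const (p k) * (A * B' - A' * B)" "l dvd Const (q k) * (A * B' - A' * B)"
      using 1 2 by (metis dvd_diff dvd_mult dvd_mult2)+
    then show ?thesis using directions[OF k] c l by (auto simp: prime_elem_dvd_mult_iff)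
  qed
  show "lf (lines i) dvd A * B' - A' * B" if i: "i \<in> {1..<10}" for i
  proof -
    have P: "prime_elem (lf (lines i))" using i by (intro prime_line) auto
    have "i < 10" using i by simp
    then show ?thesis
    proof (cases rule: line_index_cases)
      case 2
      then show ?thesis
        using step[OF P, of 4] assms lines_special(2) by (simp add: tangent_def)
    next
      case (3 k)
      then have "lf (lines i) dvd quadric k" by (simp add: quadric_eq)
      then show ?thesis using step[OF P, of k] 3 assms by (auto simp: tangent_def intro: dvd_trans)
    next
      case (4 k)
      then have "lf (lines i) dvd quadric k" by (simp add: quadric_eq)
      then show ?thesis using step[OF P, of k] 4 assms by (auto simp: tangent_def intro: dvd_trans)
    qed (use i in simp)
  qed
  show "\<not> lf (lines j) dvd lf (lines i)" if "i \<in> {1..<10}" "j \<in> {1..<10}" "i \<noteq> j" for i j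
    using that by (intro lines_not_dvd) auto
qed (use prime_line in auto)

text \<open>The factor \<open>10 h\<close> is the contribution of the Euler field, which
  multiplies each of the ten linear forms by \<open>h\<close>.\<close>

lemma der_equation:
  assumes h: "der v X = h * X" and dY: "der v Y1 = A + h * Y1" "der v Y2 = B + h * Y2"
    and c: "\<And>k. k < 4 \<Longrightarrow> along k A B = quadric k * c k" and e: "along 4 A B = along 4 Y1 Y2 * e"
  shows "der v equation = ((\<Sum>k<4. 2 * along k Y1 Y2 * c k) + e + 10 * h) * equation"
proof -
  define f where "f i = (if i = 0 then h else if i = 9 then e + h
     else if odd i then lf (lines (i + 1)) * c ((i - 1) div 2) + h
     else lf (lines (i - 1)) * c ((i - 1) div 2) + h)" for i
  have along: "der v (along k Y1 Y2) = along k A B + h * along k Y1 Y2" for k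
    unfolding der_along dY along_add along_mult ..
  have pair: "der v (lf (lines (2 * k + 1))) = f (2 * k + 1) * lf (lines (2 * k + 1))"
    "der v (lf (lines (2 * k + 2))) = f (2 * k + 2) * lf (lines (2 * k + 2))" if k: "k < 4" for k
  proof -
    have f1: "f (2 * k + 1) = lf (lines (2 * k + 2)) * c k + h" using k by (auto simp: f_def)
    show "der v (lf (lines (2 * k + 1))) = f (2 * k + 1) * lf (lines (2 * k + 1))"
      unfolding f1 lines_pair[OF k] der_simps along
      by (simp add: c[OF k] quadric_def h algebra_simps power2_eq_square)
    have f2: "f (2 * k + 2) = lf (lines (2 * k + 1)) * c k + h" using k by (auto simp: f_def)
    show "der v (lf (lines (2 * k + 2))) = f (2 * k + 2) * lf (lines (2 * k + 2))"
      unfolding f2 lines_pair[OF k] der_simps along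
      by (simp add: c[OF k] quadric_def h algebra_simps power2_eq_square)
  qed
  have "der v (lf (lines i)) = f i * lf (lines i)" if "i < 10" for i
    using that
  proof (cases rule: line_index_cases)
    case 1
    then show ?thesis by (simp add: f_def lines_special h)
  next
    case 2
    then show ?thesis by (simp add: f_def lines_special along e algebra_simps)
  qed (use pair in auto)
  then have "der v equation = (\<Sum>i<10. f i) * equation"
    unfolding equation_def by (intro der_prod) auto
  moreover have "(\<Sum>i<10. f i) = (\<Sum>k<4. 2 * along k Y1 Y2 * c k) + e + 10 * h"
  proof -
    have two: "f (2 * k + 1) + f (2 * k + 2) = 2 * along k Y1 Y2 * c k + 2 * h" if "k < 4" for k
    proof -
      have "f (2 * k + 1) = lf (lines (2 * k + 2)) * c k + h" "f (2 * k + 2) = lf (lines (2 * k + 1)) * c k + h"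
        using that by (auto simp: f_def)
      then show ?thesis unfolding lines_pair[OF that] by (simp add: algebra_simps)
    qed
    have "(\<Sum>i<10. f i) = f 0 + (f 1 + f 2) + (f 3 + f 4) + (f 5 + f 6) + (f 7 + f 8) + f 9"
      by (simp add: eval_nat_numeral)
    also have "\<dots> = h + (2 * along 0 Y1 Y2 * c 0 + 2 * h) + (2 * along 1 Y1 Y2 * c 1 + 2 * h)
        + (2 * along 2 Y1 Y2 * c 2 + 2 * h) + (2 * along 3 Y1 Y2 * c 3 + 2 * h) + (e + h)"
      using two[of 0] two[of 1] two[of 2] two[of 3] by (simp add: f_def)
    also have "\<dots> = (\<Sum>k<4. 2 * along k Y1 Y2 * c k) + e + 10 * h"
      by (simp add: eval_nat_numeral algebra_simps)
    finally show ?thesis .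
  qed
  ultimately show ?thesis by simp
qed

lemma equation_nonzero: "equation \<noteq> 0"
  using nonzero by (simp add: equation_def)

text \<open>The Euler field multiplies the equation by its degree, so no nonzero multiple of it is an
  algebraic relation.\<close>

lemma coords_zero_imp_zero:
  assumes v: "v \<in> AR equation" and c: "coords v 0 0"
  shows "v = (\<lambda>_. 0)"
proof -
  obtain h where h: "der v X = h * X" "der v Y1 = 0 + h * Y1" "der v Y2 = 0 + h * Y2"
    using c unfolding coords_def by auto
  have "der v equation = 10 * h * equation"
    using der_equation[OF h, of "\<lambda>_. 0" 0] by (simp add: along_def)
  then have "h = 0" using v equation_nonzero by (simp add: AR_iff)
  then have "der v (lf x) = 0" "der v (lf y1) = 0" "der v (lf y2) = 0" using h by auto
  then have "Const (det3 x y1 y2) * v 0 = 0" "Const (det3 x y1 y2) * v 1 = 0" "Const (det3 x y1 y2) * v 2 = 0"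
    unfolding der_lf det3_def Const_add Const_mult Const_diff by algebra+
  then have "v 0 = 0" "v 1 = 0" "v 2 = 0" using basis by auto
  moreover have "v i = 0" if "i \<ge> 3" for i
    using v that by (simp add: AR_iff free_module_def)
  moreover have "i = 0 \<or> i = 1 \<or> i = 2 \<or> i \<ge> 3" for i :: nat by linarith
  ultimately show ?thesis by (metis ext)
qed

text \<open>The coefficients of the derivation are obtained by Cramer's rule from the dual
  basis.\<close>

lemma prescribed_derivation:
  obtains v where "v \<in> free_module [0, 0, 0]" "der v X = \<xi>" "der v Y1 = \<eta>" "der v Y2 = \<zeta>"
    "\<And>d i. homog d \<xi> \<Longrightarrow> homog d \<eta> \<Longrightarrow> homog d \<zeta> \<Longrightarrow> homog d (v i)"
proof -
  define D where "D = det3 x y1 y2"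
  define a where "a = (1 / D) *s cross y1 y2"
  define b where "b = (1 / D) *s cross y2 x"
  define c where "c = (1 / D) *s cross x y1"
  define idx where "idx i = (if i = 0 then 1 else if i = 1 then 2 else 3 :: 3)" for i :: nat
  define v where "v i = (if i < 3 then Const (a $ idx i) * \<xi> + Const (b $ idx i) * \<eta>
    + Const (c $ idx i) * \<zeta> else 0)" for i :: nat
  have der: "der v (lf u) = Const (dot u a) * \<xi> + Const (dot u b) * \<eta> + Const (dot u c) * \<zeta>" for u
    unfolding der_lf by (simp add: v_def idx_def dot_def Const_add Const_mult algebra_simps)
  have D: "det3 x y1 y2 = D" "det3 y1 y2 x = D" "det3 y2 x y1 = D" "D \<noteq> 0"
    using basis by (simp_all add: D_def) (simp_all add: det3_def algebra_simps)
  have "der v X = \<xi>" "der v Y1 = \<eta>" "der v Y2 = \<zeta>"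
    using D unfolding der by (simp_all add: a_def b_def c_def dot_simps dot_cross det3_degenerate)
  moreover have "v \<in> free_module [0, 0, 0]" by (simp add: v_def free_module_def)
  moreover have "homog d (v i)" if "homog d \<xi>" "homog d \<eta>" "homog d \<zeta>" for d i
    using that by (auto simp: v_def intro!: homog_add homog_scale homog_0)
  ultimately show ?thesis using that by blast
qed

lemma homog_along: "homog d A \<Longrightarrow> homog d B \<Longrightarrow> homog d (along k A B)"
  by (auto simp: along_def intro: homog_add homog_scale)

lemma quadric_nonzero: "k < 4 \<Longrightarrow> quadric k \<noteq> 0"
  using nonzero by (simp add: quadric_eq)

text \<open>A tangent pair multiplies the equation by a polynomial \<open>G\<close>. Adding
  \<open>- G / 10\<close> times the Euler field cancels this factor and keeps the degree.\<close>

lemma tangent_lift: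
  assumes t: "tangent A B" and hom: "homog (r + 2) A" "homog (r + 2) B"
  obtains v where "v \<in> AR equation" "coords v A B" "v \<in> graded_part [0, 0, 0] (r + 2)"
proof -
  have "\<forall>k. \<exists>c. k < 4 \<longrightarrow> along k A B = quadric k * c"
    using t by (auto simp: tangent_def dvd_def)
  then obtain c where c: "\<And>k. k < 4 \<Longrightarrow> along k A B = quadric k * c k" by metis
  obtain e where e: "along 4 A B = along 4 Y1 Y2 * e" using t by (auto simp: tangent_def dvd_def)
  have "homog 2 (quadric k)" for k
    unfolding quadric_def
    using homog_power[OF homog_along[OF homog_lf homog_lf], of 2] homog_power[OF homog_scale[OF homog_lf], of 2]
    by (intro homog_diff) simp_all
  then have hc: "homog r (c k)" if "k < 4" for k
    using homog_cofactor[of 2 "quadric k" r "c k"] quadric_nonzero[OF that]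
      homog_along[OF hom, of k] c[OF that] by (simp add: add.commute)
  have L4: "along 4 Y1 Y2 \<noteq> 0" using nonzero[of 9] by (simp flip: lines_special(2))
  have he: "homog (r + 1) e"
    using homog_cofactor[of 1 "along 4 Y1 Y2" "r + 1" e] homog_along[OF homog_lf homog_lf] L4
      homog_along[OF hom, of 4] e by (simp add: add.commute)
  define G where "G = (\<Sum>k<4. 2 * along k Y1 Y2 * c k) + e"
  define h where "h = Const (- 1 / 10) * G"
  have hG: "homog (r + 1) G"
    unfolding G_def
  proof (intro homog_add homog_sum he)
    fix k :: nat assume "k \<in> {..<4}"
    then have "homog (0 + 1 + r) (2 * along k Y1 Y2 * c k)"
      using hc by (intro homog_mult homog_numeral homog_along homog_lf) auto
    then show "homog (r + 1) (2 * along k Y1 Y2 * c k)" by (simp add: add.commute)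
  qed
  have "10 * h = - (10 * Const (1 / 10)) * G" by (simp add: h_def)
  also have "10 * Const (1 / 10) = 1" using Const_mult[of 10 "1 / 10"] by simp
  finally have h10: "G + 10 * h = 0" by simp
  have hh: "homog (r + 2) (h * lf u)" for u
    using homog_mult[OF homog_scale[OF hG] homog_lf, of "- 1 / 10" u] by (simp add: h_def)
  obtain v where v: "v \<in> free_module [0, 0, 0]" "der v X = h * X" "der v Y1 = A + h * Y1"
    "der v Y2 = B + h * Y2" and hv: "\<And>i. homog (r + 2) (v i)"
    using prescribed_derivation[of "h * X" "A + h * Y1" "B + h * Y2"] hh hom homog_add by metis
  have "der v equation = 0"
    using der_equation[OF v(2-4) c e] h10 by (simp add: G_def)
  then have "v \<in> AR equation" using v by (simp add: AR_iff)
  moreover have "coords v A B" using v unfolding coords_def by blast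
  moreover have "v \<in> graded_part [0, 0, 0] (r + 2)"
    using v(1) hv by (auto simp: graded_part_iff nth_Cons split: nat.splits)
  ultimately show ?thesis using that by blast
qed

lemma AR_combination:
  assumes "\<And>i. i < length ds \<Longrightarrow> R i \<in> AR equation"
  shows "combination ds R w \<in> AR equation"
proof -
  have "der (combination ds R w) u = (\<Sum>i<length ds. w i * der (R i) u)" for u
    unfolding combination_def by (simp add: der_vector_simps)
  then show ?thesis
    using assms by (auto simp: AR_iff combination_def free_module_def intro!: sum.neutral)
qed

text \<open>An algebraic relation is determined by its coordinates, so generators and relations of
  the module of tangent pairs lift to generators and relations of the algebraic relations.\<close>

lemma resolution_of_tangent_fields:
  assumes deg: "\<And>i. i < length ds \<Longrightarrow> ds ! i \<ge> 2"
    and hom: "\<And>i. i < length ds \<Longrightarrow> homog (ds ! i) (A i)" "\<And>i. i < length ds \<Longrightarrow> homog (ds ! i) (B i)"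
    and tan: "\<And>i. i < length ds \<Longrightarrow> tangent (A i) (B i)"
    and gen: "\<And>A' B'. tangent A' B' \<Longrightarrow>
      \<exists>w. A' = (\<Sum>i<length ds. w i * A i) \<and> B' = (\<Sum>i<length ds. w i * B i)"
    and \<rho>: "\<And>j. j < length es \<Longrightarrow> \<rho> j \<in> graded_part ds (es ! j)"
    and \<rho>_min: "\<And>j k. j < length es \<Longrightarrow> \<rho> j k \<in> irrelevant_ideal"
    and rel: "\<And>w. w \<in> free_module ds \<Longrightarrow>
      (\<Sum>i<length ds. w i * A i) = 0 \<and> (\<Sum>i<length ds. w i * B i) = 0 \<longleftrightarrow>
      (\<exists>c\<in>free_module es. w = combination es \<rho> c)"
    and inj: "\<And>c. c \<in> free_module es \<Longrightarrow> combination es \<rho> c = (\<lambda>_. 0) \<Longrightarrow> c = (\<lambda>_. 0)"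
  shows "has_minimal_graded_resolution [0, 0, 0] (AR equation) (finite_resolution [ds, es])"
proof -
  have "\<exists>v. v \<in> AR equation \<and> coords v (A i) (B i) \<and> v \<in> graded_part [0, 0, 0] (ds ! i)"
    if i: "i < length ds" for i
  proof -
    have eq: "ds ! i - 2 + 2 = ds ! i" using deg[OF i] by simp
    show ?thesis
      using tangent_lift[OF tan[OF i], of "ds ! i - 2"] hom[OF i] unfolding eq by blast
  qed
  then obtain R where R: "\<And>i. i < length ds \<Longrightarrow> R i \<in> AR equation"
    "\<And>i. i < length ds \<Longrightarrow> coords (R i) (A i) (B i)"
    "\<And>i. i < length ds \<Longrightarrow> R i \<in> graded_part [0, 0, 0] (ds ! i)" by metis
  have cmb: "coords (combination ds R w) (\<Sum>i<length ds. w i * A i) (\<Sum>i<length ds. w i * B i)" for w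
    using coords_combination R(2) by blast
  have cmb_AR: "combination ds R w \<in> AR equation" for w
    using AR_combination R(1) by blast
  show ?thesis
  proof (rule has_minimal_graded_resolution_of_matrices[OF R(3) \<rho> \<rho>_min])
    show "combination ds R ` free_module ds = AR equation"
    proof (intro equalityI subsetI)
      fix v assume v: "v \<in> AR equation"
      then obtain A' B' where AB: "coords v A' B'" "tangent A' B'" using AR_tangent_coords by blast
      then obtain w where w: "A' = (\<Sum>i<length ds. w i * A i)" "B' = (\<Sum>i<length ds. w i * B i)"
        using gen by blast
      define u where "u = (\<lambda>i. v i - combination ds R w i)"
      have der_u: "der u f = der v f - der (combination ds R w) f" for f
        unfolding u_def by (rule der_vector_simps)
      have "u \<in> AR equation"
        using v cmb_AR[of w] der_u by (auto simp: AR_iff free_module_def u_def)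
      moreover have "coords u 0 0"
      proof -
        obtain h h' where "der v X = h * X" "der v Y1 = A' + h * Y1" "der v Y2 = B' + h * Y2"
          "der (combination ds R w) X = h' * X" "der (combination ds R w) Y1 = A' + h' * Y1"
          "der (combination ds R w) Y2 = B' + h' * Y2"
          using AB(1) cmb[of w] unfolding w[symmetric] coords_def by blast
        then show ?thesis unfolding coords_def der_u
          by (intro exI[of _ "h - h'"]) (simp add: algebra_simps)
      qed
      ultimately have "u = (\<lambda>_. 0)" by (rule coords_zero_imp_zero)
      then have "v = combination ds R w" by (simp add: u_def fun_eq_iff)
      also have "\<dots> = combination ds R (\<lambda>i. if i < length ds then w i else 0)"
        by (simp add: combination_def)
      finally show "v \<in> combination ds R ` free_module ds" by (auto simp: free_module_def)
    qed (use cmb_AR in auto)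
    have "combination ds R w = (\<lambda>_. 0) \<longleftrightarrow>
        (\<Sum>i<length ds. w i * A i) = 0 \<and> (\<Sum>i<length ds. w i * B i) = 0" for w
    proof
      assume "combination ds R w = (\<lambda>_. 0)"
      then have "coords (\<lambda>_. 0) (\<Sum>i<length ds. w i * A i) (\<Sum>i<length ds. w i * B i)"
        using cmb[of w] by simp
      moreover have "coords (\<lambda>_. 0) 0 0" unfolding coords_def der_def by (intro exI[of _ 0]) simp
      ultimately show "(\<Sum>i<length ds. w i * A i) = 0 \<and> (\<Sum>i<length ds. w i * B i) = 0"
        using coords_unique[of "\<lambda>_. 0"] by blast
    next
      assume "(\<Sum>i<length ds. w i * A i) = 0 \<and> (\<Sum>i<length ds. w i * B i) = 0"
      then have "coords (combination ds R w) 0 0" using cmb[of w] by simp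
      then show "combination ds R w = (\<lambda>_. 0)"
        using coords_zero_imp_zero cmb_AR by blast
    qed
    moreover have "combination es \<rho> c \<in> free_module ds" for c
    proof -
      have "\<rho> j \<in> free_module ds" if "j < length es" for j using \<rho>[OF that] by (simp add: graded_part_def)
      then show ?thesis by (auto simp: combination_def free_module_def intro!: sum.neutral)
    qed
    ultimately show "combination es \<rho> ` free_module es = {w \<in> free_module ds. combination ds R w = (\<lambda>_. 0)}"
      using rel by blast
  qed (use inj in auto)
qed

end

section \<open>Modules of rank two generated by three or four pairs\<close>

lemma proportional_to_two_imp_zero:
  fixes A B :: S
  assumes "A * B1 = A1 * B" "A * B2 = A2 * B" "A1 * B2 - A2 * B1 \<noteq> 0"
  shows "A = 0 \<and> B = 0"
proof -
  have "A * (A1 * B2 - A2 * B1) = 0" "B * (A1 * B2 - A2 * B1) = 0"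
    using assms(1,2) by algebra+
  then show ?thesis using assms(3) by simp
qed

lemma not_dvd_by_eval: "eval p v = 0 \<Longrightarrow> eval c v \<noteq> 0 \<Longrightarrow> \<not> p dvd c"
  by (auto simp: eval_simps elim!: dvdE)

text \<open>A product of two primes, even equal ones, divides \<open>b\<close> as soon as it
  divides \<open>b c\<close> and neither prime divides \<open>c\<close>.\<close>

lemma cancel_two_primes:
  fixes b c :: S
  assumes "prime_elem p1" "prime_elem p2" "\<not> p1 dvd c" "\<not> p2 dvd c" "k \<noteq> 0"
    and "Const k * (p1 * p2) dvd b * c"
  shows "Const k * (p1 * p2) dvd b"
proof -
  have "p1 dvd b * c" using assms(6) by (meson dvd_mult_left dvd_mult_right dvd_trans)
  then obtain b' where b': "b = p1 * b'" using assms(1,3) by (auto simp: prime_elem_dvd_mult_iff elim: dvdE)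
  obtain d where "p1 * b' * c = Const k * (p1 * p2) * d" using assms(6) unfolding b' by (elim dvdE)
  then have "p1 * (b' * c) = p1 * (p2 * (Const k * d))" by (simp add: algebra_simps)
  then have "b' * c = p2 * (Const k * d)" using assms(1) by (simp add: prime_elem_def)
  then have "p2 dvd b'" using assms(2,4) by (metis dvd_triv_left prime_elem_dvd_mult_iff)
  then obtain b'' where b'': "b = p1 * (p2 * b'')" using b' by (auto elim: dvdE)
  have "Const k * Const (1 / k) = 1" using assms(5) by (simp flip: Const_mult)
  then have "b = Const k * (p1 * p2) * (Const (1 / k) * b'')" unfolding b'' by algebra
  then show ?thesis by simp
qed

subsection \<open>Exactness of a Koszul complex\<close>

lemma coprime_syzygy:
  fixes p q a b :: S
  assumes reg: "\<And>b. q dvd b * p \<Longrightarrow> q dvd b" and "q \<noteq> 0" and "a * p + b * q = 0"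
  obtains g where "a = q * g" "b = - (p * g)"
proof -
  have "a * p = q * (- b)" using assms(3) by (simp add: eq_neg_iff_add_eq_0 mult.commute)
  then have "q dvd a" using reg by (metis dvd_triv_left)
  then obtain g where g: "a = q * g" by (elim dvdE)
  then have "q * (p * g + b) = 0" using assms(3) by (simp add: algebra_simps)
  then have "p * g + b = 0" using assms(2) by simp
  then have "b = - (p * g)" by (simp add: eq_neg_iff_add_eq_0 add.commute)
  with g show ?thesis using that by blast
qed

text \<open>Restriction to the plane \<open>lf u = 0\<close> turns the equation into a syzygy of
  \<open>p\<close> and \<open>q\<close>, which are unchanged by it. Since \<open>p\<close> and
  \<open>q\<close> are coprime, \<open>c\<close> and \<open>d\<close> are those of a trivial
  syzygy up to multiples of \<open>lf u\<close>.\<close>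

lemma linear_form_regular_mod:
  assumes reg: "\<And>b. q dvd b * p \<Longrightarrow> q dvd b" and q: "q \<noteq> 0" and a: "dot u a = 1"
    and fix_p: "restrict_to u a p = p" and fix_q: "restrict_to u a q = q"
    and eq: "lf u * b = p * c + q * d"
  shows "\<exists>c' d'. b = p * c' + q * d'"
proof -
  let ?\<sigma> = "restrict_to u a"
  have "?\<sigma> (lf u) = 0" by (simp add: restrict_to_lf a lf_simps)
  then have "?\<sigma> c * p + ?\<sigma> d * q = 0"
    using arg_cong[OF eq, of ?\<sigma>] by (simp add: restrict_to_simps fix_p fix_q mult.commute)
  then obtain g where g: "?\<sigma> c = q * g" "?\<sigma> d = - (p * g)" using coprime_syzygy[OF reg q] by blast
  obtain c' where c': "c - ?\<sigma> c = lf u * c'" using restrict_to_dvd[of u c a] by (elim dvdE)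
  obtain d' where d': "d - ?\<sigma> d = lf u * d'" using restrict_to_dvd[of u d a] by (elim dvdE)
  have "lf u * (b - (p * c' + q * d')) = 0" using eq c' d' g by algebra
  moreover have "u \<noteq> 0" using a by (auto simp: dot_simps)
  ultimately show ?thesis by auto
qed

text \<open>For regularity of \<open>C2\<close> modulo \<open>(C1, C3)\<close> it suffices that a
  power of the regular form \<open>lf u\<close> lies in \<open>(C1, C2, C3)\<close>.\<close>

lemma koszul_exact:
  assumes reg: "\<And>b. C3 dvd b * C1 \<Longrightarrow> C3 dvd b" and C3: "C3 \<noteq> 0" and a: "dot u a = 1"
    and fix1: "restrict_to u a C1 = C1" and fix3: "restrict_to u a C3 = C3"
    and power: "lf u ^ n = C1 * \<alpha> + C2 * \<beta> + C3 * \<gamma>"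
    and syz: "c1 * C1 + c2 * C2 + c3 * C3 = 0"
  shows "\<exists>w1 w2 w3. c1 = C2 * w3 - C3 * w2 \<and> c2 = C3 * w1 - C1 * w3 \<and> c3 = C1 * w2 - C2 * w1"
proof -
  have "\<exists>c' d'. b = C1 * c' + C3 * d'" if "lf u ^ k * b = C1 * c + C3 * d" for k b c d
    using that
  proof (induction k arbitrary: b)
    case (Suc k)
    then have "\<exists>c' d'. lf u * b = C1 * c' + C3 * d'" by (simp add: mult.assoc mult.left_commute)
    then show ?case using linear_form_regular_mod[OF reg C3 a fix1 fix3] by blast
  qed auto
  moreover have "lf u ^ n * c2 = C1 * (\<alpha> * c2 - c1 * \<beta>) + C3 * (\<gamma> * c2 - c3 * \<beta>)"
    unfolding power using syz by algebra
  ultimately obtain \<delta> \<epsilon> where c2: "c2 = C1 * \<delta> + C3 * \<epsilon>" by blast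
  have "(c1 + \<delta> * C2) * C1 + (c3 + \<epsilon> * C2) * C3 = 0" using syz unfolding c2 by algebra
  then obtain g where g: "c1 + \<delta> * C2 = C3 * g" "c3 + \<epsilon> * C2 = - (C1 * g)"
    using coprime_syzygy[OF reg C3] by blast
  show ?thesis
    by (intro exI[of _ \<epsilon>] exI[of _ "- g"] exI[of _ "- \<delta>"])
       (use g c2 in \<open>auto simp: algebra_simps eq_diff_eq\<close>)
qed

subsection \<open>Three generators\<close>

text \<open>Three pairs in a module of rank two with one relation. By \<open>dets\<close> the
  relation is given by the determinants of the pairs up to the common factor
  \<open>\<Delta>\<close>.\<close>

locale three_pairs =
  fixes A1 B1 A2 B2 A3 B3 C1 C2 C3 \<Delta> :: S
  assumes relA: "C1 * A1 + C2 * A2 + C3 * A3 = 0" and relB: "C1 * B1 + C2 * B2 + C3 * B3 = 0"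
    and det: "A1 * B2 - A2 * B1 = C3 * \<Delta>" and nz: "C3 \<noteq> 0" "\<Delta> \<noteq> 0"
begin

lemma dets: "A2 * B3 - A3 * B2 = C1 * \<Delta>" "A3 * B1 - A1 * B3 = C2 * \<Delta>"
proof -
  have "C3 * (A2 * B3 - A3 * B2 - C1 * \<Delta>) = 0" "C3 * (A3 * B1 - A1 * B3 - C2 * \<Delta>) = 0"
    using relA relB det by algebra+
  then show "A2 * B3 - A3 * B2 = C1 * \<Delta>" "A3 * B1 - A1 * B3 = C2 * \<Delta>" using nz by auto
qed

lemma generate:
  assumes koszul: "\<And>c1 c2 c3. c1 * C1 + c2 * C2 + c3 * C3 = 0 \<Longrightarrow>
      \<exists>w1 w2 w3. c1 = C2 * w3 - C3 * w2 \<and> c2 = C3 * w1 - C1 * w3 \<and> c3 = C1 * w2 - C2 * w1"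
    and saito: "\<Delta> dvd A * B1 - A1 * B" "\<Delta> dvd A * B2 - A2 * B" "\<Delta> dvd A * B3 - A3 * B"
  shows "\<exists>w1 w2 w3. A = w1 * A1 + w2 * A2 + w3 * A3 \<and> B = w1 * B1 + w2 * B2 + w3 * B3"
proof -
  obtain c1 c2 c3 where c: "A * B1 - A1 * B = \<Delta> * c1" "A * B2 - A2 * B = \<Delta> * c2" "A * B3 - A3 * B = \<Delta> * c3"
    using saito by (auto elim!: dvdE)
  have "\<Delta> * (c1 * C1 + c2 * C2 + c3 * C3) = 0" using c relA relB by algebra
  then have "c1 * C1 + c2 * C2 + c3 * C3 = 0" using nz by simp
  then obtain w1 w2 w3 where w: "c1 = C2 * w3 - C3 * w2" "c2 = C3 * w1 - C1 * w3" "c3 = C1 * w2 - C2 * w1"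
    using koszul by blast
  \<comment> \<open>The difference has zero determinant with two independent pairs.\<close>
  define A' where "A' = A - (w1 * A1 + w2 * A2 + w3 * A3)"
  define B' where "B' = B - (w1 * B1 + w2 * B2 + w3 * B3)"
  have "A' * B1 = A1 * B'" "A' * B2 = A2 * B'"
    using c w det dets unfolding A'_def B'_def by algebra+
  then have "A' = 0 \<and> B' = 0" by (rule proportional_to_two_imp_zero) (simp add: det nz)
  then show ?thesis by (auto simp: A'_def B'_def)
qed

lemma syzygies:
  assumes reg: "\<And>b. C3 dvd b * C2 \<Longrightarrow> C3 dvd b"
    and "w1 * A1 + w2 * A2 + w3 * A3 = 0" "w1 * B1 + w2 * B2 + w3 * B3 = 0"
  shows "\<exists>k. w1 = k * C1 \<and> w2 = k * C2 \<and> w3 = k * C3"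
proof -
  have "\<Delta> * (w3 * C2 - w2 * C3) = 0" "\<Delta> * (w1 * C3 - w3 * C1) = 0"
    using assms(2,3) det dets by algebra+
  then have 1: "w3 * C2 = C3 * w2" "w1 * C3 = w3 * C1" using nz by (auto simp: mult.commute)
  then obtain k where k: "w3 = C3 * k" using reg by (metis dvdE dvd_triv_left)
  have "C3 * (w2 - k * C2) = 0" "C3 * (w1 - k * C1) = 0" using 1 k by algebra+
  then show ?thesis using nz k by (auto simp: mult.commute)
qed

end

subsection \<open>Four generators\<close>

text \<open>Four pairs in a module of rank two with two relations. The factor \<open>lf u\<close>
  in \<open>det12\<close> is the coefficient of the fourth pair in the second relation; it is the
  reason why the first three pairs do not generate.\<close>

locale four_pairs =
  fixes A1 B1 A2 B2 A3 B3 A4 B4 C q2 q3 \<Delta> :: S and x u s :: "complex ^ 3"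
  assumes rel1A: "(lf x)\<^sup>2 * A1 = lf u * A2 + lf s * A3" and rel1B: "(lf x)\<^sup>2 * B1 = lf u * B2 + lf s * B3"
    and rel2A: "lf u * A4 = C * A1 + q2 * A2 + q3 * A3" and rel2B: "lf u * B4 = C * B1 + q2 * B2 + q3 * B3"
    and det12: "A1 * B2 - A2 * B1 = - (lf s * lf u * \<Delta>)" and \<Delta>: "\<Delta> \<noteq> 0"
    and independent: "det3 x u s \<noteq> 0"
begin

abbreviation Lx where "Lx \<equiv> lf x"
abbreviation Lu where "Lu \<equiv> lf u"
abbreviation Ls where "Ls \<equiv> lf s"

lemma nz: "Lx \<noteq> 0" "Lu \<noteq> 0" "Ls \<noteq> 0" "x \<noteq> 0" "u \<noteq> 0" "s \<noteq> 0"
  using independent by (auto simp: det3_def)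

lemma primes: "prime_elem Lu" "prime_elem Ls"
  using nz prime_elem_lf by auto

lemma not_dvd: "\<not> Lu dvd Ls" "\<not> Ls dvd Lu" "\<not> Lu dvd Lx" "\<not> Ls dvd Lx"
proof -
  have "det3 x u (c *s u) = 0" "det3 x (c *s s) s = 0" "det3 (c *s u) u s = 0" "det3 (c *s s) u s = 0" for c
    by (simp_all add: det3_def algebra_simps)
  then show "\<not> Lu dvd Ls" "\<not> Ls dvd Lu" "\<not> Lu dvd Lx" "\<not> Ls dvd Lx"
    using independent lf_dvd_lf_imp nz by metis+
qed

lemma dets:
  "A1 * B3 - A3 * B1 = Lu\<^sup>2 * \<Delta>" "A2 * B3 - A3 * B2 = Lx\<^sup>2 * Lu * \<Delta>"
  "A1 * B4 - A4 * B1 = (q3 * Lu - q2 * Ls) * \<Delta>"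
  "A2 * B4 - A4 * B2 = (C * Ls + q3 * Lx\<^sup>2) * \<Delta>"
  "A3 * B4 - A4 * B3 = - ((C * Lu + q2 * Lx\<^sup>2) * \<Delta>)"
proof -
  have "Ls * (A1 * B3 - A3 * B1 - Lu\<^sup>2 * \<Delta>) = 0" "Ls * (A2 * B3 - A3 * B2 - Lx\<^sup>2 * Lu * \<Delta>) = 0"
    using rel1A rel1B det12 by algebra+
  then show d: "A1 * B3 - A3 * B1 = Lu\<^sup>2 * \<Delta>" "A2 * B3 - A3 * B2 = Lx\<^sup>2 * Lu * \<Delta>"
    using nz by auto
  have "Lu * (A1 * B4 - A4 * B1 - (q3 * Lu - q2 * Ls) * \<Delta>) = 0"
    "Lu * (A2 * B4 - A4 * B2 - (C * Ls + q3 * Lx\<^sup>2) * \<Delta>) = 0"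
    "Lu * (A3 * B4 - A4 * B3 + (C * Lu + q2 * Lx\<^sup>2) * \<Delta>) = 0"
    using rel2A rel2B det12 d by algebra+
  then show "A1 * B4 - A4 * B1 = (q3 * Lu - q2 * Ls) * \<Delta>" "A2 * B4 - A4 * B2 = (C * Ls + q3 * Lx\<^sup>2) * \<Delta>"
    "A3 * B4 - A4 * B3 = - ((C * Lu + q2 * Lx\<^sup>2) * \<Delta>)"
    using nz by (auto simp: eq_neg_iff_add_eq_0)
qed

lemma generate:
  assumes reg: "\<And>b. q2 dvd b * (C * Ls + q3 * Lx\<^sup>2) \<Longrightarrow> q2 dvd b" and q2: "q2 \<noteq> 0"
    and a: "dot u a = 1" "dot x a = 0" "dot s a = 0" and a': "dot s a' = 1" "dot x a' = 0" "dot u a' = 0"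
    and fixed: "restrict_to u a C = C" "restrict_to u a q2 = q2" "restrict_to u a q3 = q3"
    and saito: "\<Delta> dvd A * B1 - A1 * B" "\<Delta> dvd A * B2 - A2 * B" "\<Delta> dvd A * B3 - A3 * B"
      "\<Delta> dvd A * B4 - A4 * B"
  shows "\<exists>w1 w2 w3 w4. A = w1 * A1 + w2 * A2 + w3 * A3 + w4 * A4
    \<and> B = w1 * B1 + w2 * B2 + w3 * B3 + w4 * B4"
proof -
  obtain c1 c2 c3 c4 where c: "A * B1 - A1 * B = \<Delta> * c1" "A * B2 - A2 * B = \<Delta> * c2"
    "A * B3 - A3 * B = \<Delta> * c3" "A * B4 - A4 * B = \<Delta> * c4"
    using saito by (auto elim!: dvdE)
  let ?m1 = "q3 * Lu - q2 * Ls" and ?m2 = "C * Ls + q3 * Lx\<^sup>2" and ?m3 = "- (C * Lu + q2 * Lx\<^sup>2)"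
  have "\<Delta> * (Lx\<^sup>2 * c1 - Lu * c2 - Ls * c3) = 0" using c rel1A rel1B by algebra
  then have e1: "Lx\<^sup>2 * c1 - Lu * c2 - Ls * c3 = 0" using \<Delta> by simp
  \<comment> \<open>This is the Pluecker relation between the given pair and the generators 1,
    2, 4.\<close>
  have "\<Delta>\<^sup>2 * (c1 * ?m2 - c2 * ?m1 - c4 * Ls * Lu) = 0" using c det12 dets by algebra
  then have e2: "c1 * ?m2 - c2 * ?m1 - c4 * Ls * Lu = 0" using \<Delta> by simp
  \<comment> \<open>Modulo \<open>lf u\<close> the vector of the quotients is a multiple of that
    of the fourth generator.\<close>
  let ?\<sigma> = "restrict_to u a"
  have \<sigma>: "?\<sigma> Lu = 0" "?\<sigma> Lx = Lx" "?\<sigma> Ls = Ls"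
    by (simp_all add: restrict_to_lf a lf_simps)
  have "Lx\<^sup>2 * ?\<sigma> c1 = Ls * ?\<sigma> c3"
    using arg_cong[OF e1, of ?\<sigma>] by (simp add: restrict_to_simps \<sigma>)
  then have "Ls dvd Lx\<^sup>2 * ?\<sigma> c1" by simp
  then have "Ls dvd ?\<sigma> c1"
    using primes(2) not_dvd(4) by (simp add: prime_elem_dvd_mult_iff power2_eq_square)
  then obtain c' where c': "?\<sigma> c1 = Ls * c'" by (elim dvdE)
  have "Ls * (c' * ?m2 + ?\<sigma> c2 * q2) = 0"
    using arg_cong[OF e2, of ?\<sigma>] c' by (simp add: restrict_to_simps \<sigma> fixed algebra_simps)
  then have e3: "c' * ?m2 + ?\<sigma> c2 * q2 = 0" using nz by simp
  then obtain k where k: "c' = q2 * k" "?\<sigma> c2 = - (?m2 * k)"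
    using coprime_syzygy[OF reg q2] by blast
  obtain d1 where d1: "c1 - ?\<sigma> c1 = Lu * d1" using restrict_to_dvd[of u c1 a] by (elim dvdE)
  obtain d2 where d2: "c2 - ?\<sigma> c2 = Lu * d2" using restrict_to_dvd[of u c2 a] by (elim dvdE)
  define f1 where "f1 = d1 + k * q3"
  have f1: "c1 + k * ?m1 = Lu * f1" using d1 c' k unfolding f1_def by algebra
  have f2: "c2 + k * ?m2 = Lu * d2" using d2 k by algebra
  have "Ls * (c3 + k * ?m3) = Lu * (Lx\<^sup>2 * f1 - Lu * d2)" using e1 f1 f2 by algebra
  then have "Lu dvd Ls * (c3 + k * ?m3)" by simp
  then have "Lu dvd c3 + k * ?m3" using primes(1) not_dvd(1) by (simp add: prime_elem_dvd_mult_iff)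
  then obtain f3 where f3: "c3 + k * ?m3 = Lu * f3" by (elim dvdE)
  have "Lu * (Lx\<^sup>2 * f1 - Lu * d2 - Ls * f3) = 0" using e1 f1 f2 f3 by algebra
  then have e4: "Lx\<^sup>2 * f1 - Lu * d2 - Ls * f3 = 0" using nz by simp
  \<comment> \<open>What remains is divisible by \<open>lf u\<close> and comes from the first
    three generators.\<close>
  let ?\<tau> = "restrict_to s a'"
  have \<tau>: "?\<tau> Ls = 0" "?\<tau> Lx = Lx" "?\<tau> Lu = Lu"
    by (simp_all add: restrict_to_lf a' lf_simps)
  have e5: "Lx\<^sup>2 * ?\<tau> f1 = Lu * ?\<tau> d2"
    using arg_cong[OF e4, of ?\<tau>] by (simp add: restrict_to_simps \<tau>)
  then have "Lu dvd Lx\<^sup>2 * ?\<tau> f1" by simp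
  then have "Lu dvd ?\<tau> f1"
    using primes(1) not_dvd(3) by (simp add: prime_elem_dvd_mult_iff power2_eq_square)
  then obtain r where r: "?\<tau> f1 = Lu * r" by (elim dvdE)
  have "Lu * (Lx\<^sup>2 * r - ?\<tau> d2) = 0" using e5 r by algebra
  then have r2: "?\<tau> d2 = Lx\<^sup>2 * r" using nz by simp
  obtain g1 where g1: "f1 - ?\<tau> f1 = Ls * g1" using restrict_to_dvd[of s f1 a'] by (elim dvdE)
  obtain g2 where g2: "d2 - ?\<tau> d2 = Ls * g2" using restrict_to_dvd[of s d2 a'] by (elim dvdE)
  define A' where "A' = A - (- g2 * A1 + g1 * A2 - r * A3 + k * A4)"
  define B' where "B' = B - (- g2 * B1 + g1 * B2 - r * B3 + k * B4)"
  have "A' * B1 = A1 * B'"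
    using c(1) f1 g1 r det12 dets(1,3) unfolding A'_def B'_def by algebra
  moreover have "A' * B2 = A2 * B'"
    using c(2) f2 g2 r2 det12 dets(2,4) unfolding A'_def B'_def by algebra
  ultimately have "A' = 0 \<and> B' = 0"
    by (rule proportional_to_two_imp_zero) (simp add: det12 nz \<Delta>)
  then have "A = - g2 * A1 + g1 * A2 + (- r) * A3 + k * A4 \<and> B = - g2 * B1 + g1 * B2 + (- r) * B3 + k * B4"
    unfolding A'_def B'_def by (simp add: algebra_simps)
  then show ?thesis by blast
qed

lemma syzygies:
  assumes "\<not> Lu dvd q2"
    and "w1 * A1 + w2 * A2 + w3 * A3 + w4 * A4 = 0" "w1 * B1 + w2 * B2 + w3 * B3 + w4 * B4 = 0"
  shows "\<exists>k l. w1 = k * C + l * Lx\<^sup>2 \<and> w2 = k * q2 - l * Lu \<and> w3 = k * q3 - l * Ls \<and> w4 = - (k * Lu)"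
proof -
  have "\<Delta> * (w2 * Ls * Lu - w3 * Lu\<^sup>2 - w4 * (q3 * Lu - q2 * Ls)) = 0"
    using assms(2,3) det12 dets(1,3) by algebra
  then have 1: "w2 * Ls * Lu - w3 * Lu\<^sup>2 - w4 * (q3 * Lu - q2 * Ls) = 0" using \<Delta> by simp
  then have "w4 * q2 * Ls = Lu * (w3 * Lu + w4 * q3 - w2 * Ls)" by algebra
  then have "Lu dvd w4 * q2 * Ls" by simp
  then have "Lu dvd w4" using primes(1) not_dvd(1) assms(1) by (simp add: prime_elem_dvd_mult_iff)
  then obtain k' where k': "w4 = Lu * k'" by (elim dvdE)
  define k where "k = - k'"
  have k: "w4 = - (k * Lu)" by (simp add: k_def k' mult.commute)
  have "Lu * ((w2 - k * q2) * Ls - (w3 - k * q3) * Lu) = 0" using 1 k by algebra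
  then have 2: "(w2 - k * q2) * Ls = Lu * (w3 - k * q3)" using nz by (simp add: mult.commute)
  then have "Lu dvd (w2 - k * q2) * Ls" by simp
  then have "Lu dvd w2 - k * q2" using primes(1) not_dvd(1) by (simp add: prime_elem_dvd_mult_iff)
  then obtain l' where l': "w2 - k * q2 = Lu * l'" by (elim dvdE)
  define l where "l = - l'"
  have l: "w2 = k * q2 - l * Lu" using l' unfolding l_def by algebra
  have "Lu * (w3 - k * q3 + l * Ls) = 0" using 2 l by algebra
  then have "w3 - k * q3 + l * Ls = 0" using nz by simp
  then have w3: "w3 = k * q3 - l * Ls" by algebra
  have "\<Delta> * Lu * Ls * (w1 - (k * C + l * Lx\<^sup>2)) = 0"
    using assms(2,3) k l w3 det12 dets by algebra
  then have "w1 = k * C + l * Lx\<^sup>2" using nz \<Delta> by simp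
  then show ?thesis using k l w3 by blast
qed

end

section \<open>Resolutions from tangent pairs\<close>

lemma Const_mult_dvd_iff: assumes "k \<noteq> 0" shows "Const k * p dvd d \<longleftrightarrow> p dvd d"
proof
  assume "p dvd d"
  then obtain c where "d = p * c" by (elim dvdE)
  moreover have "Const k * Const (1 / k) = 1" using assms by (simp flip: Const_mult)
  ultimately have "d = Const k * p * (Const (1 / k) * c)" by algebra
  then show "Const k * p dvd d" by simp
qed (metis dvd_mult_right)

context simple_centred_arrangement
begin

text \<open>The generators are listed as in the resolution, with the one of degree 5 in the last
  place.\<close>

lemma resolution_of_three_pairs:
  assumes k: "k \<noteq> 0"
    and three: "three_pairs A1 B1 A2 B2 A3 B3 C1 C2 C3 (Const k * (\<Prod>i\<in>{1..<10}. lf (lines i)))"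
    and tan: "tangent A1 B1" "tangent A2 B2" "tangent A3 B3"
    and hom: "homog 5 A1" "homog 5 B1" "homog 6 A2" "homog 6 B2" "homog 6 A3" "homog 6 B3"
    and homC: "homog 3 C1" "homog 2 C2" "homog 2 C3"
    and koszul: "\<And>c1 c2 c3. c1 * C1 + c2 * C2 + c3 * C3 = 0 \<Longrightarrow>
      \<exists>w1 w2 w3. c1 = C2 * w3 - C3 * w2 \<and> c2 = C3 * w1 - C1 * w3 \<and> c3 = C1 * w2 - C2 * w1"
    and reg: "\<And>b. C3 dvd b * C2 \<Longrightarrow> C3 dvd b"
  shows "has_minimal_graded_resolution [0, 0, 0] (AR equation) (finite_resolution [[6, 6, 5], [8]])"
proof -
  interpret three_pairs A1 B1 A2 B2 A3 B3 C1 C2 C3 "Const k * (\<Prod>i\<in>{1..<10}. lf (lines i))"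
    by (rule three)
  define A where "A i = [A2, A3, A1] ! i" for i
  define B where "B i = [B2, B3, B1] ! i" for i
  define \<rho> where "\<rho> j = (\<lambda>i. if i < 3 then [C2, C3, C1] ! i else 0)" for j :: nat
  have lt: "i < length [6, 6, 5 :: nat] \<longleftrightarrow> i = 0 \<or> i = 1 \<or> i = 2" for i by auto
  have sumA: "(\<Sum>i<length [6, 6, 5 :: nat]. w i * A i) = w 2 * A1 + w 0 * A2 + w 1 * A3"
    and sumB: "(\<Sum>i<length [6, 6, 5 :: nat]. w i * B i) = w 2 * B1 + w 0 * B2 + w 1 * B3" for w
    by (simp_all add: A_def B_def numeral_2_eq_2 algebra_simps)
  have comb: "combination [8] \<rho> c = (\<lambda>i. c 0 * \<rho> 0 i)" for c
    by (simp add: combination_def)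
  show ?thesis
  proof (rule resolution_of_tangent_fields[where A = A and B = B and \<rho> = \<rho>])
    show "2 \<le> [6, 6, 5 :: nat] ! i" "homog ([6, 6, 5] ! i) (A i)" "homog ([6, 6, 5] ! i) (B i)" "tangent (A i) (B i)"
      if "i < length [6, 6, 5 :: nat]" for i
      using that hom tan unfolding lt by (auto simp: A_def B_def)
    show "\<rho> j \<in> graded_part [6, 6, 5] ([8] ! j)" "\<rho> j i \<in> irrelevant_ideal" if "j < length [8 :: nat]" for j i
      using that homC
      by (auto simp: \<rho>_def graded_part_iff free_module_def nth_Cons irrelevant_ideal_closed
          intro: homog_irrelevant split: nat.splits)
    show "\<exists>w. A' = (\<Sum>i<length [6, 6, 5 :: nat]. w i * A i) \<and> B' = (\<Sum>i<length [6, 6, 5 :: nat]. w i * B i)"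
      if t: "tangent A' B'" for A' B'
    proof -
      have "\<exists>w1 w2 w3. A' = w1 * A1 + w2 * A2 + w3 * A3 \<and> B' = w1 * B1 + w2 * B2 + w3 * B3"
        by (rule generate[OF koszul]) (use saito_dvd[OF t] tan k in \<open>auto simp: Const_mult_dvd_iff\<close>)
      then obtain w1 w2 w3 where "A' = w1 * A1 + w2 * A2 + w3 * A3" "B' = w1 * B1 + w2 * B2 + w3 * B3" by blast
      then show ?thesis unfolding sumA sumB
        by (intro exI[of _ "\<lambda>i. if i = 0 then w2 else if i = 1 then w3 else w1"]) simp
    qed
    show "(\<Sum>i<length [6, 6, 5 :: nat]. w i * A i) = 0 \<and> (\<Sum>i<length [6, 6, 5 :: nat]. w i * B i) = 0 \<longleftrightarrow>
      (\<exists>c\<in>free_module [8]. w = combination [8] \<rho> c)" if w: "w \<in> free_module [6, 6, 5]" for w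
    proof
      assume "(\<Sum>i<length [6, 6, 5 :: nat]. w i * A i) = 0 \<and> (\<Sum>i<length [6, 6, 5 :: nat]. w i * B i) = 0"
      then obtain l where l: "w 2 = l * C1" "w 0 = l * C2" "w 1 = l * C3"
        using syzygies[OF reg] unfolding sumA sumB by blast
      have "w i = l * \<rho> 0 i" for i
      proof (cases "i < 3")
        case True
        then have "i = 0 \<or> i = 1 \<or> i = 2" by linarith
        then show ?thesis using l by (auto simp: \<rho>_def)
      qed (use w in \<open>auto simp: \<rho>_def free_module_def\<close>)
      then show "\<exists>c\<in>free_module [8]. w = combination [8] \<rho> c"
        unfolding comb
        by (intro bexI[of _ "\<lambda>i. if i = 0 then l else 0"]) (auto simp: free_module_def)
    next
      assume "\<exists>c\<in>free_module [8]. w = combination [8] \<rho> c"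
      then obtain l where "w = (\<lambda>i. l * \<rho> 0 i)" unfolding comb by blast
      then have "w 2 = l * C1" "w 0 = l * C2" "w 1 = l * C3" by (simp_all add: \<rho>_def)
      then show "(\<Sum>i<length [6, 6, 5 :: nat]. w i * A i) = 0 \<and> (\<Sum>i<length [6, 6, 5 :: nat]. w i * B i) = 0"
        unfolding sumA sumB using relA relB by algebra
    qed
    show "c = (\<lambda>_. 0)" if c: "c \<in> free_module [8]" and z: "combination [8] \<rho> c = (\<lambda>_. 0)" for c
    proof
      fix i
      have "c 0 * \<rho> 0 1 = 0" using z unfolding comb by metis
      then have "c 0 = 0" using nz by (simp add: \<rho>_def)
      then show "c i = 0" using c by (cases i) (auto simp: free_module_def)
    qed
  qed
qed

text \<open>The relation of degree 7 does not involve the generator of degree 7, so the two equal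
  shifts do not cancel.\<close>

lemma resolution_of_four_pairs:
  assumes k: "k \<noteq> 0"
    and four: "four_pairs A1 B1 A2 B2 A3 B3 A4 B4 C q2 q3 (Const k * (\<Prod>i\<in>{1..<10}. lf (lines i))) x y1 y2"
    and tan: "tangent A1 B1" "tangent A2 B2" "tangent A3 B3" "tangent A4 B4"
    and hom: "homog 5 A1" "homog 5 B1" "homog 6 A2" "homog 6 B2" "homog 6 A3" "homog 6 B3"
      "homog 7 A4" "homog 7 B4"
    and homC: "homog 3 C" "homog 2 q2" "homog 2 q3"
    and reg: "\<And>b. q2 dvd b * (C * Y2 + q3 * X\<^sup>2) \<Longrightarrow> q2 dvd b" and q2: "q2 \<noteq> 0"
    and a: "dot y1 a = 1" "dot x a = 0" "dot y2 a = 0" and a': "dot y2 a' = 1" "dot x a' = 0" "dot y1 a' = 0"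
    and fixed: "restrict_to y1 a C = C" "restrict_to y1 a q2 = q2" "restrict_to y1 a q3 = q3"
  shows "has_minimal_graded_resolution [0, 0, 0] (AR equation)
    (finite_resolution [[7, 6, 6, 5], [8, 7]])"
proof -
  interpret four_pairs A1 B1 A2 B2 A3 B3 A4 B4 C q2 q3 "Const k * (\<Prod>i\<in>{1..<10}. lf (lines i))" x y1 y2
    by (rule four)
  define A where "A i = [A4, A2, A3, A1] ! i" for i
  define B where "B i = [B4, B2, B3, B1] ! i" for i
  define \<rho> where "\<rho> j = (\<lambda>i. if i < 4 then (if j = 0 then [- Y1, q2, q3, C] ! i else [0, - Y1, - Y2, X\<^sup>2] ! i) else 0)"
    for j :: nat
  have lt: "i < length [7, 6, 6, 5 :: nat] \<longleftrightarrow> i = 0 \<or> i = 1 \<or> i = 2 \<or> i = 3" for i by auto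
  have sumA: "(\<Sum>i<length [7, 6, 6, 5 :: nat]. w i * A i) = w 3 * A1 + w 1 * A2 + w 2 * A3 + w 0 * A4"
    and sumB: "(\<Sum>i<length [7, 6, 6, 5 :: nat]. w i * B i) = w 3 * B1 + w 1 * B2 + w 2 * B3 + w 0 * B4" for w
    by (simp_all add: A_def B_def numeral_2_eq_2 numeral_3_eq_3 algebra_simps)
  have comb: "combination [8, 7] \<rho> c = (\<lambda>i. c 0 * \<rho> 0 i + c 1 * \<rho> 1 i)" for c
    by (simp add: combination_def)
  have q2U: "\<not> Y1 dvd q2" using q2 fixed(2) by (simp add: lf_dvd_iff[OF a(1)])
  have homX: "homog 2 (X\<^sup>2)" "homog 1 (- Y1)" "homog 1 (- Y2)"
    using homog_power[OF homog_lf[of x], of 2] homog_uminus[OF homog_lf] by simp_all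
  show ?thesis
  proof (rule resolution_of_tangent_fields[where A = A and B = B and \<rho> = \<rho>])
    show "2 \<le> [7, 6, 6, 5 :: nat] ! i" "homog ([7, 6, 6, 5] ! i) (A i)" "homog ([7, 6, 6, 5] ! i) (B i)"
      "tangent (A i) (B i)" if "i < length [7, 6, 6, 5 :: nat]" for i
      using that hom tan unfolding lt by (auto simp: A_def B_def numeral_3_eq_3)
    have homs: "homog 1 (\<rho> 0 0)" "homog 2 (\<rho> 0 1)" "homog 2 (\<rho> 0 2)" "homog 3 (\<rho> 0 3)"
      "\<rho> 1 0 = 0" "homog 1 (\<rho> 1 1)" "homog 1 (\<rho> 1 2)" "homog 2 (\<rho> 1 3)" "\<And>j i. i \<ge> 4 \<Longrightarrow> \<rho> j i = 0"
      using homC homX by (simp_all add: \<rho>_def numeral_3_eq_3)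
    show "\<rho> j \<in> graded_part [7, 6, 6, 5] ([8, 7] ! j)" if "j < length [8, 7 :: nat]" for j
    proof -
      have "j = 0 \<or> j = 1" using that by auto
      then show ?thesis
        using homs homog_0[of 0] by (auto simp: graded_part_iff free_module_def less_Suc_eq numeral_2_eq_2 numeral_3_eq_3)
    qed
    show "\<rho> j i \<in> irrelevant_ideal" if "j < length [8, 7 :: nat]" for j i
    proof -
      have j: "j = 0 \<or> j = 1" using that by auto
      consider "i = 0" | "i = 1" | "i = 2" | "i = 3" | "i \<ge> 4" by linarith
      then show ?thesis
        using j homs homog_irrelevant irrelevant_ideal_closed(1)
        by cases (metis zero_less_numeral zero_less_one)+
    qed
    show "\<exists>w. A' = (\<Sum>i<length [7, 6, 6, 5 :: nat]. w i * A i) \<and> B' = (\<Sum>i<length [7, 6, 6, 5 :: nat]. w i * B i)"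
      if t: "tangent A' B'" for A' B'
    proof -
      have "\<exists>w1 w2 w3 w4. A' = w1 * A1 + w2 * A2 + w3 * A3 + w4 * A4
          \<and> B' = w1 * B1 + w2 * B2 + w3 * B3 + w4 * B4"
        by (rule generate[OF reg q2 a a' fixed])
           (use saito_dvd[OF t] tan k in \<open>auto simp: Const_mult_dvd_iff\<close>)
      then obtain w1 w2 w3 w4 where "A' = w1 * A1 + w2 * A2 + w3 * A3 + w4 * A4"
        "B' = w1 * B1 + w2 * B2 + w3 * B3 + w4 * B4" by blast
      then show ?thesis unfolding sumA sumB
        by (intro exI[of _ "\<lambda>i. if i = 0 then w4 else if i = 1 then w2 else if i = 2 then w3 else w1"]) simp
    qed
    show "(\<Sum>i<length [7, 6, 6, 5 :: nat]. w i * A i) = 0 \<and> (\<Sum>i<length [7, 6, 6, 5 :: nat]. w i * B i) = 0 \<longleftrightarrow>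
      (\<exists>c\<in>free_module [8, 7]. w = combination [8, 7] \<rho> c)" if w: "w \<in> free_module [7, 6, 6, 5]" for w
    proof
      assume "(\<Sum>i<length [7, 6, 6, 5 :: nat]. w i * A i) = 0 \<and> (\<Sum>i<length [7, 6, 6, 5 :: nat]. w i * B i) = 0"
      then obtain l l' where l: "w 3 = l * C + l' * X\<^sup>2" "w 1 = l * q2 - l' * Y1"
        "w 2 = l * q3 - l' * Y2" "w 0 = - (l * Y1)"
        using syzygies[OF q2U] unfolding sumA sumB by blast
      have "w i = l * \<rho> 0 i + l' * \<rho> 1 i" for i
      proof (cases "i < 4")
        case True
        then have "i = 0 \<or> i = 1 \<or> i = 2 \<or> i = 3" by linarith
        then show ?thesis using l by (auto simp: \<rho>_def numeral_3_eq_3)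
      qed (use w in \<open>auto simp: \<rho>_def free_module_def\<close>)
      then show "\<exists>c\<in>free_module [8, 7]. w = combination [8, 7] \<rho> c"
        unfolding comb
        by (intro bexI[of _ "\<lambda>i. if i = 0 then l else if i = 1 then l' else 0"]) (auto simp: free_module_def)
    next
      assume "\<exists>c\<in>free_module [8, 7]. w = combination [8, 7] \<rho> c"
      then obtain l l' where "w = (\<lambda>i. l * \<rho> 0 i + l' * \<rho> 1 i)" unfolding comb by blast
      then have "w 3 = l * C + l' * X\<^sup>2" "w 1 = l * q2 - l' * Y1" "w 2 = l * q3 - l' * Y2" "w 0 = - (l * Y1)"
        by (simp_all add: \<rho>_def numeral_3_eq_3)
      then show "(\<Sum>i<length [7, 6, 6, 5 :: nat]. w i * A i) = 0 \<and> (\<Sum>i<length [7, 6, 6, 5 :: nat]. w i * B i) = 0"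
        unfolding sumA sumB using rel1A rel1B rel2A rel2B by algebra
    qed
    show "c = (\<lambda>_. 0)" if c: "c \<in> free_module [8, 7]" and z: "combination [8, 7] \<rho> c = (\<lambda>_. 0)" for c
    proof
      fix i :: nat
      have z': "c 0 * \<rho> 0 i + c 1 * \<rho> 1 i = 0" for i using z unfolding comb by metis
      have "c 0 = 0" using z'[of 0] nz by (simp add: \<rho>_def)
      moreover from this have "c 1 = 0" using z'[of 1] nz by (simp add: \<rho>_def)
      moreover have "i = 0 \<or> i = 1 \<or> i \<ge> 2" by linarith
      ultimately show "c i = 0" using c by (auto simp: free_module_def)
    qed
  qed
qed

end

text \<open>In the homogeneity proofs below the degree is computed by the rules; the equations
  between degrees are discharged only afterwards.\<close>

lemma homog_cong: "homog d p \<Longrightarrow> d = n \<Longrightarrow> homog n p" by simp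
lemma homog_add': "homog d p \<Longrightarrow> homog e q \<Longrightarrow> d = e \<Longrightarrow> homog d (p + q)" by (simp add: homog_add)
lemma homog_diff': "homog d p \<Longrightarrow> homog e q \<Longrightarrow> d = e \<Longrightarrow> homog d (p - q)" by (simp add: homog_diff)

lemmas homog_rules = homog_lf homog_numeral homog_1 homog_Const homog_uminus homog_add' homog_diff'
  homog_mult homog_power

section \<open>Determinants over the ring of the golden ratio\<close>

definition gold :: complex where "gold = complex_of_real ((1 + sqrt 5) / 2)"

lemma gold_square: "gold * gold = gold + 1"
proof -
  have "((1 + sqrt 5) / 2) * ((1 + sqrt 5) / 2) = (1 + sqrt 5) / 2 + 1"
    by (simp add: field_simps)
  then show ?thesis unfolding gold_def by (metis of_real_1 of_real_add of_real_mult)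
qed

lemma sqrt5_gold: "complex_of_real (sqrt 5) = 2 * gold - 1"
  by (simp add: gold_def field_simps)

text \<open>The pair \<open>(a, b)\<close> stands for \<open>a + b * gold\<close>.
  Integer pairs make the determinants computable, and a nonzero norm certifies that a determinant
  does not vanish.\<close>

type_synonym zg = "int \<times> int"

definition emb :: "zg \<Rightarrow> complex" where
  "emb a = of_int (fst a) + of_int (snd a) * gold"

definition zadd :: "zg \<Rightarrow> zg \<Rightarrow> zg" where "zadd a b = (fst a + fst b, snd a + snd b)"
definition zsub :: "zg \<Rightarrow> zg \<Rightarrow> zg" where "zsub a b = (fst a - fst b, snd a - snd b)"
definition zmul :: "zg \<Rightarrow> zg \<Rightarrow> zg" where
  "zmul a b = (fst a * fst b + snd a * snd b, fst a * snd b + snd a * fst b + snd a * snd b)"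
definition znorm :: "zg \<Rightarrow> int" where
  "znorm a = fst a * fst a + fst a * snd a - snd a * snd a"

lemma emb_simps: "emb (zadd a b) = emb a + emb b" "emb (zsub a b) = emb a - emb b"
  "emb (zmul a b) = emb a * emb b" "emb (0, 0) = 0"
  using gold_square by (simp_all add: emb_def zadd_def zsub_def zmul_def algebra_simps) algebra

lemma emb_nonzero: assumes "znorm a \<noteq> 0" shows "emb a \<noteq> 0"
proof
  assume "emb a = 0"
  then have "emb a * (of_int (fst a) + of_int (snd a) - of_int (snd a) * gold) = 0" by simp
  then have "complex_of_int (znorm a) = 0"
    using gold_square unfolding emb_def znorm_def of_int_add of_int_diff of_int_mult by algebra
  then show False using assms by simp
qed

type_synonym zvec = "zg \<times> zg \<times> zg"

definition vec_of :: "zvec \<Rightarrow> complex ^ 3" where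
  "vec_of u = (case u of (a, b, c) \<Rightarrow> vector [emb a, emb b, emb c])"

definition zdet :: "zvec \<Rightarrow> zvec \<Rightarrow> zvec \<Rightarrow> zg" where
  "zdet u v w = (case u of (a1, a2, a3) \<Rightarrow> case v of (b1, b2, b3) \<Rightarrow> case w of (c1, c2, c3) \<Rightarrow>
     zadd (zsub (zmul a1 (zsub (zmul b2 c3) (zmul b3 c2))) (zmul a2 (zsub (zmul b1 c3) (zmul b3 c1))))
       (zmul a3 (zsub (zmul b1 c2) (zmul b2 c1))))"

lemma det3_vec_of: "det3 (vec_of u) (vec_of v) (vec_of w) = emb (zdet u v w)"
  by (cases u; cases v; cases w) (simp add: det3_def vec_of_def zdet_def emb_simps)

text \<open>Two lines are distinct if they belong to a triple of independent lines.\<close>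

definition simple_table :: "zvec list \<Rightarrow> bool" where
  "simple_table us \<longleftrightarrow> list_all (\<lambda>i. list_all (\<lambda>j. i = j \<or>
     list_ex (\<lambda>k. znorm (zdet (us ! i) (us ! j) (us ! k)) \<noteq> 0) [0..<10]) [0..<10]) [0..<10]"

definition same_triples :: "zvec list \<Rightarrow> zvec list \<Rightarrow> bool" where
  "same_triples us vs \<longleftrightarrow> list_all (\<lambda>i. list_all (\<lambda>j. list_all (\<lambda>k.
     let d = zdet (us ! i) (us ! j) (us ! k); e = zdet (vs ! i) (vs ! j) (vs ! k) in
       if d = (0, 0) then e = (0, 0) else znorm d \<noteq> 0 \<and> znorm e \<noteq> 0) [Suc j..<10]) [Suc i..<10]) [0..<10]"

lemma simple_configuration_table:
  assumes "simple_table us" "\<And>i. i < 10 \<Longrightarrow> f i = vec_of (us ! i)"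
  shows "simple_configuration f 10"
proof -
  have cr: "cross (f i) (f j) \<noteq> 0" if ij: "i < 10" "j < 10" "i \<noteq> j" for i j
  proof -
    have "i \<in> set [0..<10]" "j \<in> set [0..<10]" using ij by auto
    then have "\<exists>k\<in>set [0..<10]. znorm (zdet (us ! i) (us ! j) (us ! k)) \<noteq> 0"
      using assms(1) ij(3) unfolding simple_table_def list_all_iff list_ex_iff by blast
    then have "\<exists>k<10. znorm (zdet (us ! i) (us ! j) (us ! k)) \<noteq> 0" by auto
    then obtain k where "k < 10" "det3 (f i) (f j) (f k) \<noteq> 0"
      using assms(2) ij det3_vec_of emb_nonzero by metis
    then show ?thesis by (metis dot_cross(1) dot_simps(7))
  qed
  show ?thesis
  proof
    fix i :: nat assume i: "i < 10"
    obtain j :: nat where "j < 10" "i \<noteq> j" by (metis zero_less_numeral one_less_numeral_iff semiring_norm(76) zero_neq_one)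
    then have "cross (f i) (f j) \<noteq> 0" using cr i by blast
    then show "f i \<noteq> 0" by (auto simp: cross_def vec_eq_iff forall_3)
  qed (rule cr)
qed

lemma same_triples_det:
  assumes "same_triples us vs" "\<And>i. i < 10 \<Longrightarrow> f i = vec_of (us ! i)" "\<And>i. i < 10 \<Longrightarrow> g i = vec_of (vs ! i)"
    and "i < j" "j < k" "k < 10"
  shows "det3 (f i) (f j) (f k) = 0 \<longleftrightarrow> det3 (g i) (g j) (g k) = 0"
proof -
  have "let d = zdet (us ! i) (us ! j) (us ! k); e = zdet (vs ! i) (vs ! j) (vs ! k) in
       if d = (0, 0) then e = (0, 0) else znorm d \<noteq> 0 \<and> znorm e \<noteq> 0"
    using assms(1,4-6) unfolding same_triples_def list_all_iff by auto
  moreover have "f i = vec_of (us ! i)" "f j = vec_of (us ! j)" "f k = vec_of (us ! k)"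
    "g i = vec_of (vs ! i)" "g j = vec_of (vs ! j)" "g k = vec_of (vs ! k)"
    using assms(2-6) by auto
  ultimately show ?thesis
    by (auto simp: Let_def det3_vec_of emb_simps dest: emb_nonzero split: if_splits)
qed

text \<open>Row \<open>i\<close> of a table contains the coefficients of the line with index
  \<open>i\<close>.\<close>

definition table1 :: "zvec list" where
  "table1 =
   [((1, 0), (0, 0), (0, 0)), ((0, 0), (2, 0), (2, 0)), ((2, 0), (2, 0), (2, 0)),
    ((0, 0), (0, 0), (4, 0)), ((2, 0), (0, 0), (4, 0)), ((0, 0), (4, 0), (0, 0)),
    ((2, 0), (4, 0), (0, 0)), ((2, 0), (10, 0), (6, 0)), ((6, 0), (10, 0), (6, 0)),
    ((2, 0), (2, 0), (6, 0))]"

definition table2 :: "zvec list" where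
  "table2 =
   [((1, 0), (0, 0), (0, 0)), ((0, 0), (2, 0), (2, 0)), ((2, 0), (2, 0), (2, 0)),
    ((0, 0), (0, 0), (2, 4)), ((2, 0), (0, 0), (2, 4)), ((0, 0), (1, 1), (0, 0)),
    ((2, 0), (1, 1), (0, 0)), ((- 6, 4), (- 5, 5), (- 4, 4)), ((- 4, 4), (- 5, 5), (- 4, 4)),
    ((1, 0), (1, 0), (2, 2))]"

lemma tables: "simple_table table1" "simple_table table2" "same_triples table1 table2"
  by code_simp+

section \<open>The two arrangements\<close>

lemma nat_less_10_cases: "(i::nat) < 10 \<longleftrightarrow> i = 0 \<or> i = 1 \<or> i = 2 \<or> i = 3 \<or> i = 4 \<or> i = 5 \<or> i = 6 \<or> i = 7 \<or> i = 8 \<or> i = 9"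
  by presburger

lemma nat_less_5_cases: "(i::nat) < 5 \<longleftrightarrow> i = 0 \<or> i = 1 \<or> i = 2 \<or> i = 3 \<or> i = 4"
  by presburger

lemma nat_less_4_cases: "(i::nat) < 4 \<longleftrightarrow> i = 0 \<or> i = 1 \<or> i = 2 \<or> i = 3"
  by presburger

text \<open>The constants with suffix 1 belong to the parameters \<open>(5, 3)\<close> and those
  with suffix 2 to the other parameters; both arrangements contain the line \<open>x1\<close>. The
  linear forms \<open>t1\<close> and \<open>w1\<close> are centres of two of the four pairs of
  lines. In the second arrangement \<open>u2\<close> is the common factor of the determinants of
  the first three generators, and \<open>v2\<close> is the unpaired line.\<close>

definition "x1 = (vector [1, 0, 0] :: complex ^ 3)"
definition "t1 = (vector [1, 2, 2] :: complex ^ 3)"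
definition "w1 = (vector [1, 0, 4] :: complex ^ 3)"
definition "p1 k = [1, 0, 2, 5, 1 :: complex] ! k"
definition "q1 k = [0, 1, - 1, - 1, 1 :: complex] ! k"
definition "m1 k = [1, 1, 1, 2 :: complex] ! k"

definition "u2 = (vector [2 + 2 * gold, 3 + 4 * gold, 4 + 6 * gold] :: complex ^ 3)"
definition "v2 = (vector [1, 1, 2 + 2 * gold] :: complex ^ 3)"
definition "p2 k = [2 * gold - 3, 3 - 2 * gold, 2 - gold, 2 - gold, 0] ! k"
definition "q2 k = [3 - 2 * gold, 2 * gold - 1, - 1, 4 * gold - 7, 1] ! k"
definition "m2 k = [1, 1, 1, 1 :: complex] ! k"

interpretation c1: centred_arrangement x1 t1 w1 p1 q1 m1 .
interpretation c2: centred_arrangement x1 u2 v2 p2 q2 m2 .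

lemma lines1: "i < 10 \<Longrightarrow> c1.lines i = vec_of (table1 ! i)"
  unfolding nat_less_10_cases c1.lines_def c1.dir_def
  by (elim disjE) (simp_all add: p1_def q1_def m1_def x1_def t1_def w1_def
      table1_def vec_of_def emb_def vec_eq_iff forall_3)

lemma lines2: "i < 10 \<Longrightarrow> c2.lines i = vec_of (table2 ! i)"
proof -
  have g: "gold * gold = gold + 1" "gold * (gold * y) = (gold + 1) * y" for y
    by (simp_all add: gold_square flip: mult.assoc)
  show "i < 10 \<Longrightarrow> c2.lines i = vec_of (table2 ! i)"
    unfolding nat_less_10_cases c2.lines_def c2.dir_def
    by (elim disjE) (simp_all add: p2_def q2_def m2_def x1_def u2_def v2_def
      table2_def vec_of_def emb_def vec_eq_iff forall_3 algebra_simps g)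
qed

interpretation c1: simple_centred_arrangement x1 t1 w1 p1 q1 m1
proof (rule simple_centred_arrangement.intro)
  show "det3 x1 t1 w1 \<noteq> 0" by (simp add: det3_def x1_def t1_def w1_def)
  show "simple_configuration c1.lines 10" by (rule simple_configuration_table[OF tables(1) lines1])
  show "p1 k \<noteq> 0 \<or> q1 k \<noteq> 0" if "k < 5" for k
    using that unfolding nat_less_5_cases by (auto simp: p1_def q1_def)
qed

lemma det_x1_u2_v2: "det3 x1 u2 v2 = 10 + 16 * gold"
  unfolding det3_def x1_def u2_def v2_def vector_3 using gold_square by algebra

lemma gold_nonzero: "of_int a + of_int b * gold \<noteq> 0" if "a * a + a * b - b * b \<noteq> 0" for a b
  using emb_nonzero[of "(a, b)"] that by (simp add: emb_def znorm_def)

interpretation c2: simple_centred_arrangement x1 u2 v2 p2 q2 m2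
proof (rule simple_centred_arrangement.intro)
  show "det3 x1 u2 v2 \<noteq> 0" unfolding det_x1_u2_v2 using gold_nonzero[of 10 16] by simp
  show "simple_configuration c2.lines 10" by (rule simple_configuration_table[OF tables(2) lines2])
  show "p2 k \<noteq> 0 \<or> q2 k \<noteq> 0" if "k < 5" for k
    using that gold_nonzero[of "- 3" 2] gold_nonzero[of 2 "- 1"] unfolding nat_less_5_cases by (auto simp: p2_def q2_def)
qed

subsection \<open>Generators of the first arrangement\<close>

abbreviation X1 :: S where "X1 \<equiv> lf x1"
abbreviation T1 :: S where "T1 \<equiv> lf t1"
abbreviation W1 :: S where "W1 \<equiv> lf w1"
abbreviation K1_0 :: S where "K1_0 \<equiv> T1\<^sup>2 - X1\<^sup>2"
abbreviation K1_1 :: S where "K1_1 \<equiv> W1\<^sup>2 - X1\<^sup>2"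
abbreviation K1_2 :: S where "K1_2 \<equiv> (2 * T1 - W1)\<^sup>2 - X1\<^sup>2"
abbreviation K1_3 :: S where "K1_3 \<equiv> (5 * T1 - W1)\<^sup>2 - (2 * X1)\<^sup>2"

text \<open>The tangent pairs of lowest degree, found by linear algebra. The symmetry under
  \<open>X \<mapsto> - X\<close> makes it possible to choose them even in \<open>X1\<close>. The
  pair with number \<open>i\<close> is \<open>(K1_0 * a1_i, K1_1 * b1_i)\<close>, and the
  generators are normalised so that the relation has coefficients with few terms.\<close>

definition a1_1 :: S where
  "a1_1 =
    5 * X1 ^ 2 * T1 - 3 * X1 ^ 2 * W1 - 50 * T1 ^ 3 + 20 * T1 ^ 2 * W1 + T1 * W1 ^ 2 + 3 * W1 ^ 3"

definition b1_1 :: S where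
  "b1_1 =
    - (15 * X1 ^ 2 * T1) - 7 * X1 ^ 2 * W1 + 15 * T1 ^ 3 - 35 * T1 ^ 2 * W1 + 20 * T1 * W1 ^ 2
    - 2 * W1 ^ 3"

definition a1_2 :: S where
  "a1_2 =
    30 * X1 ^ 2 * T1 ^ 2 + 2 * X1 ^ 2 * W1 ^ 2 - 250 * T1 ^ 4 + 50 * T1 ^ 3 * W1
    + 20 * T1 ^ 2 * W1 ^ 2 + 6 * T1 * W1 ^ 3 - 2 * W1 ^ 4"

definition b1_2 :: S where
  "b1_2 =
    - (30 * X1 ^ 2 * T1 ^ 2) - 2 * X1 ^ 2 * W1 ^ 2 - 75 * T1 ^ 4 - 160 * T1 ^ 3 * W1
    + 160 * T1 ^ 2 * W1 ^ 2 - 40 * T1 * W1 ^ 3 + 3 * W1 ^ 4"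

definition a1_3 :: S where
  "a1_3 =
    2 * X1 ^ 4 + 2 * X1 ^ 2 * T1 * W1 - 2 * X1 ^ 2 * W1 ^ 2 - 150 * T1 ^ 4 + 10 * T1 ^ 3 * W1
    + 38 * T1 ^ 2 * W1 ^ 2 + 4 * T1 * W1 ^ 3"

definition b1_3 :: S where
  "b1_3 =
    - (2 * X1 ^ 4) - 35 * X1 ^ 2 * T1 ^ 2 - 36 * X1 ^ 2 * T1 * W1 + 3 * X1 ^ 2 * W1 ^ 2
    - 5 * T1 ^ 4 - 70 * T1 ^ 3 * W1 + 55 * T1 ^ 2 * W1 ^ 2 - 6 * T1 * W1 ^ 3"

lemma along1: "c1.along 0 A B = A" "c1.along (Suc 0) A B = B" "c1.along 2 A B = 2 * A - B"
  "c1.along 3 A B = 5 * A - B" "c1.along 4 A B = A + B"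
  by (simp_all add: c1.along_def p1_def q1_def)

lemma quadric1: "c1.quadric 0 = K1_0" "c1.quadric (Suc 0) = K1_1"
  "c1.quadric 2 = K1_2" "c1.quadric 3 = K1_3"
  by (simp_all add: c1.quadric_def along1 m1_def)

lemma tangent1I:
  assumes "2 * A - B = K1_2 * c" "5 * A - B = K1_3 * d"
    "A + B = (T1 + W1) * e" "A = K1_0 * a" "B = K1_1 * b"
  shows "c1.tangent A B"
  unfolding c1.tangent_def nat_less_4_cases using assms
  by (auto simp: along1 quadric1)

lemma tangent1_1: "c1.tangent (K1_0 * a1_1) (K1_1 * b1_1)"
proof (rule tangent1I[OF _ _ _ refl refl])
  show "2 * (K1_0 * a1_1) - K1_1 * b1_1 =
    K1_2 * (
      25 * X1 ^ 2 * T1 + X1 ^ 2 * W1 - 25 * T1 ^ 3 - 15 * T1 ^ 2 * W1 - 12 * T1 * W1 ^ 2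
      + 2 * W1 ^ 3)"
    unfolding a1_1_def b1_1_def by algebra
  show "5 * (K1_0 * a1_1) - K1_1 * b1_1 =
    K1_3 * (
      10 * X1 ^ 2 * T1 - 2 * X1 ^ 2 * W1 - 10 * T1 ^ 3 + 2 * W1 ^ 3)"
    unfolding a1_1_def b1_1_def by algebra
  show "K1_0 * a1_1 + K1_1 * b1_1 =
    (T1 + W1) * (
      10 * X1 ^ 4 + 40 * X1 ^ 2 * T1 ^ 2 - 28 * X1 ^ 2 * T1 * W1 - 8 * X1 ^ 2 * W1 ^ 2
      - 50 * T1 ^ 4 + 70 * T1 ^ 3 * W1 - 54 * T1 ^ 2 * W1 ^ 2 + 22 * T1 * W1 ^ 3 - 2 * W1 ^ 4)"
    unfolding a1_1_def b1_1_def by algebra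
qed

lemma tangent1_2: "c1.tangent (K1_0 * a1_2) (K1_1 * b1_2)"
proof (rule tangent1I[OF _ _ _ refl refl])
  show "2 * (K1_0 * a1_2) - K1_1 * b1_2 =
    K1_2 * (
      90 * X1 ^ 2 * T1 ^ 2 + 6 * X1 ^ 2 * W1 ^ 2 - 125 * T1 ^ 4 - 100 * T1 ^ 3 * W1
      - 40 * T1 ^ 2 * W1 ^ 2 + 28 * T1 * W1 ^ 3 - 3 * W1 ^ 4)"
    unfolding a1_2_def b1_2_def by algebra
  show "5 * (K1_0 * a1_2) - K1_1 * b1_2 =
    K1_3 * (
      45 * X1 ^ 2 * T1 ^ 2 + 3 * X1 ^ 2 * W1 ^ 2 - 50 * T1 ^ 4 - 10 * T1 ^ 3 * W1
      + 5 * T1 ^ 2 * W1 ^ 2 + 10 * T1 * W1 ^ 3 - 3 * W1 ^ 4)"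
    unfolding a1_2_def b1_2_def by algebra
  show "K1_0 * a1_2 + K1_1 * b1_2 =
    (T1 + W1) * (
      355 * X1 ^ 2 * T1 ^ 3 - 245 * X1 ^ 2 * T1 ^ 2 * W1 + 37 * X1 ^ 2 * T1 * W1 ^ 2
      - 3 * X1 ^ 2 * W1 ^ 3 - 250 * T1 ^ 5 + 300 * T1 ^ 4 * W1 - 355 * T1 ^ 3 * W1 ^ 2
      + 201 * T1 ^ 2 * W1 ^ 3 - 43 * T1 * W1 ^ 4 + 3 * W1 ^ 5)"
    unfolding a1_2_def b1_2_def by algebra
qed

lemma tangent1_3: "c1.tangent (K1_0 * a1_3) (K1_1 * b1_3)"
proof (rule tangent1I[OF _ _ _ refl refl])
  show "2 * (K1_0 * a1_3) - K1_1 * b1_3 =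
    K1_2 * (
      6 * X1 ^ 4 + 55 * X1 ^ 2 * T1 ^ 2 + 16 * X1 ^ 2 * T1 * W1 - 3 * X1 ^ 2 * W1 ^ 2 - 75 * T1 ^ 4
      - 70 * T1 ^ 3 * W1 - 31 * T1 ^ 2 * W1 ^ 2 + 6 * T1 * W1 ^ 3)"
    unfolding a1_3_def b1_3_def by algebra
  show "5 * (K1_0 * a1_3) - K1_1 * b1_3 =
    K1_3 * (
      3 * X1 ^ 4 + 25 * X1 ^ 2 * T1 ^ 2 + 4 * X1 ^ 2 * T1 * W1 - 3 * X1 ^ 2 * W1 ^ 2 - 30 * T1 ^ 4
      - 10 * T1 ^ 3 * W1 + 5 * T1 ^ 2 * W1 ^ 2 + 6 * T1 * W1 ^ 3)"
    unfolding a1_3_def b1_3_def by algebra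
  show "K1_0 * a1_3 + K1_1 * b1_3 =
    (T1 + W1) * (
      37 * X1 ^ 4 * T1 - 3 * X1 ^ 4 * W1 + 155 * X1 ^ 2 * T1 ^ 3 - 93 * X1 ^ 2 * T1 ^ 2 * W1
      - 37 * X1 ^ 2 * T1 * W1 ^ 2 + 3 * X1 ^ 2 * W1 ^ 3 - 150 * T1 ^ 5 + 160 * T1 ^ 4 * W1
      - 127 * T1 ^ 3 * W1 ^ 2 + 61 * T1 ^ 2 * W1 ^ 3 - 6 * T1 * W1 ^ 4)"
    unfolding a1_3_def b1_3_def by algebra
qed

definition C1_1 :: S where "C1_1 = - (20 * T1\<^sup>2 * (T1 + W1))"
definition C1_2 :: S where "C1_2 = - (X1\<^sup>2 + 5 * T1\<^sup>2 - 2 * T1 * W1)"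
definition C1_3 :: S where "C1_3 = 15 * T1\<^sup>2 + W1\<^sup>2"

lemma relation1: "C1_1 * a1_1 + C1_2 * a1_2 + C1_3 * a1_3 = 0" "C1_1 * b1_1 + C1_2 * b1_2 + C1_3 * b1_3 = 0"
  unfolding C1_1_def C1_2_def C1_3_def a1_1_def a1_2_def a1_3_def b1_1_def b1_2_def b1_3_def
  by algebra+

lemma det1: "a1_1 * b1_2 - a1_2 * b1_1
    = 5 * C1_3 * (K1_2 * K1_3 * (T1 + W1))"
  unfolding C1_3_def a1_1_def a1_2_def b1_1_def b1_2_def by algebra

subsection \<open>Generators of the second arrangement\<close>

abbreviation U2 :: S where "U2 \<equiv> lf u2"
abbreviation V2 :: S where "V2 \<equiv> lf v2"

abbreviation H :: S where "H \<equiv> Const gold"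
abbreviation K2_0 :: S where "K2_0 \<equiv> ((2 * H - 3) * U2 + (3 - 2 * H) * V2)\<^sup>2 - X1\<^sup>2"
abbreviation K2_1 :: S where "K2_1 \<equiv> ((3 - 2 * H) * U2 + (2 * H - 1) * V2)\<^sup>2 - X1\<^sup>2"
abbreviation K2_2 :: S where "K2_2 \<equiv> ((2 - H) * U2 - V2)\<^sup>2 - X1\<^sup>2"
abbreviation K2_3 :: S where "K2_3 \<equiv> ((2 - H) * U2 + (4 * H - 7) * V2)\<^sup>2 - X1\<^sup>2"
abbreviation A2 :: "S \<Rightarrow> S \<Rightarrow> S" where "A2 a e \<equiv> V2 * e + (2 * H + 1) * K2_0 * a"

lemma H_square: "H\<^sup>2 = H + 1"
  using arg_cong[OF gold_square, of Const] by (simp add: Const_mult Const_add power2_eq_square)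

text \<open>The pair with number \<open>i\<close> is \<open>(A2 a2_i e2_i, V2 * e2_i)\<close>.
  Here \<open>2 H + 1\<close> is the inverse of \<open>2 H - 3\<close>, so \<open>a2_i\<close> is
  the cofactor of the first pair of lines and \<open>e2_i\<close> that of the unpaired
  line.\<close>

definition a2_1 :: S where
  "a2_1 =
    (1 + H) * X1 ^ 2 * U2 + (6 + 8 * H) * X1 ^ 2 * V2 + (H - 2) * U2 ^ 3 - 2 * U2 ^ 2 * V2
    + (11 * H - 13) * U2 * V2 ^ 2 + 10 * V2 ^ 3"

definition e2_1 :: S where
  "e2_1 =
    (4 * H - 2) * X1 ^ 2 * U2 ^ 2 - 4 * H * X1 ^ 2 * U2 * V2 - (8 + 24 * H) * X1 ^ 2 * V2 ^ 2
    + (32 - 20 * H) * U2 ^ 4 + (84 * H - 132) * U2 ^ 3 * V2 + (234 - 156 * H) * U2 ^ 2 * V2 ^ 2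
    + (132 * H - 176) * U2 * V2 ^ 3 + (40 - 40 * H) * V2 ^ 4"

definition a2_2 :: S where
  "a2_2 =
    (1 + H) * X1 ^ 4 + (H - 2) * X1 ^ 2 * U2 ^ 2 + (4 - 2 * H) * X1 ^ 2 * U2 * V2
    + (30 * H - 90) * X1 ^ 2 * V2 ^ 2 + (370 - 225 * H) * U2 ^ 2 * V2 ^ 2
    + (620 - 390 * H) * U2 * V2 ^ 3 + (225 * H - 375) * V2 ^ 4"

definition e2_2 :: S where
  "e2_2 =
    (4 * H - 2) * X1 ^ 4 * U2 - 4 * H * X1 ^ 4 * V2 + (32 - 20 * H) * X1 ^ 2 * U2 ^ 3
    + (324 - 216 * H) * X1 ^ 2 * U2 * V2 ^ 2 + (360 * H - 480) * X1 ^ 2 * V2 ^ 3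
    + (680 * H - 1100) * U2 ^ 4 * V2 + (4560 - 2820 * H) * U2 ^ 3 * V2 ^ 2
    + (6240 * H - 10080) * U2 ^ 2 * V2 ^ 3 + (8990 - 5580 * H) * U2 * V2 ^ 4
    + (1500 * H - 2400) * V2 ^ 5"

definition a2_3 :: S where
  "a2_3 =
    (6 + 8 * H) * X1 ^ 4 + (2 * H - 6) * X1 ^ 2 * U2 ^ 2 + (77 - 19 * H) * X1 ^ 2 * U2 * V2
    + 10 * X1 ^ 2 * V2 ^ 2 + (225 * H - 370) * U2 ^ 3 * V2 + (390 * H - 620) * U2 ^ 2 * V2 ^ 2
    + (375 - 225 * H) * U2 * V2 ^ 3"

definition e2_3 :: S where
  "e2_3 =
    - ((8 + 24 * H) * X1 ^ 4 * V2) + (84 * H - 132) * X1 ^ 2 * U2 ^ 3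
    + (60 * H - 90) * X1 ^ 2 * U2 ^ 2 * V2 + (304 - 228 * H) * X1 ^ 2 * U2 * V2 ^ 2
    + (40 - 40 * H) * X1 ^ 2 * V2 ^ 3 + (1100 - 680 * H) * U2 ^ 5 + (2820 * H - 4560) * U2 ^ 4 * V2
    + (10080 - 6240 * H) * U2 ^ 3 * V2 ^ 2 + (5580 * H - 8990) * U2 ^ 2 * V2 ^ 3
    + (2400 - 1500 * H) * U2 * V2 ^ 4"

definition a2_4 :: S where
  "a2_4 =
    - ((5 + 10 * H) * X1 ^ 4 * V2) + (5 * H - 5) * X1 ^ 2 * U2 ^ 2 * V2
    + (50 - 10 * H) * X1 ^ 2 * U2 * V2 ^ 2 + (60 * H - 70) * X1 ^ 2 * V2 ^ 3
    + (75 * H - 75) * U2 ^ 2 * V2 ^ 3 + (150 - 350 * H) * U2 * V2 ^ 4 + (75 + 350 * H) * V2 ^ 5"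

definition e2_4 :: S where
  "e2_4 =
    - ((260 + 420 * H) * X1 ^ 6) + (60 + 80 * H) * X1 ^ 4 * U2 ^ 2
    - (540 + 810 * H) * X1 ^ 4 * U2 * V2 + (1680 + 2640 * H) * X1 ^ 4 * V2 ^ 2
    + (20 * H - 40) * X1 ^ 2 * U2 ^ 4 + (420 - 140 * H) * X1 ^ 2 * U2 ^ 3 * V2
    - 1640 * X1 ^ 2 * U2 ^ 2 * V2 ^ 2 + (3080 + 1540 * H) * X1 ^ 2 * U2 * V2 ^ 3
    - (2420 + 2420 * H) * X1 ^ 2 * V2 ^ 4 + (500 - 300 * H) * U2 ^ 3 * V2 ^ 3
    + (1200 * H - 2100) * U2 ^ 2 * V2 ^ 4 + (2100 - 1050 * H) * U2 * V2 ^ 5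
    + (200 * H - 600) * V2 ^ 6"

lemma along2: "c2.along 0 A B = (2 * H - 3) * A + (3 - 2 * H) * B" "c2.along (Suc 0) A B = (3 - 2 * H) * A + (2 * H - 1) * B"
  "c2.along 2 A B = (2 - H) * A - B" "c2.along 3 A B = (2 - H) * A + (4 * H - 7) * B" "c2.along 4 A B = B"
  by (simp_all add: c2.along_def p2_def q2_def Const_diff Const_mult)

lemma quadric2: "c2.quadric 0 = K2_0"
  "c2.quadric (Suc 0) = K2_1"
  "c2.quadric 2 = K2_2" "c2.quadric 3 = K2_3"
  by (simp_all add: c2.quadric_def along2 m2_def)

lemma tangent2I:
  assumes "A = V2 * e + (2 * H + 1) * K2_0 * a" "B = V2 * e"
    "(3 - 2 * H) * A + (2 * H - 1) * B = K2_1 * b" "(2 - H) * A - B = K2_2 * c" "(2 - H) * A + (4 * H - 7) * B = K2_3 * d"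
  shows "c2.tangent A B"
proof -
  have "(2 * H - 3) * A + (3 - 2 * H) * B = K2_0 * a"
    using assms(1,2) H_square by algebra
  then show ?thesis unfolding c2.tangent_def nat_less_4_cases using assms by (auto simp: along2 quadric2)
qed

lemma tangent2_1: "c2.tangent (A2 a2_1 e2_1) (V2 * e2_1)"
proof (rule tangent2I[OF refl refl])
  show "(3 - 2 * H) * A2 a2_1 e2_1 + (2 * H - 1) * (V2 * e2_1) =
    K2_1 * (
      - ((1 + H) * X1 ^ 2 * U2) - (6 + 8 * H) * X1 ^ 2 * V2 + (2 - H) * U2 ^ 3
      + (2 - 4 * H) * U2 ^ 2 * V2 + (5 + 5 * H) * U2 * V2 ^ 2 - 10 * V2 ^ 3)"
    using H_square unfolding a2_1_def e2_1_def by algebra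
  show "(2 - H) * A2 a2_1 e2_1 - (V2 * e2_1) =
    K2_2 * (
      (1 + 2 * H) * X1 ^ 2 * U2 + (8 + 14 * H) * X1 ^ 2 * V2 + (3 - 2 * H) * U2 ^ 3
      + (6 - 4 * H) * U2 ^ 2 * V2 - (9 + 2 * H) * U2 * V2 ^ 2 + 10 * H * V2 ^ 3)"
    using H_square unfolding a2_1_def e2_1_def by algebra
  show "(2 - H) * A2 a2_1 e2_1 + (4 * H - 7) * (V2 * e2_1) =
    K2_3 * (
      (1 + 2 * H) * X1 ^ 2 * U2 + (8 + 14 * H) * X1 ^ 2 * V2 + (3 - 2 * H) * U2 ^ 3
      + (8 * H - 14) * U2 ^ 2 * V2 + (15 - 10 * H) * U2 * V2 ^ 2 + 10 * H * V2 ^ 3)"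
    using H_square unfolding a2_1_def e2_1_def by algebra
qed

lemma tangent2_2: "c2.tangent (A2 a2_2 e2_2) (V2 * e2_2)"
proof (rule tangent2I[OF refl refl])
  show "(3 - 2 * H) * A2 a2_2 e2_2 + (2 * H - 1) * (V2 * e2_2) =
    K2_1 * (
      - ((1 + H) * X1 ^ 4) + (2 - H) * X1 ^ 2 * U2 ^ 2 - (4 + 2 * H) * X1 ^ 2 * U2 * V2
      + (90 - 30 * H) * X1 ^ 2 * V2 ^ 2 + (305 * H - 490) * U2 ^ 2 * V2 ^ 2
      + (100 - 70 * H) * U2 * V2 ^ 3 + (375 - 225 * H) * V2 ^ 4)"
    using H_square unfolding a2_2_def e2_2_def by algebra
  show "(2 - H) * A2 a2_2 e2_2 - (V2 * e2_2) =
    K2_2 * (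
      (1 + 2 * H) * X1 ^ 4 + (3 - 2 * H) * X1 ^ 2 * U2 ^ 2 + (2 * H - 2) * X1 ^ 2 * U2 * V2
      + (30 - 60 * H) * X1 ^ 2 * V2 ^ 2 + (530 * H - 855) * U2 ^ 2 * V2 ^ 2
      + (610 - 370 * H) * U2 * V2 ^ 3 + (225 - 150 * H) * V2 ^ 4)"
    using H_square unfolding a2_2_def e2_2_def by algebra
  show "(2 - H) * A2 a2_2 e2_2 + (4 * H - 7) * (V2 * e2_2) =
    K2_3 * (
      (1 + 2 * H) * X1 ^ 4 + (3 - 2 * H) * X1 ^ 2 * U2 ^ 2 + (14 * H - 22) * X1 ^ 2 * U2 * V2
      + (30 - 60 * H) * X1 ^ 2 * V2 ^ 2 + (505 - 310 * H) * U2 ^ 2 * V2 ^ 2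
      + (450 * H - 730) * U2 * V2 ^ 3 + (225 - 150 * H) * V2 ^ 4)"
    using H_square unfolding a2_2_def e2_2_def by algebra
qed

lemma tangent2_3: "c2.tangent (A2 a2_3 e2_3) (V2 * e2_3)"
proof (rule tangent2I[OF refl refl])
  show "(3 - 2 * H) * A2 a2_3 e2_3 + (2 * H - 1) * (V2 * e2_3) =
    K2_1 * (
      - ((6 + 8 * H) * X1 ^ 4) + (6 - 2 * H) * X1 ^ 2 * U2 ^ 2 + (35 * H - 85) * X1 ^ 2 * U2 * V2
      - 10 * X1 ^ 2 * V2 ^ 2 + (490 - 305 * H) * U2 ^ 3 * V2 + (70 * H - 100) * U2 ^ 2 * V2 ^ 2
      + (225 * H - 375) * U2 * V2 ^ 3)"
    using H_square unfolding a2_3_def e2_3_def by algebra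
  show "(2 - H) * A2 a2_3 e2_3 - (V2 * e2_3) =
    K2_2 * (
      (8 + 14 * H) * X1 ^ 4 + (8 - 6 * H) * X1 ^ 2 * U2 ^ 2 + (58 * H - 39) * X1 ^ 2 * U2 * V2
      + 10 * H * X1 ^ 2 * V2 ^ 2 + (855 - 530 * H) * U2 ^ 3 * V2
      + (370 * H - 610) * U2 ^ 2 * V2 ^ 2 + (150 * H - 225) * U2 * V2 ^ 3)"
    using H_square unfolding a2_3_def e2_3_def by algebra
  show "(2 - H) * A2 a2_3 e2_3 + (4 * H - 7) * (V2 * e2_3) =
    K2_3 * (
      (8 + 14 * H) * X1 ^ 4 + (8 - 6 * H) * X1 ^ 2 * U2 ^ 2 + (50 * H - 15) * X1 ^ 2 * U2 * V2
      + 10 * H * X1 ^ 2 * V2 ^ 2 + (310 * H - 505) * U2 ^ 3 * V2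
      + (730 - 450 * H) * U2 ^ 2 * V2 ^ 2 + (150 * H - 225) * U2 * V2 ^ 3)"
    using H_square unfolding a2_3_def e2_3_def by algebra
qed

lemma tangent2_4: "c2.tangent (A2 a2_4 e2_4) (V2 * e2_4)"
proof (rule tangent2I[OF refl refl])
  show "(3 - 2 * H) * A2 a2_4 e2_4 + (2 * H - 1) * (V2 * e2_4) =
    K2_1 * (
      (525 + 850 * H) * X1 ^ 4 * V2 - (75 + 125 * H) * X1 ^ 2 * U2 ^ 2 * V2
      + (450 + 750 * H) * X1 ^ 2 * U2 * V2 ^ 2 - (650 + 1100 * H) * X1 ^ 2 * V2 ^ 3
      + (75 - 75 * H) * U2 ^ 2 * V2 ^ 3 + (250 * H - 250) * U2 * V2 ^ 4 + (125 - 150 * H) * V2 ^ 5)"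
    using H_square unfolding a2_4_def e2_4_def by algebra
  show "(2 - H) * A2 a2_4 e2_4 - (V2 * e2_4) =
    K2_2 * (
      - ((170 + 275 * H) * X1 ^ 4 * V2) + (10 + 15 * H) * X1 ^ 2 * U2 ^ 2 * V2
      - (170 + 280 * H) * X1 ^ 2 * U2 * V2 ^ 2 + (860 + 1390 * H) * X1 ^ 2 * V2 ^ 3
      + (150 - 75 * H) * U2 ^ 2 * V2 ^ 3 + (200 * H - 550) * U2 * V2 ^ 4 + (350 - 75 * H) * V2 ^ 5)"
    using H_square unfolding a2_4_def e2_4_def by algebra
  show "(2 - H) * A2 a2_4 e2_4 + (4 * H - 7) * (V2 * e2_4) =
    K2_3 * (
      - ((50 + 75 * H) * X1 ^ 4 * V2) + (50 - 25 * H) * X1 ^ 2 * U2 ^ 2 * V2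
      - 150 * X1 ^ 2 * U2 * V2 ^ 2 + (300 + 350 * H) * X1 ^ 2 * V2 ^ 3
      + (150 - 75 * H) * U2 ^ 2 * V2 ^ 3 - 250 * U2 * V2 ^ 4 + (150 + 125 * H) * V2 ^ 5)"
    using H_square unfolding a2_4_def e2_4_def by algebra
qed

definition C2_1 :: S where "C2_1 = - ((120 + 210 * H) * X1 ^ 2 * V2) - 75 * H * V2 ^ 3"
definition C2_2 :: S where "C2_2 = - ((58 + 94 * H) * X1 ^ 2) - (30 + 50 * H) * V2 ^ 2"
definition C2_3 :: S where "C2_3 = (8 + 13 * H) * X1 ^ 2"

lemma relation2_1: "X1\<^sup>2 * a2_1 = U2 * a2_2 + V2 * a2_3" "X1\<^sup>2 * e2_1 = U2 * e2_2 + V2 * e2_3"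
  using H_square unfolding a2_1_def a2_2_def a2_3_def e2_1_def e2_2_def e2_3_def by algebra+

lemma relation2_2: "U2 * a2_4 = C2_1 * a2_1 + C2_2 * a2_2 + C2_3 * a2_3"
  "U2 * e2_4 = C2_1 * e2_1 + C2_2 * e2_2 + C2_3 * e2_3"
  using H_square unfolding C2_1_def C2_2_def C2_3_def
    a2_1_def a2_2_def a2_3_def a2_4_def e2_1_def e2_2_def e2_3_def e2_4_def by algebra+

lemma det2: "a2_1 * e2_2 - a2_2 * e2_1 = - ((20 + 40 * H) * V2 * U2
    * (K2_1 * K2_2 * K2_3))"
  using H_square unfolding a2_1_def a2_2_def e2_1_def e2_2_def by algebra

subsection \<open>The two resolutions\<close>

context centred_arrangement
begin

lemma prod_lines:
  "(\<Prod>i\<in>{1..<10}. lf (lines i)) = quadric 0 * quadric 1 * quadric 2 * quadric 3 * along 4 Y1 Y2"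
proof -
  have "{1..<10} = {1, 2, 3, 4, 5, 6, 7, 8, 9 :: nat}" by auto
  moreover have "quadric 0 = lf (lines 1) * lf (lines 2)" "quadric 1 = lf (lines 3) * lf (lines 4)"
    "quadric 2 = lf (lines 5) * lf (lines 6)" "quadric 3 = lf (lines 7) * lf (lines 8)"
    using quadric_eq[of 0] quadric_eq[of 1] quadric_eq[of 2] quadric_eq[of 3]
    by (simp_all add: numeral_2_eq_2[symmetric])
  ultimately show ?thesis by (simp add: lines_special mult.assoc)
qed

lemma equation_eq: "equation = X * (quadric 0 * quadric 1 * quadric 2 * quadric 3 * along 4 Y1 Y2)"
proof -
  have "{..<10} = insert 0 {1..<10 :: nat}" by auto
  then have "equation = lf (lines 0) * (\<Prod>i\<in>{1..<10}. lf (lines i))"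
    unfolding equation_def by (simp del: One_nat_def)
  then show ?thesis unfolding prod_lines lines_special(1) .
qed

end

lemma fields1: "three_pairs (K1_0 * a1_1) (K1_1 * b1_1)
    (K1_0 * a1_2) (K1_1 * b1_2) (K1_0 * a1_3) (K1_1 * b1_3)
    C1_1 C1_2 C1_3 (Const 5 * (\<Prod>i\<in>{1..<10}. lf (c1.lines i)))"
proof
  have prod: "(\<Prod>i\<in>{1..<10}. lf (c1.lines i)) = K1_0 * K1_1 *
      (K1_2 * K1_3 * (T1 + W1))"
    unfolding c1.prod_lines by (simp only: quadric1 along1 One_nat_def mult.assoc)
  show "C1_1 * (K1_0 * a1_1) + C1_2 * (K1_0 * a1_2) + C1_3 * (K1_0 * a1_3) = 0"
    using relation1(1) by algebra
  show "C1_1 * (K1_1 * b1_1) + C1_2 * (K1_1 * b1_2) + C1_3 * (K1_1 * b1_3) = 0"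
    using relation1(2) by algebra
  have "K1_0 * a1_1 * (K1_1 * b1_2) - K1_0 * a1_2 * (K1_1 * b1_1)
      = K1_0 * K1_1 * (a1_1 * b1_2 - a1_2 * b1_1)" by algebra
  then show "K1_0 * a1_1 * (K1_1 * b1_2) - K1_0 * a1_2 * (K1_1 * b1_1)
      = C1_3 * (Const 5 * (\<Prod>i\<in>{1..<10}. lf (c1.lines i)))"
    unfolding prod det1 by (simp only: Const_numeral mult.assoc mult.left_commute)
  have "eval C1_3 (vector [1, 1 / 4, - 1 / 4]) \<noteq> 0"
    by (simp add: C1_3_def eval_simps eval_lf dot_def t1_def w1_def)
  then show "C1_3 \<noteq> 0" by (auto simp: eval_simps)
  show "Const 5 * (\<Prod>i\<in>{1..<10}. lf (c1.lines i)) \<noteq> 0" using c1.nonzero by simp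
qed

lemma square_minus_15: "\<exists>\<kappa> :: complex. \<kappa> * \<kappa> = - 15"
  using power2_csqrt[of "- 15"] unfolding power2_eq_square by blast

text \<open>Over the complex numbers the quadratic form \<open>C1_3\<close> in \<open>T1\<close>
  and \<open>W1\<close> is a product of two linear forms; on each of them the other two
  coefficients do not vanish identically.\<close>

lemma regular1:
  shows "C1_3 dvd b * C1_1 \<Longrightarrow> C1_3 dvd b" and "C1_3 dvd b * C1_2 \<Longrightarrow> C1_3 dvd b"
proof -
  obtain \<kappa> :: complex where \<kappa>: "\<kappa> * \<kappa> = - 15" using square_minus_15 by blast
  have \<kappa>1: "\<kappa> \<noteq> 1" "\<kappa> \<noteq> - 1" using \<kappa> by auto
  have C: "C1_3 = Const 1 * (lf (w1 - \<kappa> *s t1) * lf (w1 + \<kappa> *s t1))"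
    using arg_cong[OF \<kappa>, of Const]
    unfolding C1_3_def lf_simps Const_mult Const_uminus Const_numeral Const_1 by algebra
  have nz: "w1 - \<kappa> *s t1 \<noteq> 0" "w1 + \<kappa> *s t1 \<noteq> 0"
    using \<kappa>1 by (auto simp: w1_def t1_def vec_eq_iff forall_3)
  note P = nz[THEN prime_elem_lf]
  have val: "eval C1_1 (vector [0, 1 / 2 - c / 4, c / 4]) \<noteq> 0" if "c \<noteq> - 1" for c
  proof
    have "eval C1_1 (vector [0, 1 / 2 - c / 4, c / 4]) = - 20 * c - 20"
      by (simp add: C1_1_def eval_simps eval_lf dot_def t1_def w1_def algebra_simps)
    moreover assume "eval C1_1 (vector [0, 1 / 2 - c / 4, c / 4]) = 0"
    ultimately have "c = - 1" by algebra
    then show False using that by simp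
  qed
  have n1: "\<not> lf (w1 - \<kappa> *s t1) dvd C1_1"
    by (rule not_dvd_by_eval[OF _ val[OF \<kappa>1(2)]]) (simp add: eval_lf dot_simps, simp add: dot_def t1_def w1_def)
  have "- \<kappa> \<noteq> - 1" using \<kappa>1(1) by simp
  then have n2: "\<not> lf (w1 + \<kappa> *s t1) dvd C1_1"
    by (intro not_dvd_by_eval[OF _ val[of "- \<kappa>"]]) (simp_all add: eval_lf dot_simps, simp add: dot_def t1_def w1_def)
  have "\<not> lf (w1 + c *s t1) dvd C1_2" for c
    by (rule not_dvd_by_eval[of _ "vector [1, - 1 / 4, - 1 / 4]"])
       (simp_all add: C1_2_def eval_simps eval_lf dot_simps dot_def t1_def w1_def x1_def)
  from this[of "- \<kappa>"] this[of \<kappa>]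
  have n3: "\<not> lf (w1 - \<kappa> *s t1) dvd C1_2" "\<not> lf (w1 + \<kappa> *s t1) dvd C1_2" by simp_all
  have one: "(1 :: complex) \<noteq> 0" by simp
  show "C1_3 dvd b * C1_1 \<Longrightarrow> C1_3 dvd b" unfolding C by (rule cancel_two_primes[OF P n1 n2 one])
  show "C1_3 dvd b * C1_2 \<Longrightarrow> C1_3 dvd b" unfolding C by (rule cancel_two_primes[OF P n3 one])
qed

lemma koszul1:
  assumes "c1 * C1_1 + c2 * C1_2 + c3 * C1_3 = 0"
  shows "\<exists>w1 w2 w3. c1 = C1_2 * w3 - C1_3 * w2 \<and> c2 = C1_3 * w1 - C1_1 * w3 \<and> c3 = C1_1 * w2 - C1_2 * w1"
proof -
  define a :: "complex ^ 3" where "a = vector [1, - 1 / 4, - 1 / 4]"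
  let ?q = "5 * T1\<^sup>2 - 2 * T1 * W1"
  have a: "dot x1 a = 1" "dot t1 a = 0" "dot w1 a = 0"
    by (simp_all add: a_def dot_def x1_def t1_def w1_def)
  have fixed: "restrict_to x1 a T1 = T1" "restrict_to x1 a W1 = W1"
    using a by (simp_all add: restrict_to_lf)
  \<comment> \<open>The square of \<open>?q\<close> is in the ideal generated by the coprime
    forms \<open>C1_1\<close> and \<open>C1_3\<close>, so the product of \<open>C1_2\<close>
    with the conjugate factor is a fourth power modulo these.\<close>
  have "64 * Const (1 / 64) = 1" using Const_mult[of 64 "1 / 64"] by simp
  then have power: "X1 ^ 4 = C1_1 * (Const (1 / 64) * (67 * T1 - 3 * W1)) + C1_2 * (?q - X1\<^sup>2)
      + C1_3 * (Const (1 / 64) * (196 * T1\<^sup>2))"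
    unfolding C1_1_def C1_2_def C1_3_def by algebra
  show ?thesis
  proof (rule koszul_exact[OF _ _ a(1) _ _ power assms])
    show "C1_3 dvd b" if "C1_3 dvd b * C1_1" for b by (rule regular1(1)[OF that])
    show "C1_3 \<noteq> 0" by (rule three_pairs.nz(1)[OF fields1])
  qed (simp_all add: C1_1_def C1_3_def restrict_to_simps fixed)
qed

lemma resolution1:
  "has_minimal_graded_resolution [0, 0, 0] (AR c1.equation) (finite_resolution [[6, 6, 5], [8]])"
proof (rule c1.resolution_of_three_pairs[OF _ fields1 tangent1_1 tangent1_2 tangent1_3])
  show "homog 5 (K1_0 * a1_1)" "homog 5 (K1_1 * b1_1)"
    "homog 6 (K1_0 * a1_2)" "homog 6 (K1_1 * b1_2)"
    "homog 6 (K1_0 * a1_3)" "homog 6 (K1_1 * b1_3)"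
    unfolding a1_1_def a1_2_def a1_3_def b1_1_def b1_2_def b1_3_def
    by (rule homog_cong, (rule homog_rules | simp)+)+
  show "homog 3 C1_1" "homog 2 C1_2" "homog 2 C1_3"
    unfolding C1_1_def C1_2_def C1_3_def by (rule homog_cong, (rule homog_rules | simp)+)+
  show "\<exists>w1 w2 w3. c1 = C1_2 * w3 - C1_3 * w2 \<and> c2 = C1_3 * w1 - C1_1 * w3 \<and> c3 = C1_1 * w2 - C1_2 * w1"
    if "c1 * C1_1 + c2 * C1_2 + c3 * C1_3 = 0" for c1 c2 c3 by (rule koszul1[OF that])
  show "C1_3 dvd b" if "C1_3 dvd b * C1_2" for b by (rule regular1(2)[OF that])
qed simp

lemma fields2: "four_pairs (A2 a2_1 e2_1) (V2 * e2_1) (A2 a2_2 e2_2) (V2 * e2_2) (A2 a2_3 e2_3) (V2 * e2_3)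
    (A2 a2_4 e2_4) (V2 * e2_4) C2_1 C2_2 C2_3
    (Const (100 + 160 * gold) * (\<Prod>i\<in>{1..<10}. lf (c2.lines i))) x1 u2 v2"
proof
  define D where "D = (2 * H + 1) * K2_0"
  have A2: "A2 a e = V2 * e + D * a" for a e
    by (simp add: D_def)
  have "X1\<^sup>2 * (V2 * e2_1 + D * a2_1) = V2 * (X1\<^sup>2 * e2_1) + D * (X1\<^sup>2 * a2_1)" by (simp add: algebra_simps)
  then show "X1\<^sup>2 * A2 a2_1 e2_1 = U2 * A2 a2_2 e2_2 + V2 * A2 a2_3 e2_3"
    unfolding A2 relation2_1 by (simp add: algebra_simps)
  have "X1\<^sup>2 * (V2 * e2_1) = V2 * (X1\<^sup>2 * e2_1)" by (simp add: algebra_simps)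
  then show "X1\<^sup>2 * (V2 * e2_1) = U2 * (V2 * e2_2) + V2 * (V2 * e2_3)"
    unfolding relation2_1 by (simp add: algebra_simps)
  have "U2 * (V2 * e2_4 + D * a2_4) = V2 * (U2 * e2_4) + D * (U2 * a2_4)" by (simp add: algebra_simps)
  then show "U2 * A2 a2_4 e2_4 = C2_1 * A2 a2_1 e2_1 + C2_2 * A2 a2_2 e2_2 + C2_3 * A2 a2_3 e2_3"
    unfolding A2 relation2_2 by (simp add: algebra_simps)
  have "U2 * (V2 * e2_4) = V2 * (U2 * e2_4)" by (simp add: algebra_simps)
  then show "U2 * (V2 * e2_4) = C2_1 * (V2 * e2_1) + C2_2 * (V2 * e2_2) + C2_3 * (V2 * e2_3)"
    unfolding relation2_2 by (simp add: algebra_simps)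
  have k: "Const (100 + 160 * gold) = (2 * H + 1) * (20 + 40 * H)"
    using H_square unfolding Const_add Const_mult Const_numeral by algebra
  have "(V2 * e2_1 + D * a2_1) * (V2 * e2_2) - (V2 * e2_2 + D * a2_2) * (V2 * e2_1)
      = D * V2 * (a2_1 * e2_2 - a2_2 * e2_1)" by (simp add: algebra_simps)
  also have "\<dots> = - (V2 * U2 * (Const (100 + 160 * gold) * (\<Prod>i\<in>{1..<10}. lf (c2.lines i))))"
    unfolding c2.prod_lines det2 k D_def
    unfolding One_nat_def quadric2 along2
    by (simp only: mult_minus_right mult_ac)
  finally show "A2 a2_1 e2_1 * (V2 * e2_2) - A2 a2_2 e2_2 * (V2 * e2_1)
      = - (V2 * U2 * (Const (100 + 160 * gold) * (\<Prod>i\<in>{1..<10}. lf (c2.lines i))))"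
    unfolding A2 .
  show "Const (100 + 160 * gold) * (\<Prod>i\<in>{1..<10}. lf (c2.lines i)) \<noteq> 0"
    using c2.nonzero gold_nonzero[of 100 160] by simp
  show "det3 x1 u2 v2 \<noteq> 0" by (rule c2.basis)
qed

text \<open>On each of the two lines \<open>C2_2 = 0\<close> the other form takes the value 80
  times the golden ratio at a point with \<open>V2 = 1\<close>.\<close>

lemma regular2:
  assumes "C2_2 dvd b * (C2_1 * V2 + C2_3 * X1\<^sup>2)" shows "C2_2 dvd b"
proof -
  obtain \<kappa> :: complex where \<kappa>: "\<kappa> * \<kappa> = 4 * gold - 7"
    using power2_csqrt[of "4 * gold - 7"] unfolding power2_eq_square by blast
  have C: "C2_2 = Const (- 58 - 94 * gold) * (lf (x1 - \<kappa> *s v2) * lf (x1 + \<kappa> *s v2))"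
    using arg_cong[OF \<kappa>, of Const] H_square
    unfolding C2_2_def lf_simps Const_mult Const_diff Const_add Const_uminus Const_numeral by algebra
  have "x1 + c *s v2 \<noteq> 0" for c by (auto simp: x1_def v2_def vec_eq_iff forall_3)
  from this[of \<kappa>] this[of "- \<kappa>"] have nz: "x1 - \<kappa> *s v2 \<noteq> 0" "x1 + \<kappa> *s v2 \<noteq> 0" by simp_all
  note P = nz[THEN prime_elem_lf]
  have val: "eval (C2_1 * V2 + C2_3 * X1\<^sup>2) (vector [c, 1 - c, 0]) \<noteq> 0" if "c * c = 4 * gold - 7" for c
  proof -
    have "eval (C2_1 * V2 + C2_3 * X1\<^sup>2) (vector [c, 1 - c, 0]) = 80 * gold"
      using that gold_square
      by (simp add: C2_1_def C2_3_def eval_simps eval_lf dot_def v2_def x1_def power2_eq_square) algebra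
    then show ?thesis using gold_nonzero[of 0 80] by simp
  qed
  have "\<not> lf (x1 - \<kappa> *s v2) dvd C2_1 * V2 + C2_3 * X1\<^sup>2"
    by (rule not_dvd_by_eval[OF _ val[OF \<kappa>]]) (simp add: eval_lf dot_simps, simp add: dot_def x1_def v2_def)
  moreover have "\<not> lf (x1 + \<kappa> *s v2) dvd C2_1 * V2 + C2_3 * X1\<^sup>2"
    by (rule not_dvd_by_eval[OF _ val[of "- \<kappa>"]]) (simp_all add: \<kappa> eval_lf dot_simps, simp add: dot_def x1_def v2_def)
  moreover have "- 58 - 94 * gold \<noteq> 0" using gold_nonzero[of "- 58" "- 94"] by simp
  ultimately show ?thesis using cancel_two_primes[OF P] assms unfolding C by blast
qed

lemma resolution2:
  "has_minimal_graded_resolution [0, 0, 0] (AR c2.equation) (finite_resolution [[7, 6, 6, 5], [8, 7]])"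
proof -
  define a :: "complex ^ 3" where "a = vector [0, 5 - 3 * gold, (8 * gold - 13) / 2]"
  define b :: "complex ^ 3" where "b = vector [0, gold - 2, (7 - 4 * gold) / 2]"
  have dots: "dot u2 a = 1" "dot x1 a = 0" "dot v2 a = 0" "dot v2 b = 1" "dot x1 b = 0" "dot u2 b = 0"
    unfolding a_def b_def dot_def x1_def u2_def v2_def vector_3 using gold_square by (simp_all add: field_simps) algebra+
  have fixed: "restrict_to u2 a X1 = X1" "restrict_to u2 a V2 = V2"
    using dots by (simp_all add: restrict_to_lf)
  show ?thesis
  proof (rule c2.resolution_of_four_pairs[OF _ fields2 tangent2_1 tangent2_2 tangent2_3 tangent2_4])
    show "dot u2 a = 1" "dot x1 a = 0" "dot v2 a = 0" "dot v2 b = 1" "dot x1 b = 0" "dot u2 b = 0"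
      by (fact dots)+
    show "restrict_to u2 a C2_1 = C2_1" "restrict_to u2 a C2_2 = C2_2" "restrict_to u2 a C2_3 = C2_3"
      unfolding C2_1_def C2_2_def C2_3_def by (simp_all add: restrict_to_simps fixed)
    show "homog 5 (A2 a2_1 e2_1)" "homog 5 (V2 * e2_1)" "homog 6 (A2 a2_2 e2_2)" "homog 6 (V2 * e2_2)"
      "homog 6 (A2 a2_3 e2_3)" "homog 6 (V2 * e2_3)" "homog 7 (A2 a2_4 e2_4)" "homog 7 (V2 * e2_4)"
      unfolding a2_1_def a2_2_def a2_3_def a2_4_def e2_1_def e2_2_def e2_3_def e2_4_def
      by (rule homog_cong, (rule homog_rules | simp)+)+
    show "homog 3 C2_1" "homog 2 C2_2" "homog 2 C2_3"
      unfolding C2_1_def C2_2_def C2_3_def by (rule homog_cong, (rule homog_rules | simp)+)+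
    show "100 + 160 * gold \<noteq> 0" using gold_nonzero[of 100 160] by simp
    show "C2_2 dvd b" if "C2_2 dvd b * (C2_1 * V2 + C2_3 * X1\<^sup>2)" for b by (rule regular2[OF that])
    have "eval C2_2 (vector [1, - 1, 0]) \<noteq> 0"
      using gold_nonzero[of "- 58" "- 94"] by (simp add: C2_2_def eval_simps eval_lf dot_def x1_def v2_def)
    then show "C2_2 \<noteq> 0" by (auto simp: eval_simps)
  qed
qed

section \<open>The Ziegler pair\<close>

text \<open>The factors of \<open>Q\<close> are the ten lines up to scalars; pairs of lines are
  compared at once as quadrics.\<close>

lemma Q1_equation: "\<exists>\<kappa>. \<kappa> \<noteq> 0 \<and> Q 5 3 = Const \<kappa> * c1.equation"
proof -
  let ?l = "\<lambda>a b c. linear_form a b c"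
  have q: "c1.quadric 0 = 4 * (?l 0 1 1 * ?l 1 1 1)" "c1.quadric (Suc 0) = - 8 * (Var 3 * ?l (- 1) 0 (- 2))"
    "c1.quadric 2 = 8 * (Var 2 * ?l 1 2 0)" "c1.quadric 3 = 4 * (?l 1 5 3 * ?l 3 5 3)"
    unfolding quadric1
    unfolding lf_def linear_form_def x1_def t1_def w1_def vector_3 Const_0 Const_1 Const_numeral Const_uminus
    by algebra+
  have l: "3 * c1.along 4 T1 W1 = - ?l (- 6) (- 6) (- 18)"
    by (simp add: along1 lf_def linear_form_def x1_def t1_def w1_def)
  have x: "X1 = Var 1" by (simp add: lf_def linear_form_def x1_def)
  have Q: "Q 5 3 = Var 1 * Var 2 * Var 3 * ?l 3 5 3 * ?l 0 1 1 * ?l 1 1 1 * ?l 1 5 3 * ?l (- 1) 0 (- 2)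
      * ?l 1 2 0 * ?l (- 6) (- 6) (- 18)"
    by (simp add: Q_def)
  have "3 * c1.equation = 1024 * Q 5 3"
    unfolding c1.equation_eq One_nat_def Q using q l x by algebra
  then have e: "Const (1 / 1024) * (3 * c1.equation) = Const (1 / 1024) * (1024 * Q 5 3)" by (simp only:)
  have c: "Const (1 / 1024) * 1024 = 1" "Const (1 / 1024) * 3 = Const (3 / 1024)"
    using Const_mult[of "1 / 1024" 1024] Const_mult[of "1 / 1024" 3] by simp_all
  have "Q 5 3 = Const (1 / 1024) * 1024 * Q 5 3" unfolding c(1) by simp
  also have "\<dots> = Const (1 / 1024) * 3 * c1.equation" unfolding mult.assoc by (rule e[symmetric])
  finally have "Q 5 3 = Const (3 / 1024) * c1.equation" unfolding c(2) .
  then show ?thesis by (intro exI[of _ "3 / 1024"]) simp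
qed

text \<open>With \<open>j = (gold + 1) / 2\<close> the parameters are \<open>5 j\<close> and
  \<open>4 j\<close>, so no square root appears in the coefficients.\<close>

lemma Q2_equation:
  "\<exists>\<kappa>. \<kappa> \<noteq> 0 \<and> Q (complex_of_real ((5 * sqrt 5 + 15) / 4)) (complex_of_real (sqrt 5 + 3)) = Const \<kappa> * c2.equation"
proof -
  define j where "j = (gold + 1) / 2"
  let ?l = "\<lambda>a b c. linear_form a b c" and ?J = "Const j"
  have st: "complex_of_real ((5 * sqrt 5 + 15) / 4) = 5 * j" "complex_of_real (sqrt 5 + 3) = 4 * j"
    by (simp_all add: sqrt5_gold j_def field_simps)
  have "gold = 2 * j - 1" by (simp add: j_def field_simps)
  from arg_cong[OF this, of Const] have HJ: "H = 2 * ?J - 1" by (simp add: Const_diff Const_mult)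
  have J: "4 * ?J\<^sup>2 = 6 * ?J - 1" using H_square HJ by algebra
  let ?f9 = "?l (- (5 * j) * (4 * j)\<^sup>2 + 5 * j * (4 * j) + (4 * j) ^ 3 - 4 * j) (- (5 * j) * (4 * j) + (4 * j)\<^sup>2)
      (- (5 * j) * (4 * j)\<^sup>2 + (4 * j) ^ 3)"
  note expand = lf_def linear_form_def x1_def u2_def v2_def vector_3 power2_eq_square power3_eq_cube
    Const_add Const_diff Const_mult Const_0 Const_1 Const_numeral Const_uminus
  have q: "c2.quadric 0 = 4 * (?l 0 1 1 * ?l 1 1 1)"
    "c2.quadric (Suc 0) = (2 + 4 * H) * (- 4 * H) * (Var 3 * ?l (- (5 * j) + 4 * j + 1) 0 (- (5 * j) + 4 * j))"
    "c2.quadric 2 = (1 + H) * 2 * (Var 2 * ?l 1 (5 * j - 4 * j) 0)"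
    "c2.quadric 3 = (4 * H - 6)\<^sup>2 * (?l 1 (5 * j) (4 * j) * ?l (4 * j) (5 * j) (4 * j))"
    unfolding quadric2 unfolding expand using HJ J by algebra+
  have l: "c2.along 4 U2 V2 = (3 * H - 5) * ?f9"
    unfolding along2 unfolding expand using HJ J by algebra
  have x: "X1 = Var 1" by (simp add: lf_def linear_form_def x1_def)
  define \<gamma> where "\<gamma> = 4 * ((2 + 4 * gold) * (- 4 * gold)) * ((1 + gold) * 2) * (4 * gold - 6)\<^sup>2 * (3 * gold - 5)"
  have \<gamma>: "Const \<gamma> = 4 * ((2 + 4 * H) * (- 4 * H)) * ((1 + H) * 2) * (4 * H - 6)\<^sup>2 * (3 * H - 5)"
    by (simp add: \<gamma>_def Const_add Const_diff Const_mult power2_eq_square)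
  have "c2.equation = Const \<gamma> * Q (5 * j) (4 * j)"
    unfolding c2.equation_eq One_nat_def q l x \<gamma> Q_def by (simp only: mult_ac)
  moreover have "\<gamma> \<noteq> 0"
    unfolding \<gamma>_def mult_eq_0_iff power_eq_0_iff
    using gold_nonzero[of 2 4] gold_nonzero[of 0 1] gold_nonzero[of 1 1] gold_nonzero[of "- 6" 4] gold_nonzero[of "- 5" 3]
    by simp
  moreover from this have "Const (1 / \<gamma>) * Const \<gamma> = 1" by (simp flip: Const_mult)
  ultimately have "Q (5 * j) (4 * j) = Const (1 / \<gamma>) * c2.equation" by (simp flip: mult.assoc)
  then show ?thesis using \<open>\<gamma> \<noteq> 0\<close> unfolding st by (intro exI[of _ "1 / \<gamma>"]) simp
qed

theorem mainTheorem2: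
  shows "let Q1 = Q 5 3;
             Q2 = Q (complex_of_real ((5 * sqrt 5 + 15) / 4)) (complex_of_real (sqrt 5 + 3))
    in
      card (arrangement Q1) = 10 \<and>
      card (arrangement Q2) = 10 \<and>
      isomorphic_lattices (arrangement Q1) (arrangement Q2) \<and>
      has_minimal_graded_resolution [0, 0, 0] (AR Q1)
        (finite_resolution [[6, 6, 5], [8]]) \<and>
      has_minimal_graded_resolution [0, 0, 0] (AR Q2)
        (finite_resolution [[7, 6, 6, 5], [8, 7]]) \<and>
      ziegler_pair_2 Q1 Q2"
proof -
  define Q1 where "Q1 = Q 5 3"
  define Q2 where "Q2 = Q (complex_of_real ((5 * sqrt 5 + 15) / 4)) (complex_of_real (sqrt 5 + 3))"
  obtain \<kappa>1 where \<kappa>1: "\<kappa>1 \<noteq> 0" "Q1 = Const \<kappa>1 * c1.equation" using Q1_equation unfolding Q1_def by blast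
  obtain \<kappa>2 where \<kappa>2: "\<kappa>2 \<noteq> 0" "Q2 = Const \<kappa>2 * c2.equation" using Q2_equation unfolding Q2_def by blast
  have arr: "arrangement Q1 = (\<lambda>i. line (c1.lines i)) ` {..<10}" "arrangement Q2 = (\<lambda>i. line (c2.lines i)) ` {..<10}"
    using arrangement_prod \<kappa>1 \<kappa>2 c1.nonzero c2.nonzero unfolding c1.equation_def c2.equation_def by blast+
  have card: "card (arrangement Q1) = 10" "card (arrangement Q2) = 10"
    using card_arrangement_prod \<kappa>1 \<kappa>2 c1.nonzero c2.nonzero c1.distinct c2.distinct
    unfolding c1.equation_def c2.equation_def by blast+
  have iso: "isomorphic_lattices (arrangement Q1) (arrangement Q2)"
    unfolding arr
    by (rule isomorphic_lattices_of_triples[OF c1.simple c2.simple])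
       (rule same_triples_det[OF tables(3) lines1 lines2])
  have res: "has_minimal_graded_resolution [0, 0, 0] (AR Q1) (finite_resolution [[6, 6, 5], [8]])"
    "has_minimal_graded_resolution [0, 0, 0] (AR Q2) (finite_resolution [[7, 6, 6, 5], [8, 7]])"
    using resolution1 resolution2 \<kappa>1 \<kappa>2 by (simp_all add: AR_scale)
  have "different_graded_betti [0, 0, 0] (AR Q1) (AR Q2)"
    by (rule different_graded_betti_of_degree[OF res, of 7]) (simp_all add: finite_resolution_def)
  then have "ziegler_pair_2 Q1 Q2" using iso by (simp add: ziegler_pair_2_def)
  then show ?thesis using card iso res unfolding Let_def Q1_def Q2_def by blast
qed

end
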